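(* Let $s\in(0,1)$, and let $\mathcal{C}_s$ be the class of sets $E\subseteq\mathbb{R}^2$ with $\dim_H(E)\le s$. Then: (1) There exists some $\mathcal{D}\subseteq \mathcal{S}^1$ of lower box dimension $0$ and packing dimension $s$ that is universal for $\mathcal{C}_{AD}\cap\mathcal{C}_s$. (2) For every $\varepsilon\in(0,1)$ there exists some $\mathcal{D}_\varepsilon\subseteq \mathcal{S}^1$ of lower box dimension $\varepsilon$ and packing dimension $s$ that is universal for $\mathcal{C}_{WR}\cap\mathcal{C}_s$.
   Context: $\mathcal{S}^1$ is the unit circle in $\mathbb{R}^2$. For $e\in\mathcal{S}^1$ and $x\in\mathbb{R}^2$, $p_ex=e\cdot x$ and $p_eE=\{p_ex:x\in E\}$. A set $\mathcal{D}\subseteq\mathcal{S}^1$ is universal for a class $\mathcal{C}$ of subsets of $\mathbb{R}^2$ if for every $E\in\mathcal{C}$ there is some $e\in\mathcal{D}$ such that $\dim_H(p_eE)=\min\{\dim_H(E),1\}$. $\dim_H$ and $\dim_P$ are Hausdorff and packing dimension. $\mathcal{C}_{WR}$ is the class of weakly regular subsets of $\mathbb{R}^2$, i.e. those with $\dim_H(E)=\dim_P(E)$. $\mathcal{C}_{AD}$ is the class of AD-regular subsets of $\mathbb{R}^2$: a closed set $E\subseteq\mathbb{R}^n$ is $(\alpha,C)$-AD-regular, with $\alpha\ge0$ and $C\ge1$, if $C^{-1}r^\alpha\le\mathcal{H}^\alpha(E\cap B(x,r))\le Cr^\alpha$ for all $x\in E$ and $0<r<\operatorname{diam}(E)$,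 and AD-regular if it is $(\alpha,C)$-AD-regular for some $\alpha$ and $C$; $\mathcal{H}^\alpha$ is $\alpha$-dimensional Hausdorff measure. *)

theory Defs
  imports "HOL-Analysis.Analysis"
begin

(* The s-th power of the diameter, with the convention that the empty set has weight 0 and every
   nonempty set has weight 1 when s = 0 (note that "0 powr 0 = 0"), so that the 0-dimensional
   Hausdorff measure is the counting measure. *)
definition diam_weight :: "real \<Rightarrow> 'a::metric_space set \<Rightarrow> ennreal" where
  "diam_weight s U =
     (if U = {} then 0 else if s = 0 then 1 else ennreal (diameter U powr s))"

(* "diameter" is only meaningful on bounded sets, hence the explicit boundedness. Empty members
   are allowed, so finite covers are included. *)
definition hausdorff_premeasure :: "real \<Rightarrow> real \<Rightarrow> 'a::metric_space set \<Rightarrow> ennreal" where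
  "hausdorff_premeasure s \<delta> E =
     (INF U \<in> {U :: nat \<Rightarrow> 'a set. E \<subseteq> (\<Union>i. U i) \<and> (\<forall>i. bounded (U i) \<and> diameter (U i) \<le> \<delta>)}.
        \<Sum>i. diam_weight s (U i))"

definition hausdorff_measure :: "real \<Rightarrow> 'a::metric_space set \<Rightarrow> ennreal" where
  "hausdorff_measure s E = (SUP \<delta> \<in> {0<..}. hausdorff_premeasure s \<delta> E)"

definition hausdorff_dim :: "'a::metric_space set \<Rightarrow> ereal" where
  "hausdorff_dim E = (INF s \<in> {s. 0 \<le> s \<and> hausdorff_measure s E = 0}. ereal s)"

(* A packing is given by the centre-radius pairs of its pairwise disjoint closed balls. *)
definition packings :: "real \<Rightarrow> 'a::metric_space set \<Rightarrow> ('a \<times> real) set set" where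
  "packings \<delta> E =
     {P. countable P \<and> P \<subseteq> E \<times> {0<..\<delta>} \<and> disjoint_family_on (\<lambda>(x, r). cball x r) P}"

definition packing_premeasure :: "real \<Rightarrow> 'a::metric_space set \<Rightarrow> ennreal" where
  "packing_premeasure s E =
     (INF \<delta> \<in> {0<..}. SUP P \<in> packings \<delta> E. \<Sum>\<^sub>\<infinity>(x, r)\<in>P. ennreal ((2 * r) powr s))"

(* The premeasure is not countably subadditive; the packing measure is obtained from it by
   passing to countable covers. *)
definition packing_measure :: "real \<Rightarrow> 'a::metric_space set \<Rightarrow> ennreal" where
  "packing_measure s E =
     (INF A \<in> {A :: nat \<Rightarrow> 'a set. E \<subseteq> (\<Union>i. A i)}. \<Sum>i. packing_premeasure s (A i))"

definition packing_dim :: "'a::metric_space set \<Rightarrow> ereal" where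
  "packing_dim E = (INF s \<in> {s. 0 \<le> s \<and> packing_measure s E = 0}. ereal s)"

(* Only meaningful for totally bounded E, e.g. for bounded subsets of a Euclidean space. *)
definition covering_number :: "real \<Rightarrow> 'a::metric_space set \<Rightarrow> nat" where
  "covering_number \<delta> E =
     (LEAST n. \<exists>F. finite F \<and> card F = n \<and> E \<subseteq> \<Union>F \<and> (\<forall>U\<in>F. bounded U \<and> diameter U \<le> \<delta>))"

definition lower_box_dim :: "'a::metric_space set \<Rightarrow> ereal" where
  "lower_box_dim E =
     Liminf (at_right 0) (\<lambda>\<delta>. ereal (ln (real (covering_number \<delta> E)) / (- ln \<delta>)))"

definition weakly_regular :: "'a::metric_space set \<Rightarrow> bool" where
  "weakly_regular E \<longleftrightarrow> hausdorff_dim E = packing_dim E"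

(* An unbounded set has infinite diameter, so then all radii r > 0 are considered. *)
definition AD_regular_with :: "real \<Rightarrow> real \<Rightarrow> 'a::metric_space set \<Rightarrow> bool" where
  "AD_regular_with \<alpha> C E \<longleftrightarrow>
     closed E \<and>
     (\<forall>x\<in>E. \<forall>r>0. (bounded E \<longrightarrow> r < diameter E) \<longrightarrow>
        ennreal (inverse C * r powr \<alpha>) \<le> hausdorff_measure \<alpha> (E \<inter> cball x r) \<and>
        hausdorff_measure \<alpha> (E \<inter> cball x r) \<le> ennreal (C * r powr \<alpha>))"

definition AD_regular :: "'a::metric_space set \<Rightarrow> bool" where
  "AD_regular E \<longleftrightarrow> (\<exists>\<alpha> C. 0 \<le> \<alpha> \<and> 1 \<le> C \<and> AD_regular_with \<alpha> C E)"

definition class_WR :: "(real^2) set set" where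
  "class_WR = {E. weakly_regular E}"

definition class_AD :: "(real^2) set set" where
  "class_AD = {E. AD_regular E}"

definition class_dim_le :: "real \<Rightarrow> (real^2) set set" where
  "class_dim_le s = {E. hausdorff_dim E \<le> ereal s}"

definition proj :: "real^2 \<Rightarrow> real^2 \<Rightarrow> real" where
  "proj e x = e \<bullet> x"

definition universal_for :: "(real^2) set \<Rightarrow> (real^2) set set \<Rightarrow> bool" where
  "universal_for D \<C> \<longleftrightarrow>
     D \<subseteq> sphere 0 1 \<and>
     (\<forall>E\<in>\<C>. \<exists>e\<in>D. hausdorff_dim (proj e ` E) = min (hausdorff_dim E) 1)"

end

theory Submission
  imports Defs "HOL-Probability.Probability" "HOL-Real_Asymp.Real_Asymp"
begin

text \<open>
  Directions are taken with random slopes whose binary digits are free, with density \<open>s\<close>, in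
  windows \<open>[a k, b k)\<close> with \<open>b k / a k\<close> tending to infinity, and frozen in the gaps
  \<open>[b k, a (k+1))\<close>. Just after a gap only about \<open>2 powr (s b k)\<close> directions can be told apart at
  scale \<open>2 powr - a (k+1)\<close>, which makes the lower box dimension small, while the ends of the
  windows give packing dimension \<open>s\<close>. A countable set of directions of box dimension
  \<open>\<epsilon>\<close> is added to make the lower box dimension exactly \<open>\<epsilon>\<close>.

  For universality, Kaufman's argument is run on covers by dyadic cells instead of measures, so
  that no measurability of \<open>E\<close> is needed: if two cells are \<open>2 ^ i\<close> cells apart, their
  projections collide with probability about \<open>2 powr (- s i)\<close>, and if cells have about
  \<open>2 powr (t i)\<close> subcells \<open>i\<close> levels below with \<open>t \<le> s\<close>, then few cells collide with many others.
  A scale inside a gap is reached through several equal blocks of levels, each short enough to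
  lie within the last window; since a cell of level \<open>j l\<close> sees only the first \<open>l\<close> digits of the
  slope relative to its own size, each block can be treated separately. The loss per block is a
  constant factor for AD-regular sets, so the gaps may be arbitrarily long, whereas for weakly
  regular sets it is exponential in the level with a small exponent, which is harmless only for a
  bounded number of blocks. Deleting the cells that collide too often for a suitable direction
  leaves a set of positive Hausdorff content on which the projection has small fibres.\<close>

section \<open>Hausdorff content\<close>

text \<open>The error terms dictate the order of choices. The tolerance \<open>\<theta>\<close>
  fixes \<open>M\<close>, about \<open>4 / \<theta>\<close>, so that the digits before the current
  window matter little for a block of length at least \<open>M * win_start R k\<close>; then a scale
  needs at most \<open>M * R k\<close> blocks. Over \<open>i\<close> blocks of length
  \<open>l\<close> the regularity error is about \<open>2 powr (3 * \<eta> * i * l)\<close>, while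
  Markov's inequality gains only \<open>2 powr (\<theta> * l)\<close>. This is the origin of
  \<open>12 * \<eta> * i \<le> \<theta>\<close>: if \<open>R\<close> is bounded,
  \<open>\<eta>\<close> can be chosen last, and if \<open>R\<close> is unbounded,
  \<open>\<eta>\<close> must be 0. On the other side the gaps give lower box dimension at most the
  limit of \<open>s / R k\<close>, which decides between the two choices of \<open>R\<close>. The
  condition \<open>i * i \<le> N\<close> keeps \<open>l\<close> near or above \<open>sqrt N\<close>,
  so that the errors are summable over all scales \<open>N\<close>.

  Universality asks for equality of dimensions in a single direction, not for an approximation. The
  tolerances \<open>1 / Suc k\<close> are therefore treated on one probability space, with expected
  relative losses adding up to at most 1/2.\<close>

definition bounded_covers :: "'a::metric_space set \<Rightarrow> (nat \<Rightarrow> 'a set) set" where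
  "bounded_covers A = {U. A \<subseteq> (\<Union>i. U i) \<and> (\<forall>i. bounded (U i))}"

text \<open>For positive exponents it vanishes together with the measure, but it is finite on
  bounded sets. It can thus serve as a budget from which deleted cells are subtracted.\<close>

definition hausdorff_content :: "real \<Rightarrow> 'a::metric_space set \<Rightarrow> ennreal" where
  "hausdorff_content \<tau> A = (INF U \<in> bounded_covers A. \<Sum>i. diam_weight \<tau> (U i))"

lemma diam_weight_empty [simp]: "diam_weight \<tau> {} = 0"
  by (simp add: diam_weight_def)

lemma hausdorff_content_le_cover:
  assumes "A \<subseteq> (\<Union>i. U i)" "\<And>i. bounded (U i)"
  shows "hausdorff_content \<tau> A \<le> (\<Sum>i. diam_weight \<tau> (U i))"
  unfolding hausdorff_content_def bounded_covers_def using assms by (intro INF_lower) auto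

lemma hausdorff_content_mono:
  assumes "A \<subseteq> B"
  shows "hausdorff_content \<tau> A \<le> hausdorff_content \<tau> B"
  unfolding hausdorff_content_def bounded_covers_def
  using assms by (intro INF_superset_mono) auto

lemma hausdorff_content_le_diam_weight:
  assumes "bounded U"
  shows "hausdorff_content \<tau> U \<le> diam_weight \<tau> U"
proof -
  have "hausdorff_content \<tau> U \<le> (\<Sum>i. diam_weight \<tau> ((\<lambda>i. if i = 0 then U else {}) i))"
    by (rule hausdorff_content_le_cover) (use assms in auto)
  also have "\<dots> = (\<Sum>i\<in>{0::nat}. diam_weight \<tau> ((\<lambda>i. if i = 0 then U else {}) i))"
    by (rule suminf_finite) auto
  finally show ?thesis by simp
qed

lemma hausdorff_content_empty [simp]: "hausdorff_content \<tau> {} = 0"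
  using hausdorff_content_le_diam_weight[of "{}" \<tau>] by simp

text \<open>Near-optimal covers of all \<open>A n\<close>, with errors \<open>e / 2 ^ Suc n\<close>,
  are interleaved by \<open>prod_decode\<close>. Strictly better covers exist only for finite
  contents; otherwise the right-hand side is already infinite.\<close>

lemma hausdorff_content_UN_le:
  fixes A :: "nat \<Rightarrow> 'a::metric_space set"
  shows "hausdorff_content \<tau> (\<Union>n. A n) \<le> (\<Sum>n. hausdorff_content \<tau> (A n))"
proof (cases "\<exists>n. hausdorff_content \<tau> (A n) = \<infinity>")
  case True
  then obtain n where "hausdorff_content \<tau> (A n) = \<infinity>" by auto
  moreover have "hausdorff_content \<tau> (A n) \<le> (\<Sum>n. hausdorff_content \<tau> (A n))"
    using sum_le_suminf[of "\<lambda>n. hausdorff_content \<tau> (A n)" "{n}"] by simp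
  ultimately show ?thesis by (simp add: top_unique)
next
  case False
  show ?thesis
  proof (rule ennreal_le_epsilon)
    fix e :: real assume e: "0 < e"
    have "\<exists>U\<in>bounded_covers (A n). (\<Sum>i. diam_weight \<tau> (U i)) \<le> hausdorff_content \<tau> (A n) + ennreal e * ennreal ((1/2)^Suc n)"
      for n
    proof -
      have "hausdorff_content \<tau> (A n) < hausdorff_content \<tau> (A n) + ennreal e * ennreal ((1/2)^Suc n)"
        using False e by (simp add: less_top ennreal_zero_less_mult_iff)
      then show ?thesis
        unfolding hausdorff_content_def by (subst (asm) INF_less_iff) (auto intro: less_imp_le)
    qed
    then obtain U where U: "\<And>n. U n \<in> bounded_covers (A n)"
      and Us: "\<And>n. (\<Sum>i. diam_weight \<tau> (U n i)) \<le> hausdorff_content \<tau> (A n) + ennreal e * ennreal ((1/2)^Suc n)"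
      by metis
    define V where "V = case_prod U \<circ> prod_decode"
    have Vc: "(\<Union>n. A n) \<subseteq> (\<Union>i. V i)"
    proof
      fix x assume "x \<in> (\<Union>n. A n)"
      then obtain n i where "x \<in> U n i" using U by (force simp: bounded_covers_def)
      then show "x \<in> (\<Union>i. V i)"
        by (auto simp: V_def intro!: exI[of _ "prod_encode (n,i)"])
    qed
    have Vb: "bounded (V i)" for i
      using U by (auto simp: V_def bounded_covers_def split: prod.split)
    have "hausdorff_content \<tau> (\<Union>n. A n) \<le> (\<Sum>i. diam_weight \<tau> (V i))"
      by (rule hausdorff_content_le_cover[OF Vc Vb])
    also have "\<dots> = (\<Sum>i. (\<lambda>p. diam_weight \<tau> (case_prod U p)) (prod_decode i))"
      by (simp add: V_def)
    also have "\<dots> = (\<Sum>n. \<Sum>i. diam_weight \<tau> (U n i))"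
      by (rule suminf_ennreal_2dimen) auto
    also have "\<dots> \<le> (\<Sum>n. hausdorff_content \<tau> (A n) + ennreal e * ennreal ((1/2)^Suc n))"
      by (intro suminf_le Us) auto
    also have "\<dots> = (\<Sum>n. hausdorff_content \<tau> (A n)) + (\<Sum>n. ennreal e * ennreal ((1/2)^Suc n))"
      by (rule suminf_add[symmetric]) auto
    also have "(\<Sum>n. ennreal e * ennreal ((1/2)^Suc n)) = ennreal e * (\<Sum>n. ennreal ((1/2)^Suc n))"
      by simp
    also have "(\<Sum>n. ennreal ((1/2)^Suc n)) = ennreal 1"
      using power_half_series by (intro suminf_ennreal_eq) auto
    finally show "hausdorff_content \<tau> (\<Union>n. A n) \<le> (\<Sum>n. hausdorff_content \<tau> (A n)) + ennreal e"
      by simp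
  qed
qed

lemma hausdorff_content_Un_le:
  "hausdorff_content \<tau> (A \<union> B) \<le> hausdorff_content \<tau> A + hausdorff_content \<tau> B"
proof -
  let ?C = "\<lambda>n::nat. if n = 0 then A else if n = 1 then B else {}"
  have "hausdorff_content \<tau> (A \<union> B) \<le> hausdorff_content \<tau> (\<Union>n. ?C n)"
    by (intro hausdorff_content_mono) (auto intro: exI[of _ 0] exI[of _ 1])
  also have "\<dots> \<le> (\<Sum>n. hausdorff_content \<tau> (?C n))"
    by (rule hausdorff_content_UN_le)
  also have "\<dots> = (\<Sum>n\<in>{0,1::nat}. hausdorff_content \<tau> (?C n))"
    by (rule suminf_finite) auto
  finally show ?thesis by simp
qed

lemma hausdorff_content_finite_UN_le:
  assumes "finite I"
  shows "hausdorff_content \<tau> (\<Union>i\<in>I. A i) \<le> (\<Sum>i\<in>I. hausdorff_content \<tau> (A i))"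
  using assms
proof induction
  case (insert i I)
  have "hausdorff_content \<tau> (\<Union>i\<in>insert i I. A i) \<le> hausdorff_content \<tau> (A i) + hausdorff_content \<tau> (\<Union>i\<in>I. A i)"
    using hausdorff_content_Un_le[of \<tau> "A i" "\<Union>i\<in>I. A i"] by simp
  also have "\<dots> \<le> hausdorff_content \<tau> (A i) + (\<Sum>i\<in>I. hausdorff_content \<tau> (A i))"
    using insert.IH by (rule add_left_mono)
  finally show ?case using insert by simp
qed simp

lemma hausdorff_content_le_premeasure:
  "hausdorff_content \<tau> A \<le> hausdorff_premeasure \<tau> \<delta> A"
  unfolding hausdorff_content_def hausdorff_premeasure_def bounded_covers_def
  by (intro INF_superset_mono) auto

text \<open>A cover of small total weight automatically consists of sets of small diameter.\<close>

lemma hausdorff_measure_eq_0_iff: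
  assumes "0 < \<tau>"
  shows "hausdorff_measure \<tau> A = 0 \<longleftrightarrow> hausdorff_content \<tau> A = 0"
proof
  assume "hausdorff_measure \<tau> A = 0"
  moreover have "hausdorff_premeasure \<tau> 1 A \<le> hausdorff_measure \<tau> A"
    unfolding hausdorff_measure_def by (intro SUP_upper) auto
  ultimately show "hausdorff_content \<tau> A = 0"
    using hausdorff_content_le_premeasure[of \<tau> A 1] by simp
next
  assume 0: "hausdorff_content \<tau> A = 0"
  have "hausdorff_premeasure \<tau> \<delta> A \<le> 0" if "\<delta> > 0" for \<delta>
  proof (rule ennreal_le_epsilon)
    fix e :: real assume e: "0 < e"
    have "hausdorff_content \<tau> A < ennreal (min e (\<delta> powr \<tau>))"
      using 0 e \<open>\<delta> > 0\<close> by simp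
    then obtain U where U: "U \<in> bounded_covers A" and Us: "(\<Sum>i. diam_weight \<tau> (U i)) < ennreal (min e (\<delta> powr \<tau>))"
      unfolding hausdorff_content_def by (subst (asm) INF_less_iff) auto
    have "diameter (U i) \<le> \<delta>" for i
    proof (cases "U i = {}")
      case False
      have "diam_weight \<tau> (U i) \<le> (\<Sum>i. diam_weight \<tau> (U i))"
        using sum_le_suminf[of "\<lambda>i. diam_weight \<tau> (U i)" "{i}"] by simp
      with Us have "diam_weight \<tau> (U i) < ennreal (min e (\<delta> powr \<tau>))" by simp
      then have "diameter (U i) powr \<tau> < \<delta> powr \<tau>"
        using False assms by (simp add: diam_weight_def ennreal_less_iff)
      then show ?thesis
        using assms \<open>\<delta> > 0\<close> powr_mono2[of \<tau> \<delta> "diameter (U i)"] by linarith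
    qed (use \<open>\<delta> > 0\<close> in auto)
    then have "hausdorff_premeasure \<tau> \<delta> A \<le> (\<Sum>i. diam_weight \<tau> (U i))"
      unfolding hausdorff_premeasure_def using U
      by (intro INF_lower) (auto simp: bounded_covers_def)
    also have "\<dots> \<le> ennreal e"
      using Us by (metis less_imp_le min.bounded_iff ennreal_leI order_trans min.cobounded1)
    finally show "hausdorff_premeasure \<tau> \<delta> A \<le> 0 + ennreal e" by simp
  qed
  then show "hausdorff_measure \<tau> A = 0"
    unfolding hausdorff_measure_def by (simp add: SUP_eq_const bot_ennreal le_zero_eq)
qed

lemma diam_weight_mono_exponent:
  assumes "0 \<le> u" "u \<le> \<tau>" "bounded U" "diameter U \<le> 1"
  shows "diam_weight \<tau> U \<le> diam_weight u U"
proof -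
  have d: "0 \<le> diameter U" using assms diameter_ge_0 by blast
  show ?thesis
  proof (cases "diameter U = 0")
    case False
    have "diameter U powr \<tau> \<le> diameter U powr u"
      using d False assms by (intro powr_mono') auto
    moreover have "diameter U powr \<tau> \<le> 1"
      using d assms by (intro powr_le1) auto
    ultimately show ?thesis
      using assms by (auto simp: diam_weight_def intro!: ennreal_leI)
  qed (use assms in \<open>auto simp: diam_weight_def\<close>)
qed

lemma hausdorff_measure_null_mono:
  assumes "0 \<le> u" "u \<le> \<tau>" "0 < \<tau>" "hausdorff_measure u A = 0"
  shows "hausdorff_measure \<tau> A = 0"
proof -
  have "hausdorff_content \<tau> A \<le> hausdorff_premeasure \<tau> 1 A"
    by (rule hausdorff_content_le_premeasure)
  also have "\<dots> \<le> hausdorff_premeasure u 1 A"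
    unfolding hausdorff_premeasure_def
    by (intro INF_mono) (use assms in \<open>auto intro!: suminf_le diam_weight_mono_exponent\<close>)
  also have "\<dots> \<le> hausdorff_measure u A"
    unfolding hausdorff_measure_def by (intro SUP_upper) auto
  finally show ?thesis
    using assms by (simp add: hausdorff_measure_eq_0_iff)
qed

text \<open>On sets of diameter at most \<open>\<delta>\<close> the exponent \<open>\<alpha>\<close>
  is traded for \<open>u\<close> at the price of a factor
  \<open>\<delta> powr (u - \<alpha>)\<close>, which tends to 0. This later ties the exponent of an
  AD-regular set to its dimension.\<close>

lemma hausdorff_measure_null_of_finite:
  assumes "0 \<le> \<alpha>" "\<alpha> < u" "hausdorff_measure \<alpha> A < \<infinity>"
  shows "hausdorff_measure u A = 0"
proof -
  obtain h where h: "hausdorff_measure \<alpha> A = ennreal h" "h \<ge> 0"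
    using assms(3) by (cases "hausdorff_measure \<alpha> A") auto
  have "hausdorff_content u A \<le> 0"
  proof (rule ennreal_le_epsilon)
    fix e :: real assume e: "0 < e"
    \<comment> \<open>Chosen so that \<open>\<delta> powr (u - \<alpha>) * (h + 1) = e\<close>.
      Using \<open>h + 1\<close> keeps the divisor positive and makes room for a cover of weight
      strictly above the measure.\<close>
    define \<delta> where "\<delta> = (e / (h + 1)) powr (1 / (u - \<alpha>))"
    have \<delta>: "\<delta> > 0" using e h by (simp add: \<delta>_def)
    have \<delta>e: "\<delta> powr (u - \<alpha>) = e / (h + 1)"
      using e h assms by (simp add: \<delta>_def powr_powr)
    have "hausdorff_premeasure \<alpha> \<delta> A \<le> ennreal h"
      unfolding h(1)[symmetric] hausdorff_measure_def using \<delta> by (intro SUP_upper) auto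
    also have "\<dots> < ennreal (h + 1)" using h by (simp add: ennreal_less_iff)
    finally obtain U where U: "A \<subseteq> (\<Union>i. U i)" "\<And>i. bounded (U i)" "\<And>i. diameter (U i) \<le> \<delta>"
      and Us: "(\<Sum>i. diam_weight \<alpha> (U i)) < ennreal (h + 1)"
      unfolding hausdorff_premeasure_def by (subst (asm) INF_less_iff) auto
    have w: "diam_weight u (U i) \<le> ennreal (\<delta> powr (u - \<alpha>)) * diam_weight \<alpha> (U i)" for i
    proof (cases "U i = {} \<or> diameter (U i) = 0")
      case True
      then show ?thesis using assms by (auto simp: diam_weight_def)
    next
      case False
      have d: "0 < diameter (U i)" using False U(2)[of i] diameter_ge_0[of "U i"] by auto
      have "diameter (U i) powr u = diameter (U i) powr (u - \<alpha>) * diameter (U i) powr \<alpha>"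
        by (simp flip: powr_add)
      also have "\<dots> \<le> \<delta> powr (u - \<alpha>) * diameter (U i) powr \<alpha>"
        using d U(3)[of i] assms by (intro mult_right_mono powr_mono2) auto
      finally show ?thesis
        using False assms d by (auto simp: diam_weight_def ennreal_mult[symmetric] intro!: ennreal_leI)
    qed
    have "hausdorff_content u A \<le> (\<Sum>i. diam_weight u (U i))"
      by (rule hausdorff_content_le_cover) (use U in auto)
    also have "\<dots> \<le> (\<Sum>i. ennreal (\<delta> powr (u - \<alpha>)) * diam_weight \<alpha> (U i))"
      by (intro suminf_le w) auto
    also have "\<dots> = ennreal (\<delta> powr (u - \<alpha>)) * (\<Sum>i. diam_weight \<alpha> (U i))" by simp
    also have "\<dots> \<le> ennreal (\<delta> powr (u - \<alpha>)) * ennreal (h + 1)"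
      using Us by (intro mult_left_mono) auto
    also have "\<dots> = ennreal e" using h e by (simp add: \<delta>e ennreal_mult[symmetric] del: ennreal_plus)
    finally show "hausdorff_content u A \<le> 0 + ennreal e" by simp
  qed
  then show ?thesis using assms by (simp add: hausdorff_measure_eq_0_iff)
qed

lemma hausdorff_content_null_UN:
  fixes A :: "nat \<Rightarrow> 'a::metric_space set"
  assumes "\<And>n. hausdorff_content \<tau> (A n) = 0"
  shows "hausdorff_content \<tau> (\<Union>n. A n) = 0"
proof -
  have "(\<Sum>n. hausdorff_content \<tau> (A n)) = 0" by (simp only: assms suminf_zero)
  then show ?thesis using hausdorff_content_UN_le[of \<tau> A] by (simp only: le_zero_eq)
qed

lemma hausdorff_content_null_countable_UN:
  assumes "countable I" "\<And>i. i \<in> I \<Longrightarrow> hausdorff_content \<tau> (A i) = 0"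
  shows "hausdorff_content \<tau> (\<Union>i\<in>I. A i) = 0"
proof (cases "I = {}")
  case False
  define g where "g = from_nat_into I"
  have g: "range g = I" unfolding g_def by (rule range_from_nat_into[OF False assms(1)])
  have "hausdorff_content \<tau> (\<Union>n. A (g n)) = 0"
  proof (rule hausdorff_content_null_UN)
    fix n
    have "g n \<in> I" using g by blast
    then show "hausdorff_content \<tau> (A (g n)) = 0" by (rule assms(2))
  qed
  moreover have "(\<Union>i\<in>I. A i) = (\<Union>n. A (g n))"
    unfolding g[symmetric] by (rule SUP_image[unfolded comp_def])
  ultimately show ?thesis by simp
qed simp

section \<open>Hausdorff dimension as a critical exponent\<close>

lemma hausdorff_dim_nonneg: "0 \<le> hausdorff_dim A"
  unfolding hausdorff_dim_def by (intro INF_greatest) auto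

lemma hausdorff_dim_le:
  assumes "\<And>\<tau>. u < \<tau> \<Longrightarrow> hausdorff_measure \<tau> A = 0" "0 \<le> u"
  shows "hausdorff_dim A \<le> ereal u"
proof (rule ereal_le_epsilon2)
  fix e :: real assume "0 < e"
  then have "hausdorff_dim A \<le> ereal (u + e)"
    unfolding hausdorff_dim_def using assms(1)[of "u + e"] assms(2)
    by (intro INF_lower) auto
  then show "hausdorff_dim A \<le> ereal u + ereal e" by simp
qed

lemma hausdorff_measure_null_of_dim_less:
  assumes "hausdorff_dim A < ereal \<tau>"
  shows "hausdorff_measure \<tau> A = 0"
proof -
  obtain u where u: "0 \<le> u" "hausdorff_measure u A = 0" "u < \<tau>"
    using assms unfolding hausdorff_dim_def by (subst (asm) INF_less_iff) auto
  then show ?thesis by (auto intro: hausdorff_measure_null_mono[of u \<tau>])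
qed

lemma hausdorff_measure_pos_of_less_dim:
  assumes "ereal \<tau> < hausdorff_dim A" "0 \<le> \<tau>"
  shows "hausdorff_measure \<tau> A \<noteq> 0"
proof
  assume "hausdorff_measure \<tau> A = 0"
  then have "hausdorff_dim A \<le> ereal \<tau>"
    unfolding hausdorff_dim_def using assms(2) by (intro INF_lower) auto
  with assms(1) show False by simp
qed

lemma le_hausdorff_dim:
  assumes "\<And>u. 0 < u \<Longrightarrow> u < t \<Longrightarrow> hausdorff_measure u A \<noteq> 0"
  shows "ereal t \<le> hausdorff_dim A"
proof (rule ccontr)
  assume "\<not> ereal t \<le> hausdorff_dim A"
  then obtain u where u: "hausdorff_dim A < ereal u" "ereal u < ereal t"
    using ereal_dense2[of "hausdorff_dim A" "ereal t"] by (auto simp: not_le)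
  have "0 < ereal u"
    using u(1) hausdorff_dim_nonneg[of A] by (rule order.strict_trans1[rotated])
  then show False
    using u assms[of u] hausdorff_measure_null_of_dim_less[of A u] by simp
qed

lemma hausdorff_content_nonexpansive_image:
  assumes f: "\<And>x y. dist (f x) (f y) \<le> dist x y" and "0 < \<tau>"
  shows "hausdorff_content \<tau> (f ` A) \<le> hausdorff_content \<tau> A"
proof -
  have b: "bounded (f ` U)" and d: "diameter (f ` U) \<le> diameter U" if "bounded U" for U
  proof -
    show "bounded (f ` U)"
    proof -
      from that obtain x e where "\<forall>y\<in>U. dist x y \<le> e" by (auto simp: bounded_def)
      then show ?thesis unfolding bounded_def using f by (intro exI[of _ "f x"] exI[of _ e]) (auto intro: order_trans)
    qed
    show "diameter (f ` U) \<le> diameter U"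
    proof (cases "U = {}")
      case False
      show ?thesis
        unfolding diameter_def[of "f ` U"]
        using False that f by (auto intro!: cSUP_least intro: order_trans[OF _ diameter_bounded_bound])
    qed simp
  qed
  show ?thesis
    unfolding hausdorff_content_def[of _ A]
  proof (rule INF_greatest)
    fix U assume U: "U \<in> bounded_covers A"
    have "hausdorff_content \<tau> (f ` A) \<le> (\<Sum>i. diam_weight \<tau> (f ` U i))"
    proof (rule hausdorff_content_le_cover)
      show "f ` A \<subseteq> (\<Union>i. f ` U i)" using U by (fastforce simp: bounded_covers_def)
      show "bounded (f ` U i)" for i using U b by (simp add: bounded_covers_def)
    qed
    also have "\<dots> \<le> (\<Sum>i. diam_weight \<tau> (U i))"
    proof (intro suminf_le)
      fix i
      have "bounded (U i)" using U by (auto simp: bounded_covers_def)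
      then show "diam_weight \<tau> (f ` U i) \<le> diam_weight \<tau> (U i)"
        using d[of "U i"] b[of "U i"] diameter_ge_0[of "f ` U i"] \<open>0 < \<tau>\<close>
        by (auto simp: diam_weight_def intro!: ennreal_leI powr_mono2)
    qed auto
    finally show "hausdorff_content \<tau> (f ` A) \<le> (\<Sum>i. diam_weight \<tau> (U i))" .
  qed
qed

lemma hausdorff_dim_nonexpansive_image:
  assumes f: "\<And>x y. dist (f x) (f y) \<le> dist x y"
  shows "hausdorff_dim (f ` A) \<le> hausdorff_dim A"
proof (rule ccontr)
  assume "\<not> ?thesis"
  then obtain u where u: "hausdorff_dim A < ereal u" "ereal u < hausdorff_dim (f ` A)"
    using ereal_dense2[of "hausdorff_dim A" "hausdorff_dim (f ` A)"] by (auto simp: not_le)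
  have "0 < ereal u"
    using u(1) hausdorff_dim_nonneg[of A] by (rule order.strict_trans1[rotated])
  then have u0: "0 < u" by simp
  have "hausdorff_content u A = 0"
    using hausdorff_measure_null_of_dim_less[OF u(1)] u0 by (simp add: hausdorff_measure_eq_0_iff)
  then have "hausdorff_content u (f ` A) = 0"
    using hausdorff_content_nonexpansive_image[OF f u0, of A] by simp
  then show False
    using hausdorff_measure_pos_of_less_dim[OF u(2)] u0 by (simp add: hausdorff_measure_eq_0_iff)
qed

section \<open>Dyadic cells\<close>

text \<open>A half-open dyadic square of side \<open>2 ^ -n\<close> is named by its integer corner,
  so that passing to an ancestor is integer division, and distances between cells are measured in
  units of their side.\<close>

definition cell :: "nat \<Rightarrow> real^2 \<Rightarrow> int \<times> int" where
  "cell n y = (\<lfloor>2 ^ n * y $ 1\<rfloor>, \<lfloor>2 ^ n * y $ 2\<rfloor>)"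

definition coarsen :: "nat \<Rightarrow> int \<times> int \<Rightarrow> int \<times> int" where
  "coarsen k p = (fst p div 2 ^ k, snd p div 2 ^ k)"

lemma floor_div_power2:
  assumes "m \<le> n"
  shows "\<lfloor>2 ^ n * a\<rfloor> div 2 ^ (n - m) = \<lfloor>2 ^ m * (a::real)\<rfloor>"
proof -
  have "(2::real) ^ n = 2 ^ m * 2 ^ (n - m)" using assms by (simp flip: power_add)
  then have "2 ^ m * a = (2 ^ n * a) / real_of_int (2 ^ (n - m))" by simp
  then show ?thesis
    using floor_divide_real_eq_div[of "2 ^ (n - m)" "2 ^ n * a"] by (simp only: zero_le_power zero_le_numeral)
qed

lemma coarsen_cell: "m \<le> n \<Longrightarrow> coarsen (n - m) (cell n y) = cell m y"
  unfolding coarsen_def cell_def fst_conv snd_conv by (simp only: floor_div_power2)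

lemma coarsen_cell_add: "coarsen l (cell (m + l) y) = cell m y"
  using coarsen_cell[of m "m + l" y] by simp

lemma cell_eq_mono: "m \<le> n \<Longrightarrow> cell n y = cell n z \<Longrightarrow> cell m y = cell m z"
  by (metis coarsen_cell)

lemma abs_diff_less_if_floor_eq:
  fixes a b :: real
  assumes "\<lfloor>2 ^ n * a\<rfloor> = \<lfloor>2 ^ n * b\<rfloor>"
  shows "\<bar>a - b\<bar> < 2 powr - real n"
proof -
  have "\<bar>2 ^ n * a - 2 ^ n * b\<bar> < 1" using assms by linarith
  then have "2 ^ n * \<bar>a - b\<bar> < 1" by (simp add: abs_mult right_diff_distrib[symmetric])
  then show ?thesis by (simp add: powr_minus powr_realpow field_simps)
qed

lemma dist_less_if_cell_eq:
  assumes "cell n y = cell n z"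
  shows "dist y z < 2 * 2 powr - real n"
proof -
  have "dist y z \<le> \<bar>y $ 1 - z $ 1\<bar> + \<bar>y $ 2 - z $ 2\<bar>"
    using norm_le_l1_cart[of "y - z"] by (simp add: dist_norm sum_2)
  also have "\<dots> < 2 * 2 powr - real n"
    using assms abs_diff_less_if_floor_eq[of n "y $ 1" "z $ 1"] abs_diff_less_if_floor_eq[of n "y $ 2" "z $ 2"]
    by (simp add: cell_def)
  finally show ?thesis .
qed

lemma bounded_if_same_cell:
  assumes "\<And>y z. y \<in> A \<Longrightarrow> z \<in> A \<Longrightarrow> cell n y = cell n z"
  shows "bounded A"
proof (cases "A = {}")
  case False
  then obtain a where "a \<in> A" by auto
  then show ?thesis
    using assms dist_less_if_cell_eq[of n a] unfolding bounded_def by (meson less_imp_le)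
qed simp


text \<open>The diameter is at most \<open>2 * 2 powr - real n\<close>, and its leading 2 stays at
  most 2 for exponents up to 1. Level 0 gives the finiteness of the content of a set inside one unit
  cell.\<close>

lemma hausdorff_content_same_cell_le:
  assumes "\<And>y z. y \<in> A \<Longrightarrow> z \<in> A \<Longrightarrow> cell n y = cell n z" "0 < \<tau>" "\<tau> \<le> 1"
  shows "hausdorff_content \<tau> A \<le> ennreal (2 * 2 powr - (real n * \<tau>))"
proof -
  have b: "bounded A" using assms(1) by (rule bounded_if_same_cell)
  have "diameter A \<le> 2 * 2 powr - real n"
  proof (rule diameter_le)
    fix y z assume "y \<in> A" "z \<in> A"
    then show "norm (y - z) \<le> 2 * 2 powr - real n"
      using dist_less_if_cell_eq[OF assms(1)] by (simp add: dist_norm less_imp_le)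
  qed simp
  then have "diameter A powr \<tau> \<le> (2 * 2 powr - real n) powr \<tau>"
    using assms(2) diameter_ge_0[OF b] by (intro powr_mono2) auto
  also have "\<dots> = 2 powr \<tau> * 2 powr - (real n * \<tau>)"
    by (simp add: powr_mult powr_powr)
  also have "\<dots> \<le> 2 * 2 powr - (real n * \<tau>)"
    using assms(3) powr_mono[of \<tau> 1 2] by (intro mult_right_mono) auto
  finally have "diam_weight \<tau> A \<le> ennreal (2 * 2 powr - (real n * \<tau>))"
    using assms(2) by (auto simp: diam_weight_def intro!: ennreal_leI)
  then show ?thesis
    using hausdorff_content_le_diam_weight[OF b, of \<tau>] by (rule order_trans[rotated])
qed

lemma hausdorff_content_le_card_cells:
  assumes "finite (cell n ` A)" "0 < \<tau>" "\<tau> \<le> 1"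
  shows "hausdorff_content \<tau> A \<le> ennreal (real (card (cell n ` A)) * (2 * 2 powr - (real n * \<tau>)))"
proof -
  have "hausdorff_content \<tau> A \<le> hausdorff_content \<tau> (\<Union>p\<in>cell n ` A. {y. cell n y = p})"
    by (intro hausdorff_content_mono) auto
  also have "\<dots> \<le> (\<Sum>p\<in>cell n ` A. hausdorff_content \<tau> {y. cell n y = p})"
    by (rule hausdorff_content_finite_UN_le[OF assms(1)])
  also have "\<dots> \<le> (\<Sum>p\<in>cell n ` A. ennreal (2 * 2 powr - (real n * \<tau>)))"
    by (intro sum_mono hausdorff_content_same_cell_le[where n = n] assms) auto
  also have "\<dots> = ennreal (real (card (cell n ` A)) * (2 * 2 powr - (real n * \<tau>)))"
    by (simp add: ennreal_mult'' ennreal_of_nat_eq_real_of_nat)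
  finally show ?thesis .
qed

lemma finite_cells_if_bounded:
  assumes "bounded A"
  shows "finite (cell n ` A)"
proof -
  obtain r where r: "\<And>y. y \<in> A \<Longrightarrow> norm y \<le> r" using assms by (auto simp: bounded_iff)
  let ?I = "{- \<lceil>2 ^ n * r\<rceil> - 1 .. \<lceil>2 ^ n * r\<rceil>}"
  have "\<lfloor>2 ^ n * y $ i\<rfloor> \<in> ?I" if "y \<in> A" for y i
  proof -
    have "\<bar>y $ i\<bar> \<le> r" using component_le_norm_cart[of y i] r[OF that] by linarith
    then have "\<bar>2 ^ n * y $ i\<bar> \<le> 2 ^ n * r" by (simp add: abs_mult)
    then show ?thesis unfolding atLeastAtMost_iff abs_le_iff by (intro conjI; linarith)
  qed
  then have "cell n ` A \<subseteq> ?I \<times> ?I" by (auto simp: cell_def)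
  then show ?thesis by (rule finite_subset) auto
qed

section \<open>Directions and crowded cells\<close>

text \<open>For slopes in \<open>[0, 1]\<close> the projection is, up to a factor between 1 and
  \<open>sqrt 2\<close>, the map sending \<open>y\<close> to \<open>y $ 1 + x * y $ 2\<close>, which
  is affine in the random parameter \<open>x\<close>.\<close>

definition direction :: "real \<Rightarrow> real^2" where
  "direction x = (1 / sqrt (1 + x\<^sup>2)) *\<^sub>R (\<chi> i. if i = 1 then 1 else x)"

lemma proj_direction: "proj (direction x) y = (y $ 1 + x * y $ 2) / sqrt (1 + x\<^sup>2)"
  by (simp add: Defs.proj_def direction_def inner_vec_def sum_2 add_divide_distrib)

lemma norm_direction [simp]: "norm (direction x) = 1"
proof -
  have "(norm (direction x))\<^sup>2 = 1"
    unfolding power2_norm_eq_inner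
    by (simp add: direction_def inner_vec_def sum_2 power2_eq_square[symmetric] power_divide flip: add_divide_distrib)
       (metis add_pos_nonneg less_irrefl zero_le_power2 zero_less_one)
  then show ?thesis using norm_ge_zero[of "direction x"] unfolding power2_eq_1_iff by linarith
qed

text \<open>Level-\<open>n\<close> cells are compared in units of \<open>2 ^ -n\<close>; the constant 4 leaves room for any points
  of the two cells whose projections differ by at most \<open>2 ^ -n\<close>.\<close>

definition conflict :: "real \<Rightarrow> int \<times> int \<Rightarrow> int \<times> int \<Rightarrow> bool" where
  "conflict x p q \<longleftrightarrow> \<bar>of_int (fst p - fst q) + x * of_int (snd p - snd q)\<bar> \<le> (4::real)"

text \<open>A common ancestor \<open>l\<close> levels up forces a distance below
  \<open>2 ^ l\<close> units, so only the distribution of the slope at scales \<open>2 ^ -k\<close>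
  with \<open>k \<le> l\<close> matters, whatever \<open>m\<close> is.\<close>

definition crowd :: "(real^2) set \<Rightarrow> nat \<Rightarrow> nat \<Rightarrow> real \<Rightarrow> int \<times> int \<Rightarrow> (int \<times> int) set" where
  "crowd E m l x p = {q \<in> cell (m + l) ` E. coarsen l q = coarsen l p \<and> conflict x p q}"

definition bad_cells :: "(real^2) set \<Rightarrow> real \<Rightarrow> nat \<Rightarrow> nat \<Rightarrow> real \<Rightarrow> (int \<times> int) set" where
  "bad_cells E \<theta> m l x = {p \<in> cell (m + l) ` E. 2 powr (\<theta> * real l) < real (card (crowd E m l x p))}"

lemma abs_add_mult_le:
  fixes a b x :: real
  assumes "0 \<le> x" "x \<le> 1"
  shows "\<bar>a + x * b\<bar> \<le> \<bar>a\<bar> + \<bar>b\<bar>"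
proof -
  have "\<bar>x * b\<bar> \<le> 1 * \<bar>b\<bar>" unfolding abs_mult using assms by (intro mult_right_mono) auto
  then show ?thesis by linarith
qed

text \<open>In units of \<open>2 ^ -n\<close> the points differ by at most 2 in
  \<open>y $ 1 + x * y $ 2\<close>, because the normalising factor is at most 2. Rounding the two
  coordinates contributes at most 2 more.\<close>

lemma conflict_if_close_projections:
  assumes x: "0 \<le> x" "x \<le> 1" and d: "dist (proj (direction x) y) (proj (direction x) z) \<le> 2 powr - real n"
  shows "conflict x (cell n y) (cell n z)"
proof -
  let ?s = "sqrt (1 + x\<^sup>2)"
  have s: "0 < ?s" "?s \<le> 2"
  proof -
    have "x\<^sup>2 \<le> 1" using x by (simp add: power_le_one)
    then show "?s \<le> 2" by (intro real_le_lsqrt) auto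
    show "0 < ?s" by (simp add: add_pos_nonneg)
  qed
  have "proj (direction x) y - proj (direction x) z = ((y $ 1 - z $ 1) + x * (y $ 2 - z $ 2)) / ?s"
    by (simp add: proj_direction diff_divide_distrib[symmetric] algebra_simps)
  then have "\<bar>(y $ 1 - z $ 1) + x * (y $ 2 - z $ 2)\<bar> / ?s \<le> 2 powr - real n"
    using d s by (simp add: dist_real_def)
  then have "\<bar>(y $ 1 - z $ 1) + x * (y $ 2 - z $ 2)\<bar> \<le> 2 powr - real n * ?s"
    using s by (simp add: pos_divide_le_eq)
  also have "\<dots> \<le> 2 powr - real n * 2" using s by (intro mult_left_mono) auto
  finally have "2 ^ n * \<bar>(y $ 1 - z $ 1) + x * (y $ 2 - z $ 2)\<bar> \<le> 2"
    by (simp add: powr_minus powr_realpow field_simps)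
  then have A: "\<bar>2 ^ n * ((y $ 1 - z $ 1) + x * (y $ 2 - z $ 2))\<bar> \<le> 2" by (simp add: abs_mult)
  let ?f1 = "frac (2 ^ n * y $ 1) - frac (2 ^ n * z $ 1)" and ?f2 = "frac (2 ^ n * y $ 2) - frac (2 ^ n * z $ 2)"
  have "\<bar>?f1\<bar> \<le> 1" "\<bar>?f2\<bar> \<le> 1"
    using frac_ge_0[of "2 ^ n * y $ 1"] frac_lt_1[of "2 ^ n * y $ 1"] frac_ge_0[of "2 ^ n * z $ 1"] frac_lt_1[of "2 ^ n * z $ 1"]
      frac_ge_0[of "2 ^ n * y $ 2"] frac_lt_1[of "2 ^ n * y $ 2"] frac_ge_0[of "2 ^ n * z $ 2"] frac_lt_1[of "2 ^ n * z $ 2"]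
    by linarith+
  then have B: "\<bar>?f1 + x * ?f2\<bar> \<le> 2" using abs_add_mult_le[OF x, of ?f1 ?f2] by linarith
  have "of_int (fst (cell n y) - fst (cell n z)) + x * of_int (snd (cell n y) - snd (cell n z)) =
        2 ^ n * ((y $ 1 - z $ 1) + x * (y $ 2 - z $ 2)) - (?f1 + x * ?f2)"
    by (simp add: cell_def frac_def algebra_simps)
  then show ?thesis unfolding conflict_def using A B by linarith
qed

text \<open>The number of cells met by a strip grows by a factor of at most
  \<open>2 powr (\<theta> * l)\<close> per block: inside one cell of level \<open>j * l\<close> all
  subcells met by the strip belong to the crowd of any one of them, and that one is not bad. The
  strip is thinner than the cells of every block, so it causes conflicts at all of them.\<close>

lemma card_cells_strip_le:
  assumes x: "0 \<le> x" "x \<le> 1" and E: "\<And>y z. y \<in> E \<Longrightarrow> z \<in> E \<Longrightarrow> cell 0 y = cell 0 z"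
    and E1: "E1 \<subseteq> E" "\<And>j y. j < i \<Longrightarrow> y \<in> E1 \<Longrightarrow> cell (j * l + l) y \<notin> bad_cells E \<theta> (j * l) l x"
    and U: "bounded U" "diameter U \<le> 2 powr - real (i * l)"
  shows "j \<le> i \<Longrightarrow> real (card (cell (j * l) ` {y \<in> E1. proj (direction x) y \<in> U})) \<le> 2 powr (\<theta> * real (j * l))"
proof (induction j)
  case 0
  have "\<exists>p. cell 0 ` {y \<in> E1. proj (direction x) y \<in> U} \<subseteq> {p}"
    using E E1(1) by (cases "E1 = {}") blast+
  then obtain p where "cell 0 ` {y \<in> E1. proj (direction x) y \<in> U} \<subseteq> {p}" by auto
  then have "card (cell 0 ` {y \<in> E1. proj (direction x) y \<in> U}) \<le> card {p}"
    by (intro card_mono) auto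
  then show ?case by simp
next
  case (Suc j)
  let ?A = "{y \<in> E1. proj (direction x) y \<in> U}"
  have fin: "finite (cell n ` A)" if "A \<subseteq> E" for n A
    using bounded_if_same_cell[of E 0] E that by (metis bounded_subset finite_cells_if_bounded)
  have sub: "cell (Suc j * l) ` ?A \<subseteq> (\<Union>q\<in>cell (j * l) ` ?A. cell (Suc j * l) ` {z \<in> ?A. cell (j * l) z = q})"
    by auto
  have one: "real (card (cell (Suc j * l) ` {z \<in> ?A. cell (j * l) z = q})) \<le> 2 powr (\<theta> * real l)"
    if q: "q \<in> cell (j * l) ` ?A" for q
  proof -
    obtain y where y: "y \<in> ?A" "cell (j * l) y = q" using q by blast
    let ?p = "cell (j * l + l) y"
    have "cell (Suc j * l) ` {z \<in> ?A. cell (j * l) z = q} \<subseteq> crowd E (j * l) l x ?p"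
    proof (rule image_subsetI)
      fix z assume "z \<in> {z \<in> ?A. cell (j * l) z = q}"
      then have z: "z \<in> E1" "proj (direction x) z \<in> U" "q = cell (j * l) z" by auto
      have "dist (proj (direction x) y) (proj (direction x) z) \<le> 2 powr - real (i * l)"
        using diameter_bounded_bound[OF U(1), of "proj (direction x) y" "proj (direction x) z"] U(2) y z by auto
      also have "\<dots> \<le> 2 powr - real (j * l + l)"
      proof -
        have "Suc j * l \<le> i * l" using Suc.prems by (intro mult_le_mono1)
        then have "real (j * l + l) \<le> real (i * l)" by (simp only: mult_Suc of_nat_le_iff add.commute)
        then show ?thesis by (intro powr_mono) auto
      qed
      finally have "conflict x ?p (cell (j * l + l) z)" by (rule conflict_if_close_projections[OF x])
      then show "cell (Suc j * l) z \<in> crowd E (j * l) l x ?p"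
        using z y E1(1) coarsen_cell_add[of l "j * l"] by (auto simp: crowd_def add.commute)
    qed
    moreover have "finite (crowd E (j * l) l x ?p)"
      using fin[of E] by (auto simp: crowd_def)
    ultimately have "card (cell (Suc j * l) ` {z \<in> ?A. cell (j * l) z = q}) \<le> card (crowd E (j * l) l x ?p)"
      by (rule card_mono[rotated])
    moreover have "?p \<notin> bad_cells E \<theta> (j * l) l x" using E1(2)[of j y] Suc.prems y by auto
    then have "real (card (crowd E (j * l) l x ?p)) \<le> 2 powr (\<theta> * real l)"
      using y E1(1) by (auto simp: bad_cells_def)
    ultimately show ?thesis by linarith
  qed
  have finA: "finite (cell n ` {z \<in> ?A. P z})" "finite (cell n ` ?A)" for n P
    by (rule fin, use E1(1) in auto)+
  have "card (cell (Suc j * l) ` ?A) \<le> card (\<Union>q\<in>cell (j * l) ` ?A. cell (Suc j * l) ` {z \<in> ?A. cell (j * l) z = q})"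
    by (intro card_mono sub finite_UN_I finA)
  also have "\<dots> \<le> (\<Sum>q\<in>cell (j * l) ` ?A. card (cell (Suc j * l) ` {z \<in> ?A. cell (j * l) z = q}))"
    by (intro card_UN_le finA)
  finally have "real (card (cell (Suc j * l) ` ?A)) \<le> (\<Sum>q\<in>cell (j * l) ` ?A. real (card (cell (Suc j * l) ` {z \<in> ?A. cell (j * l) z = q})))"
    by (simp only: of_nat_le_iff flip: of_nat_sum)
  also have "\<dots> \<le> (\<Sum>q\<in>cell (j * l) ` ?A. 2 powr (\<theta> * real l))"
    by (intro sum_mono one)
  also have "\<dots> = real (card (cell (j * l) ` ?A)) * 2 powr (\<theta> * real l)" by simp
  also have "\<dots> \<le> 2 powr (\<theta> * real (j * l)) * 2 powr (\<theta> * real l)"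
    using Suc by (intro mult_right_mono) auto
  also have "\<dots> = 2 powr (\<theta> * real (Suc j * l))" by (simp add: powr_add[symmetric] algebra_simps)
  finally show ?case .
qed

text \<open>For each scale \<open>N\<close> the levels are cut afresh into \<open>i N\<close> blocks
  of length \<open>N div i N\<close>, with fewer than \<open>i N\<close> levels left over. Scales
  below \<open>N0\<close> are not tested, which keeps the deleted content small.\<close>

definition good_points :: "(real^2) set \<Rightarrow> real \<Rightarrow> (nat \<Rightarrow> nat) \<Rightarrow> nat \<Rightarrow> real \<Rightarrow> (real^2) set" where
  "good_points E \<theta> i N0 x = {y \<in> E. \<forall>N\<ge>N0. \<forall>j<i N.
     cell (j * (N div i N) + N div i N) y \<notin> bad_cells E \<theta> (j * (N div i N)) (N div i N) x}"

text \<open>One \<open>\<theta>\<close> in the exponent pays for the number of cells met by the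
  strip, the other for the at most \<open>i N \<le> \<theta> * N\<close> levels lost in rounding
  \<open>N\<close> to a multiple of the block length.\<close>

lemma hausdorff_content_good_strip_le:
  assumes x: "0 \<le> x" "x \<le> 1" and E: "\<And>y z. y \<in> E \<Longrightarrow> z \<in> E \<Longrightarrow> cell 0 y = cell 0 z"
    and \<tau>: "0 < \<tau>" "\<tau> \<le> 1" and \<theta>: "0 \<le> \<theta>"
    and N: "N0 \<le> N" "1 \<le> i N" "real (i N) \<le> \<theta> * real N"
    and U: "bounded U" "diameter U \<le> 2 powr - real N"
  shows "hausdorff_content \<tau> {y \<in> good_points E \<theta> i N0 x. proj (direction x) y \<in> U}
           \<le> ennreal (2 * 2 powr - (real N * (\<tau> - 2 * \<theta>)))"
proof -
  define l where "l = N div i N"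
  let ?A = "{y \<in> good_points E \<theta> i N0 x. proj (direction x) y \<in> U}"
  have l: "i N * l \<le> N" "N \<le> i N * l + i N"
  proof -
    have "N = i N * (N div i N) + N mod i N" by simp
    moreover have "N mod i N < i N" using N(2) by simp
    ultimately show "i N * l \<le> N" "N \<le> i N * l + i N" unfolding l_def by linarith+
  qed
  have U': "diameter U \<le> 2 powr - real (i N * l)"
    using l(1) by (intro order_trans[OF U(2)] powr_mono) (auto simp flip: of_nat_mult)
  have c: "real (card (cell (i N * l) ` ?A)) \<le> 2 powr (\<theta> * real (i N * l))"
    by (rule card_cells_strip_le[OF x E _ _ U(1) U' order_refl])
       (use N(1) in \<open>auto simp: good_points_def l_def\<close>)
  have "bounded ?A"
    using bounded_if_same_cell[of E 0, OF E] by (rule bounded_subset) (auto simp: good_points_def)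
  then have "hausdorff_content \<tau> ?A \<le> ennreal (real (card (cell (i N * l) ` ?A)) * (2 * 2 powr - (real (i N * l) * \<tau>)))"
    by (intro hausdorff_content_le_card_cells finite_cells_if_bounded \<tau>)
  also have "\<dots> \<le> ennreal (2 * 2 powr - (real N * (\<tau> - 2 * \<theta>)))"
  proof (rule ennreal_leI)
    have "real (card (cell (i N * l) ` ?A)) * (2 * 2 powr - (real (i N * l) * \<tau>))
        \<le> 2 powr (\<theta> * real (i N * l)) * (2 * 2 powr - (real (i N * l) * \<tau>))"
      using c by (intro mult_right_mono) auto
    also have "\<dots> = 2 * 2 powr (\<theta> * real (i N * l) - real (i N * l) * \<tau>)"
      by (simp add: powr_diff powr_minus_divide)
    also have "\<dots> \<le> 2 * 2 powr - (real N * (\<tau> - 2 * \<theta>))"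
    proof -
      have a: "\<theta> * real (i N * l) \<le> \<theta> * real N"
        using l(1) \<theta> by (intro mult_left_mono) (auto simp flip: of_nat_mult)
      have "real N - real (i N) \<le> real (i N * l)" using l(2) by linarith
      then have "(real N - real (i N)) * \<tau> \<le> real (i N * l) * \<tau>"
        using \<tau> by (intro mult_right_mono) auto
      moreover have "real (i N) * \<tau> \<le> \<theta> * real N"
        using N(3) \<tau> mult_left_mono[of \<tau> 1 "real (i N)"] by simp
      ultimately have "\<theta> * real (i N * l) - real (i N * l) * \<tau> \<le> - (real N * (\<tau> - 2 * \<theta>))"
        using a by (simp add: algebra_simps)
      then show ?thesis by (intro mult_left_mono powr_mono) auto
    qed
    finally show "real (card (cell (i N * l) ` ?A)) * (2 * 2 powr - (real (i N * l) * \<tau>))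
        \<le> 2 * 2 powr - (real N * (\<tau> - 2 * \<theta>))" .
  qed
  finally show ?thesis .
qed


lemma two_powr_scale:
  fixes d :: real
  assumes "0 < d" "d \<le> 1"
  obtains N :: nat where "2 powr - real (Suc N) < d" "d \<le> 2 powr - real N"
proof -
  define N where "N = nat \<lfloor>- log 2 d\<rfloor>"
  have l: "0 \<le> - log 2 d" using assms by simp
  have N: "real N \<le> - log 2 d" "- log 2 d < real N + 1"
    using l by (simp_all add: N_def)
  have d: "d = 2 powr (log 2 d)" using assms by simp
  have "2 powr - real (Suc N) < 2 powr (log 2 d)" using N(2) by (intro powr_less_mono) auto
  moreover have "2 powr (log 2 d) \<le> 2 powr - real N" using N(1) by (intro powr_mono) auto
  ultimately show ?thesis using that d by auto
qed

text \<open>The constant covers all sizes of \<open>U\<close>: \<open>2 ^ N0\<close> pays for sets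
  too large for the strip estimate, one factor 2 for rounding the diameter to a power of 2. Sets of
  diameter 0 have negligible fibres by letting \<open>N\<close> tend to infinity.\<close>

lemma hausdorff_content_good_strip_le_diameter:
  assumes x: "0 \<le> x" "x \<le> 1" and E: "\<And>y z. y \<in> E \<Longrightarrow> z \<in> E \<Longrightarrow> cell 0 y = cell 0 z"
    and \<tau>: "0 < \<tau>" "\<tau> \<le> 1" and \<theta>: "0 \<le> \<theta>" and u: "0 < u" "u \<le> \<tau> - 2 * \<theta>"
    and i: "\<And>N. N0 \<le> N \<Longrightarrow> 1 \<le> i N \<and> real (i N) \<le> \<theta> * real N"
    and U: "bounded U"
  shows "hausdorff_content \<tau> {y \<in> good_points E \<theta> i N0 x. proj (direction x) y \<in> U}
           \<le> ennreal (2 * 2 powr (real (Suc N0))) * diam_weight u U"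
proof -
  let ?A = "{y \<in> good_points E \<theta> i N0 x. proj (direction x) y \<in> U}"
  let ?K = "2 * 2 powr (real (Suc N0))"
  have u1: "u \<le> 1" using u \<tau> \<theta> by simp
  have *: "hausdorff_content \<tau> ?A \<le> ennreal (2 * 2 powr - (real N * u))"
    if "N0 \<le> N" "diameter U \<le> 2 powr - real N" for N
  proof -
    have "hausdorff_content \<tau> ?A \<le> ennreal (2 * 2 powr - (real N * (\<tau> - 2 * \<theta>)))"
      using i[OF that(1)] that by (intro hausdorff_content_good_strip_le[OF x E \<tau> \<theta>] U) auto
    also have "\<dots> \<le> ennreal (2 * 2 powr - (real N * u))"
      using u(2) by (intro ennreal_leI mult_left_mono powr_mono) (auto intro: mult_left_mono)
    finally show ?thesis .
  qed
  show ?thesis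
  proof (cases "U = {}")
    case False
    then have w: "diam_weight u U = ennreal (diameter U powr u)" using u by (simp add: diam_weight_def)
    have d0: "0 \<le> diameter U" by (rule diameter_ge_0[OF U])
    consider "diameter U = 0" | "2 powr - real N0 < diameter U"
      | "0 < diameter U" "diameter U \<le> 2 powr - real N0"
      using d0 by linarith
    then show ?thesis
    proof cases
      case 1
      have "(\<lambda>N. 2 * (2 powr - u) ^ N) \<longlonglongrightarrow> 2 * 0"
        using u by (intro tendsto_mult tendsto_const LIMSEQ_realpow_zero) (auto simp: powr_less_one)
      then have "(\<lambda>N. 2 * 2 powr - (real N * u)) \<longlonglongrightarrow> 0"
        by (simp add: powr_realpow[symmetric] powr_powr mult.commute)
      then have "(\<lambda>N. ennreal (2 * 2 powr - (real N * u))) \<longlonglongrightarrow> 0"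
        using tendsto_ennrealI by fastforce
      then have "hausdorff_content \<tau> ?A \<le> 0"
        by (rule tendsto_lowerbound) (use * 1 in \<open>auto simp: eventually_sequentially\<close>)
      then show ?thesis by simp
    next
      case 2
      have "hausdorff_content \<tau> ?A \<le> hausdorff_content \<tau> E"
        by (intro hausdorff_content_mono) (auto simp: good_points_def)
      also have "\<dots> \<le> ennreal (2 * 2 powr - (real 0 * \<tau>))"
        by (rule hausdorff_content_same_cell_le[OF E \<tau>])
      also have "\<dots> = ennreal 2" by simp
      also have "\<dots> \<le> ennreal (?K * diameter U powr u)"
      proof (rule ennreal_leI)
        have "1 \<le> 2 powr (real N0 - real N0 * u)"
          using u1 mult_left_mono[of u 1 "real N0"] by (intro ge_one_powr_ge_zero) auto
        also have "\<dots> = 2 powr real N0 * (2 powr - real N0) powr u"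
          by (simp add: powr_powr powr_add[symmetric])
        also have "\<dots> \<le> 2 powr real N0 * diameter U powr u"
          using 2 u by (intro mult_left_mono powr_mono2) auto
        also have "\<dots> \<le> 2 powr real (Suc N0) * diameter U powr u"
          by (intro mult_right_mono powr_mono) auto
        finally show "2 \<le> ?K * diameter U powr u" by simp
      qed
      finally show ?thesis by (simp add: w ennreal_mult)
    next
      case 3
      have "diameter U \<le> 1" using 3(2) powr_mono[of "- real N0" 0 2] by simp
      then obtain N where N: "2 powr - real (Suc N) < diameter U" "diameter U \<le> 2 powr - real N"
        using two_powr_scale 3(1) by blast
      have "N0 \<le> N"
      proof (rule ccontr)
        assume "\<not> N0 \<le> N"
        then have "2 powr - real N0 \<le> 2 powr - real (Suc N)" by (intro powr_mono) auto
        then show False using N 3 by linarith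
      qed
      then have "hausdorff_content \<tau> ?A \<le> ennreal (2 * 2 powr - (real N * u))" using N by (intro *)
      also have "\<dots> \<le> ennreal (?K * diameter U powr u)"
      proof (rule ennreal_leI)
        have "2 powr - (real N * u) = 2 powr u * (2 powr - real (Suc N)) powr u"
          by (simp add: powr_powr powr_add[symmetric] algebra_simps)
        also have "\<dots> \<le> 2 powr u * diameter U powr u"
          using N u by (intro mult_left_mono powr_mono2) auto
        also have "\<dots> \<le> 2 powr real (Suc N0) * diameter U powr u"
          using u1 by (intro mult_right_mono powr_mono) auto
        finally show "2 * 2 powr - (real N * u) \<le> ?K * diameter U powr u" by simp
      qed
      finally show ?thesis by (simp add: w ennreal_mult)
    qed
  qed simp
qed

text \<open>The mass distribution principle with a content in place of a measure: the content of the
  good points above \<open>U\<close> is countably subadditive in \<open>U\<close> and at most a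
  constant times \<open>diam_weight u U\<close>, so no cover of the projection can have small
  weight.\<close>

lemma hausdorff_measure_proj_good_points:
  assumes x: "0 \<le> x" "x \<le> 1" and E: "\<And>y z. y \<in> E \<Longrightarrow> z \<in> E \<Longrightarrow> cell 0 y = cell 0 z"
    and \<tau>: "0 < \<tau>" "\<tau> \<le> 1" and \<theta>: "0 \<le> \<theta>" and u: "0 < u" "u \<le> \<tau> - 2 * \<theta>"
    and i: "\<And>N. N0 \<le> N \<Longrightarrow> 1 \<le> i N \<and> real (i N) \<le> \<theta> * real N"
    and pos: "hausdorff_content \<tau> (good_points E \<theta> i N0 x) \<noteq> 0"
  shows "hausdorff_measure u (proj (direction x) ` E) \<noteq> 0"
proof
  let ?G = "good_points E \<theta> i N0 x" and ?K = "ennreal (2 * 2 powr (real (Suc N0)))"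
  assume "hausdorff_measure u (proj (direction x) ` E) = 0"
  then have 0: "hausdorff_content u (proj (direction x) ` E) = 0"
    using u by (simp add: hausdorff_measure_eq_0_iff)
  have "hausdorff_content \<tau> ?G \<le> ?K * (\<Sum>i. diam_weight u (U i))"
    if U: "U \<in> bounded_covers (proj (direction x) ` E)" for U
  proof -
    have "?G \<subseteq> (\<Union>n. {y \<in> ?G. proj (direction x) y \<in> U n})"
      using U by (fastforce simp: bounded_covers_def good_points_def)
    then have "hausdorff_content \<tau> ?G \<le> hausdorff_content \<tau> (\<Union>n. {y \<in> ?G. proj (direction x) y \<in> U n})"
      by (rule hausdorff_content_mono)
    also have "\<dots> \<le> (\<Sum>n. hausdorff_content \<tau> {y \<in> ?G. proj (direction x) y \<in> U n})"
      by (rule hausdorff_content_UN_le)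
    also have "\<dots> \<le> (\<Sum>n. ?K * diam_weight u (U n))"
      using U by (intro suminf_le hausdorff_content_good_strip_le_diameter[OF x E \<tau> \<theta> u i]) (auto simp: bounded_covers_def)
    finally show ?thesis by simp
  qed
  then have "hausdorff_content \<tau> ?G / ?K \<le> (\<Sum>i. diam_weight u (U i))"
    if "U \<in> bounded_covers (proj (direction x) ` E)" for U
    using that by (subst divide_le_posI_ennreal) (auto simp: mult.commute)
  then have "hausdorff_content \<tau> ?G / ?K \<le> hausdorff_content u (proj (direction x) ` E)"
    unfolding hausdorff_content_def[of u] by (rule INF_greatest)
  then show False using 0 pos by (simp add: ennreal_divide_eq_0_iff)
qed

section \<open>The expected number of conflicts\<close>

text \<open>Branching at rate \<open>t\<close>, with a multiplicative error \<open>2 powr c\<close>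
  and an error exponential in the finer level \<open>n\<close>, not in \<open>n - m\<close>. For
  weakly regular sets only such an error can be obtained, because their counts are controlled
  globally; for AD-regular sets \<open>\<eta>\<close> is 0.\<close>

definition regular_counts :: "(real^2) set \<Rightarrow> real \<Rightarrow> real \<Rightarrow> real \<Rightarrow> bool" where
  "regular_counts E t \<eta> c \<longleftrightarrow>
     (\<forall>y\<in>E. \<forall>z\<in>E. cell 0 y = cell 0 z) \<and>
     (\<forall>m n. m \<le> n \<longrightarrow> (\<forall>y\<in>E. real (card (cell n ` {z \<in> E. cell m z = cell m y}))
        \<le> 2 powr ((real n - real m) * t + \<eta> * real n + c)))"

definition max_diff :: "int \<times> int \<Rightarrow> int \<times> int \<Rightarrow> int" where
  "max_diff p q = max \<bar>fst p - fst q\<bar> \<bar>snd p - snd q\<bar>"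

text \<open>A Frostman condition of exponent \<open>s\<close> for the law of \<open>X\<close>, down
  to scale \<open>2 ^ -l\<close> only. The loss \<open>B\<close> will be a small multiple of
  \<open>l\<close>, paying for the digits before the current window.\<close>

definition spread_at :: "'w measure \<Rightarrow> ('w \<Rightarrow> real) \<Rightarrow> real \<Rightarrow> nat \<Rightarrow> real \<Rightarrow> bool" where
  "spread_at P X s l B \<longleftrightarrow>
     (\<forall>k\<le>l. \<forall>c. measure P {\<omega> \<in> space P. c \<le> X \<omega> \<and> X \<omega> \<le> c + 2 powr - real k} \<le> 8 * 2 powr (B - s * real k))"

lemma regular_counts_same_cell: "regular_counts E t \<eta> c \<Longrightarrow> y \<in> E \<Longrightarrow> z \<in> E \<Longrightarrow> cell 0 y = cell 0 z"
  unfolding regular_counts_def by blast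

lemma finite_cells_regular: "regular_counts E t \<eta> c \<Longrightarrow> finite (cell n ` E)"
  by (rule finite_cells_if_bounded[OF bounded_if_same_cell[OF regular_counts_same_cell]])

lemma card_cells_regular_le:
  assumes "regular_counts E t \<eta> c"
  shows "real (card (cell n ` E)) \<le> 2 powr (real n * t + \<eta> * real n + c)"
proof (cases "E = {}")
  case False
  then obtain y where y: "y \<in> E" by auto
  then have "{z \<in> E. cell 0 z = cell 0 y} = E" using regular_counts_same_cell[OF assms] by blast
  moreover have "real (card (cell n ` {z \<in> E. cell 0 z = cell 0 y})) \<le> 2 powr ((real n - real 0) * t + \<eta> * real n + c)"
    using assms y unfolding regular_counts_def by blast
  ultimately show ?thesis by simp
qed simp

lemma sum_UN_le_nonneg:
  fixes f :: "'a \<Rightarrow> real"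
  assumes "finite I" "\<And>i. i \<in> I \<Longrightarrow> finite (A i)" "\<And>x. 0 \<le> f x"
  shows "sum f (\<Union>i\<in>I. A i) \<le> (\<Sum>i\<in>I. sum f (A i))"
  using assms(1,2)
proof (induction I)
  case (insert i I)
  have "sum f (A i \<union> (\<Union>i\<in>I. A i)) + sum f (A i \<inter> (\<Union>i\<in>I. A i)) = sum f (A i) + sum f (\<Union>i\<in>I. A i)"
    using insert by (intro sum.union_inter) auto
  moreover have "0 \<le> sum f (A i \<inter> (\<Union>i\<in>I. A i))" using assms(3) by (intro sum_nonneg) auto
  ultimately show ?case using insert by simp
qed simp

lemma abs_div_diff_le:
  fixes a b :: int
  assumes "\<bar>a - b\<bar> < k"
  shows "\<bar>a div k - b div k\<bar> \<le> 1"
proof -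
  have k: "0 < k" using assms by linarith
  have "a div k \<le> (b + k) div k" "b div k \<le> (a + k) div k"
    by (rule zdiv_mono1[OF _ k], use assms in linarith)+
  then show ?thesis using k by simp
qed

lemma abs_diff_less_if_div_eq:
  fixes a b :: int
  assumes "a div k = b div k" "0 < k"
  shows "\<bar>a - b\<bar> < k"
proof -
  have "a - b = a mod k - b mod k"
    using mult_div_mod_eq[of k a, symmetric] mult_div_mod_eq[of k b, symmetric] assms(1) by (metis add_diff_cancel_left)
  then show ?thesis
    using pos_mod_sign[OF assms(2), of a] pos_mod_bound[OF assms(2), of a]
      pos_mod_sign[OF assms(2), of b] pos_mod_bound[OF assms(2), of b] by linarith
qed

text \<open>Cells closer than \<open>2 ^ i\<close> to \<open>p\<close> have their ancestors
  \<open>i\<close> levels up in the 3 by 3 square around that of \<open>p\<close>, whence the factor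
  9.\<close>

lemma card_near_cells_le:
  assumes E: "regular_counts E t \<eta> c" and i: "i \<le> n"
  shows "real (card {q \<in> cell n ` E. max_diff p q < 2 ^ i}) \<le> 9 * 2 powr (real i * t + \<eta> * real n + c)"
proof -
  let ?g = "coarsen i p"
  let ?I = "{fst ?g - 1..fst ?g + 1} \<times> {snd ?g - 1..snd ?g + 1}"
  let ?C = "\<lambda>g. {q \<in> cell n ` E. coarsen i q = g}"
  have fin: "finite (?C g)" for g using finite_cells_regular[OF E, of n] by simp
  have one: "real (card (?C g)) \<le> 2 powr (real i * t + \<eta> * real n + c)" for g
  proof (cases "?C g = {}")
    case False
    then obtain y where y: "y \<in> E" "coarsen i (cell n y) = g" by auto
    have c: "coarsen i (cell n z) = cell (n - i) z" for z using coarsen_cell[of "n - i" n z] i by simp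
    have "?C g = cell n ` {z \<in> E. cell (n - i) z = cell (n - i) y}" using y c by auto
    moreover have "real (card (cell n ` {z \<in> E. cell (n - i) z = cell (n - i) y}))
        \<le> 2 powr ((real n - real (n - i)) * t + \<eta> * real n + c)"
      using E y(1) unfolding regular_counts_def by auto
    ultimately show ?thesis using i by (simp add: of_nat_diff)
  qed (simp only: card.empty of_nat_0 powr_ge_zero)
  have "{q \<in> cell n ` E. max_diff p q < 2 ^ i} \<subseteq> (\<Union>g\<in>?I. ?C g)"
  proof
    fix q assume q: "q \<in> {q \<in> cell n ` E. max_diff p q < 2 ^ i}"
    then have "\<bar>fst p - fst q\<bar> < 2 ^ i" "\<bar>snd p - snd q\<bar> < 2 ^ i" by (auto simp: max_diff_def)
    then have "\<bar>fst ?g - fst (coarsen i q)\<bar> \<le> 1" "\<bar>snd ?g - snd (coarsen i q)\<bar> \<le> 1"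
      by (simp_all add: coarsen_def abs_div_diff_le)
    then have "coarsen i q \<in> ?I" by (cases "coarsen i q") (simp add: abs_le_iff)
    then show "q \<in> (\<Union>g\<in>?I. ?C g)" using q by blast
  qed
  then have "card {q \<in> cell n ` E. max_diff p q < 2 ^ i} \<le> card (\<Union>g\<in>?I. ?C g)"
    using fin by (intro card_mono) auto
  also have "\<dots> \<le> (\<Sum>g\<in>?I. card (?C g))" by (intro card_UN_le) auto
  finally have "real (card {q \<in> cell n ` E. max_diff p q < 2 ^ i}) \<le> (\<Sum>g\<in>?I. real (card (?C g)))"
    by (simp only: of_nat_le_iff flip: of_nat_sum)
  also have "\<dots> \<le> (\<Sum>g\<in>?I. 2 powr (real i * t + \<eta> * real n + c))" by (intro sum_mono one)
  also have "\<dots> = 9 * 2 powr (real i * t + \<eta> * real n + c)" by simp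
  finally show ?thesis .
qed

section \<open>Probabilities of conflicts and expected crowd sizes\<close>

lemma sets_conflict:
  assumes "X \<in> borel_measurable P"
  shows "{\<omega> \<in> space P. conflict (X \<omega>) p q} \<in> sets P"
proof -
  have "(\<lambda>\<omega>. \<bar>a + X \<omega> * b\<bar>) \<in> borel_measurable P" for a b
    using assms by simp
  then show ?thesis unfolding conflict_def by (rule borel_measurable_le[OF _ borel_measurable_const])
qed

text \<open>A conflict between cells at distance \<open>d\<close> confines the slope to an interval of length
  about \<open>1 / d\<close>.\<close>

lemma prob_conflict_le:
  assumes P: "prob_space P" and X: "X \<in> borel_measurable P" and X01: "\<And>\<omega>. 0 \<le> X \<omega> \<and> X \<omega> \<le> 1"
    and sp: "spread_at P X s l B" and s: "0 \<le> s" "s \<le> 1" and B: "0 \<le> B"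
    and i: "i \<le> l" "i = 0 \<or> 2 ^ (i - 1) \<le> max_diff p q"
  shows "measure P {\<omega> \<in> space P. conflict (X \<omega>) p q} \<le> 256 * 2 powr (B - s * real i)"
proof -
  interpret prob_space P by (rule P)
  show ?thesis
  \<comment> \<open>Here \<open>s * i \<le> 4\<close> and \<open>B \<ge> 0\<close>, so the claimed
    bound is at least \<open>256 / 16\<close> and the probability bound 1 suffices.\<close>
  proof (cases "i \<le> 4")
    case True
    have "2 powr (- 4) \<le> (2::real) powr (B - s * real i)"
    proof (intro powr_mono)
      have "s * real i \<le> 1 * 4" using True s by (intro mult_mono) auto
      then show "- 4 \<le> B - s * real i" using B by simp
    qed auto
    then have "1 \<le> 256 * 2 powr (B - s * real i)"
      by (simp add: powr_minus powr_numeral)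
    then show ?thesis using prob_le_1 order_trans by blast
  next
    case False
    define a b where "a = real_of_int (fst p - fst q)" and "b = real_of_int (snd p - snd q)"
    \<comment> \<open>The shift by 5 turns the distance \<open>2 ^ (i - 1)\<close> into
      \<open>16 * 2 ^ k\<close>; it costs a factor of at most \<open>2 ^ 5\<close>, which raises the
      8 of \<open>spread_at\<close> to 256.\<close>
    define k where "k = i - 5"
    have ik: "i = k + 5" using False by (simp add: k_def)
    have "real_of_int (2 ^ (i - 1)) \<le> real_of_int (max_diff p q)" using i(2) ik by (subst of_int_le_iff) auto
    then have d: "16 * 2 ^ k \<le> max \<bar>a\<bar> \<bar>b\<bar>"
      by (simp add: ik a_def b_def max_diff_def power_add of_int_max)
    have k1: "(1::real) \<le> 2 ^ k" by simp
    show ?thesis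
    \<comment> \<open>If the vertical distance is small, the horizontal one is at least
      \<open>16 * 2 ^ k\<close> and no slope in \<open>[0, 1]\<close> can cancel it. Otherwise a
      conflict forces the slope to within \<open>2 ^ -k / 2\<close> of
      \<open>- a / b\<close>.\<close>
    proof (cases "\<bar>b\<bar> < 8 * 2 ^ k")
      case True
      have "\<not> conflict (X \<omega>) p q" for \<omega>
      proof -
        have "\<bar>X \<omega> * b\<bar> \<le> 1 * \<bar>b\<bar>" unfolding abs_mult using X01[of \<omega>] by (intro mult_right_mono) auto
        then have "4 < \<bar>a + X \<omega> * b\<bar>" using d True k1 by linarith
        then show ?thesis by (simp add: conflict_def a_def b_def)
      qed
      then show ?thesis by simp
    next
      case b: False
      then have b0: "b \<noteq> 0" using k1 by auto
      define c where "c = - a / b - 2 powr - real k / 2"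
      have kk: "2 powr - real k = 1 / 2 ^ k" by (simp add: powr_minus powr_realpow field_simps)
      have "{\<omega> \<in> space P. conflict (X \<omega>) p q} \<subseteq> {\<omega> \<in> space P. c \<le> X \<omega> \<and> X \<omega> \<le> c + 2 powr - real k}"
      proof clarify
        fix \<omega> assume "conflict (X \<omega>) p q"
        then have "\<bar>a + X \<omega> * b\<bar> \<le> 4" by (simp add: conflict_def a_def b_def)
        moreover have "a + X \<omega> * b = b * (X \<omega> - - a / b)" using b0 by (simp add: field_simps)
        ultimately have "\<bar>b\<bar> * \<bar>X \<omega> - - a / b\<bar> \<le> 4" by (simp only: abs_mult)
        moreover have "(8 * 2 ^ k) * \<bar>X \<omega> - - a / b\<bar> \<le> \<bar>b\<bar> * \<bar>X \<omega> - - a / b\<bar>"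
          using b by (intro mult_right_mono) auto
        ultimately have "\<bar>X \<omega> - - a / b\<bar> \<le> (1 / 2 ^ k) / 2" by (simp add: field_simps)
        then show "c \<le> X \<omega> \<and> X \<omega> \<le> c + 2 powr - real k" unfolding c_def kk by (simp add: abs_le_iff)
      qed
      then have "measure P {\<omega> \<in> space P. conflict (X \<omega>) p q} \<le> measure P {\<omega> \<in> space P. c \<le> X \<omega> \<and> X \<omega> \<le> c + 2 powr - real k}"
        using X by (intro finite_measure_mono) auto
      also have "\<dots> \<le> 8 * 2 powr (B - s * real k)"
        using sp i(1) ik unfolding spread_at_def by auto
      also have "\<dots> \<le> 8 * 2 powr (5 + (B - s * real i))"
        using s by (intro mult_left_mono powr_mono) (auto simp: ik algebra_simps)
      also have "\<dots> = 256 * 2 powr (B - s * real i)" by (simp add: powr_add powr_numeral)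
      finally show ?thesis .
    qed
  qed
qed

text \<open>A discrete form of Kaufman's energy estimate. There are about
  \<open>2 powr (t * i)\<close> cells at distance about \<open>2 ^ i\<close>, each in conflict with
  probability about \<open>2 powr (- s * i)\<close>; as \<open>t \<le> s\<close>, each of the
  \<open>l + 1\<close> distances contributes boundedly, up to the error terms. Since a factor
  \<open>l + 1\<close> is affordable, \<open>t = s\<close> is allowed. The constant is
  \<open>9 * 256\<close>.\<close>

lemma sum_prob_conflict_le:
  assumes P: "prob_space P" and X: "X \<in> borel_measurable P" and X01: "\<And>\<omega>. 0 \<le> X \<omega> \<and> X \<omega> \<le> 1"
    and sp: "spread_at P X s l B" and s: "0 \<le> s" "s \<le> 1" and B: "0 \<le> B"
    and E: "regular_counts E t \<eta> c" and ts: "t \<le> s"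
  shows "(\<Sum>q\<in>{q \<in> cell (m + l) ` E. coarsen l q = coarsen l p}. measure P {\<omega> \<in> space P. conflict (X \<omega>) p q})
           \<le> real (l + 1) * (2304 * 2 powr (B + \<eta> * real (m + l) + c))"
proof -
  let ?S = "{q \<in> cell (m + l) ` E. coarsen l q = coarsen l p}"
  let ?T = "\<lambda>i. {q \<in> cell (m + l) ` E. max_diff p q < 2 ^ i \<and> (i = 0 \<or> 2 ^ (i - 1) \<le> max_diff p q)}"
  let ?f = "\<lambda>q. measure P {\<omega> \<in> space P. conflict (X \<omega>) p q}"
  have fin: "finite (cell (m + l) ` E)" by (rule finite_cells_regular[OF E])
  have "?S \<subseteq> (\<Union>i\<in>{..l}. ?T i)"
  proof
    fix q assume q: "q \<in> ?S"
    then have "fst p div 2 ^ l = fst q div 2 ^ l" "snd p div 2 ^ l = snd q div 2 ^ l"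
      by (auto simp: coarsen_def)
    then have d: "max_diff p q < 2 ^ l"
      by (simp add: max_diff_def abs_diff_less_if_div_eq)
    define i where "i = (LEAST i. max_diff p q < 2 ^ i)"
    have i1: "max_diff p q < 2 ^ i" unfolding i_def using d by (rule LeastI)
    have i2: "i \<le> l" unfolding i_def using d by (rule Least_le)
    have "i = 0 \<or> 2 ^ (i - 1) \<le> max_diff p q"
      using not_less_Least[of "i - 1" "\<lambda>i. max_diff p q < 2 ^ i"] unfolding i_def[symmetric] by (cases i) auto
    then show "q \<in> (\<Union>i\<in>{..l}. ?T i)" using q i1 i2 by blast
  qed
  then have "sum ?f ?S \<le> sum ?f (\<Union>i\<in>{..l}. ?T i)"
    using fin by (intro sum_mono2) auto
  also have "\<dots> \<le> (\<Sum>i\<in>{..l}. sum ?f (?T i))"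
    using fin by (intro sum_UN_le_nonneg) auto
  also have "\<dots> \<le> (\<Sum>i\<in>{..l}. 2304 * 2 powr (B + \<eta> * real (m + l) + c))"
  proof (rule sum_mono)
    fix i assume "i \<in> {..l}"
    then have i: "i \<le> l" by simp
    have "sum ?f (?T i) \<le> (\<Sum>q\<in>?T i. 256 * 2 powr (B - s * real i))"
      using i by (intro sum_mono prob_conflict_le[OF P X X01 sp s B]) auto
    also have "\<dots> = real (card (?T i)) * (256 * 2 powr (B - s * real i))" by simp
    also have "\<dots> \<le> (9 * 2 powr (real i * t + \<eta> * real (m + l) + c)) * (256 * 2 powr (B - s * real i))"
    proof (rule mult_right_mono)
      have "card (?T i) \<le> card {q \<in> cell (m + l) ` E. max_diff p q < 2 ^ i}"
        using fin by (intro card_mono) auto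
      then have "real (card (?T i)) \<le> real (card {q \<in> cell (m + l) ` E. max_diff p q < 2 ^ i})"
        by (simp only: of_nat_le_iff)
      also have "\<dots> \<le> 9 * 2 powr (real i * t + \<eta> * real (m + l) + c)"
        using i by (intro card_near_cells_le[OF E]) auto
      finally show "real (card (?T i)) \<le> 9 * 2 powr (real i * t + \<eta> * real (m + l) + c)" .
    qed auto
    also have "\<dots> = 2304 * 2 powr ((real i * t + \<eta> * real (m + l) + c) + (B - s * real i))"
      by (simp only: powr_add)
    also have "\<dots> \<le> 2304 * 2 powr (B + \<eta> * real (m + l) + c)"
      using mult_left_mono[OF ts, of "real i"] by (intro mult_left_mono powr_mono) (auto simp: algebra_simps)
    finally show "sum ?f (?T i) \<le> 2304 * 2 powr (B + \<eta> * real (m + l) + c)" .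
  qed
  also have "\<dots> = real (l + 1) * (2304 * 2 powr (B + \<eta> * real (m + l) + c))" by simp
  finally show ?thesis .
qed


definition total_crowd :: "(real^2) set \<Rightarrow> nat \<Rightarrow> nat \<Rightarrow> real \<Rightarrow> ennreal" where
  "total_crowd E m l x = (\<Sum>p\<in>cell (m + l) ` E. of_nat (card (crowd E m l x p)))"

lemma total_crowd_eq:
  assumes "finite (cell (m + l) ` E)"
  shows "total_crowd E m l (X \<omega>) = (\<Sum>p\<in>cell (m + l) ` E. \<Sum>q\<in>{q \<in> cell (m + l) ` E. coarsen l q = coarsen l p}.
           indicator {\<omega>. conflict (X \<omega>) p q} \<omega>)"
  unfolding total_crowd_def
proof (rule sum.cong[OF refl])
  fix p
  let ?S = "{q \<in> cell (m + l) ` E. coarsen l q = coarsen l p}"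
  have "crowd E m l (X \<omega>) p = ?S \<inter> {q. conflict (X \<omega>) p q}" by (auto simp: crowd_def)
  then have "of_nat (card (crowd E m l (X \<omega>) p)) = (\<Sum>q\<in>?S \<inter> {q. conflict (X \<omega>) p q}. 1::ennreal)"
    by simp
  also have "\<dots> = (\<Sum>q\<in>?S. indicator {\<omega>. conflict (X \<omega>) p q} \<omega>)"
    using assms by (intro sum.mono_neutral_cong_left) (auto simp: indicator_def)
  finally show "(of_nat (card (crowd E m l (X \<omega>) p)) :: ennreal) = (\<Sum>q\<in>?S. indicator {\<omega>. conflict (X \<omega>) p q} \<omega>)" .
qed

lemma indicator_conflict_measurable:
  assumes "X \<in> borel_measurable P"
  shows "(\<lambda>\<omega>. indicator {\<omega>. conflict (X \<omega>) p q} \<omega> :: ennreal) \<in> borel_measurable P"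
proof -
  have "(\<lambda>\<omega>. indicator {\<omega> \<in> space P. conflict (X \<omega>) p q} \<omega> :: ennreal) \<in> borel_measurable P"
    using sets_conflict[OF assms] by (rule borel_measurable_indicator)
  then show ?thesis
    by (rule measurable_cong[THEN iffD1, rotated]) (auto simp: indicator_def)
qed

lemma total_crowd_measurable:
  assumes "finite (cell (m + l) ` E)" "X \<in> borel_measurable P"
  shows "(\<lambda>\<omega>. total_crowd E m l (X \<omega>)) \<in> borel_measurable P"
  unfolding total_crowd_eq[OF assms(1)]
  by (intro borel_measurable_sum indicator_conflict_measurable assms)

text \<open>The errors \<open>\<eta> * n\<close> and \<open>c\<close> occur twice, once for the
  number of cells \<open>p\<close> and once for the number of neighbours of each
  \<open>p\<close>.\<close>

lemma nn_integral_total_crowd_le: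
  assumes P: "prob_space P" and X: "X \<in> borel_measurable P" and X01: "\<And>\<omega>. 0 \<le> X \<omega> \<and> X \<omega> \<le> 1"
    and sp: "spread_at P X s l B" and s: "0 \<le> s" "s \<le> 1" and B: "0 \<le> B"
    and E: "regular_counts E t \<eta> c" and ts: "t \<le> s" and n: "n = m + l"
  shows "(\<integral>\<^sup>+\<omega>. total_crowd E m l (X \<omega>) \<partial>P)
           \<le> ennreal (real (l + 1) * 2304 * 2 powr (real n * t + 2 * (\<eta> * real n) + 2 * c + B))"
proof -
  interpret prob_space P by (rule P)
  have fin: "finite (cell (m + l) ` E)" by (rule finite_cells_regular[OF E])
  have one: "(\<integral>\<^sup>+\<omega>. indicator {\<omega>. conflict (X \<omega>) p q} \<omega> \<partial>P) = ennreal (measure P {\<omega> \<in> space P. conflict (X \<omega>) p q})" for p q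
  proof -
    have "(\<integral>\<^sup>+\<omega>. indicator {\<omega>. conflict (X \<omega>) p q} \<omega> \<partial>P) = (\<integral>\<^sup>+\<omega>. indicator {\<omega> \<in> space P. conflict (X \<omega>) p q} \<omega> \<partial>P)"
      by (rule nn_integral_cong) (auto simp: indicator_def)
    also have "\<dots> = emeasure P {\<omega> \<in> space P. conflict (X \<omega>) p q}"
      by (rule nn_integral_indicator[OF sets_conflict[OF X]])
    finally show ?thesis by (simp add: emeasure_eq_measure)
  qed
  have "(\<integral>\<^sup>+\<omega>. total_crowd E m l (X \<omega>) \<partial>P) =
      (\<Sum>p\<in>cell (m + l) ` E. \<Sum>q\<in>{q \<in> cell (m + l) ` E. coarsen l q = coarsen l p}.
         ennreal (measure P {\<omega> \<in> space P. conflict (X \<omega>) p q}))"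
    unfolding total_crowd_eq[OF fin] one[symmetric]
    by (subst nn_integral_sum, intro borel_measurable_sum indicator_conflict_measurable X)
       (intro sum.cong refl nn_integral_sum indicator_conflict_measurable X)
  also have "\<dots> = ennreal (\<Sum>p\<in>cell (m + l) ` E. \<Sum>q\<in>{q \<in> cell (m + l) ` E. coarsen l q = coarsen l p}.
         measure P {\<omega> \<in> space P. conflict (X \<omega>) p q})"
    by (simp add: sum_nonneg)
  also have "\<dots> \<le> ennreal (\<Sum>p\<in>cell (m + l) ` E. real (l + 1) * (2304 * 2 powr (B + \<eta> * real (m + l) + c)))"
    by (intro ennreal_leI sum_mono sum_prob_conflict_le[OF P X X01 sp s B E ts])
  also have "\<dots> = ennreal (real (card (cell n ` E)) * (real (l + 1) * (2304 * 2 powr (B + \<eta> * real n + c))))"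
    by (simp add: n)
  also have "\<dots> \<le> ennreal (2 powr (real n * t + \<eta> * real n + c) * (real (l + 1) * (2304 * 2 powr (B + \<eta> * real n + c))))"
    by (intro ennreal_leI mult_right_mono card_cells_regular_le[OF E]) auto
  also have "2 powr (real n * t + \<eta> * real n + c) * (real (l + 1) * (2304 * 2 powr (B + \<eta> * real n + c)))
      = real (l + 1) * 2304 * (2 powr (real n * t + \<eta> * real n + c) * 2 powr (B + \<eta> * real n + c))"
    by (simp only: mult_ac)
  also have "2 powr (real n * t + \<eta> * real n + c) * 2 powr (B + \<eta> * real n + c)
      = 2 powr (real n * t + 2 * (\<eta> * real n) + 2 * c + B)"
    by (simp only: powr_add[symmetric]) (simp add: algebra_simps)
  finally show ?thesis .
qed

text \<open>Markov's inequality for the counting measure on cells, at a fixed slope.\<close>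

lemma card_bad_cells_le:
  assumes "finite (cell (m + l) ` E)"
  shows "of_nat (card (bad_cells E \<theta> m l x)) \<le> ennreal (2 powr - (\<theta> * real l)) * total_crowd E m l x"
proof -
  let ?b = "2 powr (\<theta> * real l)"
  have fb: "finite (bad_cells E \<theta> m l x)"
    by (rule finite_subset[OF _ assms]) (auto simp: bad_cells_def)
  have "real (card (bad_cells E \<theta> m l x)) * ?b = (\<Sum>p\<in>bad_cells E \<theta> m l x. ?b)" by simp
  also have "\<dots> \<le> (\<Sum>p\<in>bad_cells E \<theta> m l x. real (card (crowd E m l x p)))"
    by (intro sum_mono) (auto simp: bad_cells_def)
  also have "\<dots> \<le> (\<Sum>p\<in>cell (m + l) ` E. real (card (crowd E m l x p)))"
    using assms by (intro sum_mono2) (auto simp: bad_cells_def)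
  finally have "real (card (bad_cells E \<theta> m l x)) \<le> 2 powr - (\<theta> * real l) * (\<Sum>p\<in>cell (m + l) ` E. real (card (crowd E m l x p)))"
    by (simp add: powr_minus field_simps)
  then have "ennreal (real (card (bad_cells E \<theta> m l x))) \<le> ennreal (2 powr - (\<theta> * real l) * (\<Sum>p\<in>cell (m + l) ` E. real (card (crowd E m l x p))))"
    by (rule ennreal_leI)
  also have "\<dots> = ennreal (2 powr - (\<theta> * real l)) * total_crowd E m l x"
    unfolding total_crowd_def
    by (simp add: ennreal_mult sum_nonneg sum_ennreal[symmetric] ennreal_of_nat_eq_real_of_nat del: sum_ennreal)
  finally show ?thesis by (simp add: ennreal_of_nat_eq_real_of_nat)
qed

text \<open>By Markov's inequality this bounds the total weight of the bad cells; unlike that weight it is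
  clearly a measurable function of a random slope.\<close>

definition bad_weight :: "(real^2) set \<Rightarrow> real \<Rightarrow> real \<Rightarrow> nat \<Rightarrow> nat \<Rightarrow> real \<Rightarrow> ennreal" where
  "bad_weight E \<tau> \<theta> i l x = (\<Sum>j<i. ennreal (2 * 2 powr - (real (j * l + l) * \<tau>)) *
     (ennreal (2 powr - (\<theta> * real l)) * total_crowd E (j * l) l x))"

text \<open>A point of \<open>E\<close> that is not good lies in a bad cell of some scale and block,
  and a bad cell of level \<open>n\<close> has content at most
  \<open>2 * 2 powr - (n * \<tau>)\<close>. Only subadditivity is used, so \<open>E\<close> may be
  arbitrary.\<close>

lemma hausdorff_content_le_good_plus_bad:
  assumes E: "regular_counts E t \<eta> c" and \<tau>: "0 < \<tau>" "\<tau> \<le> 1"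
  shows "hausdorff_content \<tau> E \<le> hausdorff_content \<tau> (good_points E \<theta> i N0 x)
           + (\<Sum>k. bad_weight E \<tau> \<theta> (i (k + N0)) ((k + N0) div i (k + N0)) x)"
proof -
  let ?l = "\<lambda>N. N div i N"
  let ?B = "\<lambda>N j. (\<Union>p\<in>bad_cells E \<theta> (j * ?l N) (?l N) x. {y. cell (j * ?l N + ?l N) y = p})"
  have fb: "finite (bad_cells E \<theta> m l x)" for m l
    by (rule finite_subset[OF _ finite_cells_regular[OF E, of "m + l"]]) (auto simp: bad_cells_def)
  have one: "hausdorff_content \<tau> (?B N j) \<le> ennreal (2 * 2 powr - (real (j * ?l N + ?l N) * \<tau>)) *
     (ennreal (2 powr - (\<theta> * real (?l N))) * total_crowd E (j * ?l N) (?l N) x)" for N j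
  proof -
    have "hausdorff_content \<tau> (?B N j) \<le> (\<Sum>p\<in>bad_cells E \<theta> (j * ?l N) (?l N) x. hausdorff_content \<tau> {y. cell (j * ?l N + ?l N) y = p})"
      by (rule hausdorff_content_finite_UN_le[OF fb])
    also have "\<dots> \<le> (\<Sum>p\<in>bad_cells E \<theta> (j * ?l N) (?l N) x. ennreal (2 * 2 powr - (real (j * ?l N + ?l N) * \<tau>)))"
      by (intro sum_mono hausdorff_content_same_cell_le[where n = "j * ?l N + ?l N"] \<tau>) simp
    also have "\<dots> = ennreal (2 * 2 powr - (real (j * ?l N + ?l N) * \<tau>)) * of_nat (card (bad_cells E \<theta> (j * ?l N) (?l N) x))"
      by (simp add: mult.commute)
    also have "\<dots> \<le> ennreal (2 * 2 powr - (real (j * ?l N + ?l N) * \<tau>)) * (ennreal (2 powr - (\<theta> * real (?l N))) * total_crowd E (j * ?l N) (?l N) x)"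
      by (intro mult_left_mono card_bad_cells_le finite_cells_regular[OF E]) simp
    finally show ?thesis .
  qed
  have "E \<subseteq> good_points E \<theta> i N0 x \<union> (\<Union>k. \<Union>j\<in>{..<i (k + N0)}. ?B (k + N0) j)"
  proof
    fix y assume y: "y \<in> E"
    show "y \<in> good_points E \<theta> i N0 x \<union> (\<Union>k. \<Union>j\<in>{..<i (k + N0)}. ?B (k + N0) j)"
    proof (cases "y \<in> good_points E \<theta> i N0 x")
      case False
      then obtain N j where N: "N \<ge> N0" "j < i N" "cell (j * ?l N + ?l N) y \<in> bad_cells E \<theta> (j * ?l N) (?l N) x"
        using y by (auto simp: good_points_def)
      then have "y \<in> ?B N j" by blast
      then have "y \<in> (\<Union>j\<in>{..<i (N - N0 + N0)}. ?B (N - N0 + N0) j)"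
        using N by (simp only: le_add_diff_inverse2) blast
      then show ?thesis by blast
    qed simp
  qed
  then have "hausdorff_content \<tau> E \<le> hausdorff_content \<tau> (good_points E \<theta> i N0 x \<union> (\<Union>k. \<Union>j\<in>{..<i (k + N0)}. ?B (k + N0) j))"
    by (rule hausdorff_content_mono)
  also have "\<dots> \<le> hausdorff_content \<tau> (good_points E \<theta> i N0 x) + hausdorff_content \<tau> (\<Union>k. \<Union>j\<in>{..<i (k + N0)}. ?B (k + N0) j)"
    by (rule hausdorff_content_Un_le)
  also have "hausdorff_content \<tau> (\<Union>k. \<Union>j\<in>{..<i (k + N0)}. ?B (k + N0) j) \<le> (\<Sum>k. hausdorff_content \<tau> (\<Union>j\<in>{..<i (k + N0)}. ?B (k + N0) j))"
    by (rule hausdorff_content_UN_le)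
  also have "\<dots> \<le> (\<Sum>k. bad_weight E \<tau> \<theta> (i (k + N0)) (?l (k + N0)) x)"
  proof (rule suminf_le)
    fix k
    have "hausdorff_content \<tau> (\<Union>j\<in>{..<i (k + N0)}. ?B (k + N0) j) \<le> (\<Sum>j<i (k + N0). hausdorff_content \<tau> (?B (k + N0) j))"
      by (rule hausdorff_content_finite_UN_le) simp
    also have "\<dots> \<le> bad_weight E \<tau> \<theta> (i (k + N0)) (?l (k + N0)) x"
      unfolding bad_weight_def by (intro sum_mono one)
    finally show "hausdorff_content \<tau> (\<Union>j\<in>{..<i (k + N0)}. ?B (k + N0) j) \<le> bad_weight E \<tau> \<theta> (i (k + N0)) (?l (k + N0)) x" .
  qed auto
  finally show ?thesis by (simp add: add_left_mono)
qed

lemma bad_weight_measurable: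
  assumes "regular_counts E t \<eta> c" "X \<in> borel_measurable P"
  shows "(\<lambda>\<omega>. bad_weight E \<tau> \<theta> i l (X \<omega>)) \<in> borel_measurable P"
  unfolding bad_weight_def
  by (intro borel_measurable_sum borel_measurable_times_ennreal borel_measurable_const
      total_crowd_measurable finite_cells_regular[OF assms(1)] assms(2))


text \<open>For a cell level \<open>n \<le> i * l\<close>, the mismatch
  \<open>t - \<tau> \<le> \<eta>\<close> and the two count errors cost at most
  \<open>3 * \<eta> * n\<close>, which is at most \<open>\<theta> * l / 4\<close> by the condition
  with constant 12. The spread costs another \<open>\<theta> * l / 4\<close>, and Markov's
  inequality gains \<open>\<theta> * l\<close>; half of the gain remains.\<close>

lemma nn_integral_bad_weight_le:
  assumes P: "prob_space P" and X: "X \<in> borel_measurable P" and X01: "\<And>\<omega>. 0 \<le> X \<omega> \<and> X \<omega> \<le> 1"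
    and s: "0 \<le> s" "s \<le> 1" and E: "regular_counts E t \<eta> c" and ts: "t \<le> s"
    and \<tau>: "t - \<eta> \<le> \<tau>" and \<eta>: "0 \<le> \<eta>" and \<theta>: "0 \<le> \<theta>"
    and i: "1 \<le> i" "i * i \<le> N" "12 * \<eta> * real i \<le> \<theta>"
    and sp: "spread_at P X s (N div i) (\<theta> * real (N div i) / 4)"
  shows "(\<integral>\<^sup>+\<omega>. bad_weight E \<tau> \<theta> i (N div i) (X \<omega>) \<partial>P)
           \<le> ennreal (9216 * 2 powr (2 * c) * (real N * 2 powr - (\<theta> / 2 * (sqrt (real N) - 1))))"
proof -
  define l where "l = N div i"
  have il: "i * l \<le> N" "N < i * (l + 1)"
  proof -
    have "N = i * (N div i) + N mod i" "N mod i < i" using i(1) by simp_all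
    then have "i * (N div i) \<le> N" "N < i * (N div i) + i" by linarith+
    then show "i * l \<le> N" "N < i * (l + 1)" unfolding l_def distrib_left mult_1_right by blast+
  qed
  \<comment> \<open>\<open>i * i \<le> N\<close> makes the block length at least about
    \<open>sqrt N\<close>, so the remaining gain beats the polynomial factors.\<close>
  have sq: "sqrt (real N) - 1 \<le> real l"
  proof -
    have "real i \<le> sqrt (real N)" using i(2) by (intro real_le_rsqrt) (simp add: power2_eq_square flip: of_nat_mult)
    then have "real i * real (l + 1) \<le> sqrt (real N) * real (l + 1)" by (intro mult_right_mono) auto
    moreover have "real N < real i * real (l + 1)" using il(2) by (simp only: of_nat_less_iff flip: of_nat_mult)
    moreover have "real N = sqrt (real N) * sqrt (real N)" by simp
    ultimately have "sqrt (real N) * sqrt (real N) < sqrt (real N) * real (l + 1)" by linarith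
    then have "sqrt (real N) < real (l + 1)" by (rule mult_left_less_imp_less) simp
    then show ?thesis by simp
  qed
  let ?w = "4608 * 2 powr (2 * c) * (real (l + 1) * 2 powr - (\<theta> * real l / 2))"
  have one: "(\<integral>\<^sup>+\<omega>. ennreal (2 * 2 powr - (real (j * l + l) * \<tau>)) *
     (ennreal (2 powr - (\<theta> * real l)) * total_crowd E (j * l) l (X \<omega>)) \<partial>P) \<le> ennreal ?w" if j: "j < i" for j
  proof -
    define n where "n = j * l + l"
    have n: "real n \<le> real i * real l"
    proof -
      have "Suc j * l \<le> i * l" using j by (intro mult_le_mono1) auto
      then show ?thesis unfolding n_def by (simp only: mult_Suc add.commute of_nat_le_iff flip: of_nat_mult)
    qed
    have fin: "finite (cell (j * l + l) ` E)" by (rule finite_cells_regular[OF E])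
    have "(\<integral>\<^sup>+\<omega>. ennreal (2 * 2 powr - (real n * \<tau>)) *
     (ennreal (2 powr - (\<theta> * real l)) * total_crowd E (j * l) l (X \<omega>)) \<partial>P) =
      ennreal (2 * 2 powr - (real n * \<tau>)) * (ennreal (2 powr - (\<theta> * real l)) * (\<integral>\<^sup>+\<omega>. total_crowd E (j * l) l (X \<omega>) \<partial>P))"
      using total_crowd_measurable[OF fin X] by (simp add: nn_integral_cmult)
    also have "\<dots> \<le> ennreal (2 * 2 powr - (real n * \<tau>)) * (ennreal (2 powr - (\<theta> * real l)) *
        ennreal (real (l + 1) * 2304 * 2 powr (real n * t + 2 * (\<eta> * real n) + 2 * c + \<theta> * real l / 4)))"
      using \<theta> by (intro mult_left_mono nn_integral_total_crowd_le[OF P X X01 sp[folded l_def] s _ E ts]) (auto simp: n_def)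
    also have "\<dots> = ennreal (2 * 2 powr - (real n * \<tau>) * (2 powr - (\<theta> * real l) *
        (real (l + 1) * 2304 * 2 powr (real n * t + 2 * (\<eta> * real n) + 2 * c + \<theta> * real l / 4))))"
      by (simp add: ennreal_mult')
    also have "2 * 2 powr - (real n * \<tau>) * (2 powr - (\<theta> * real l) *
        (real (l + 1) * 2304 * 2 powr (real n * t + 2 * (\<eta> * real n) + 2 * c + \<theta> * real l / 4)))
      = 4608 * real (l + 1) * (2 powr - (real n * \<tau>) * (2 powr - (\<theta> * real l) *
          2 powr (real n * t + 2 * (\<eta> * real n) + 2 * c + \<theta> * real l / 4)))" by (simp only: mult_ac)
    also have "(2 powr - (real n * \<tau>) * (2 powr - (\<theta> * real l) *
          2 powr (real n * t + 2 * (\<eta> * real n) + 2 * c + \<theta> * real l / 4)))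
        = 2 powr (- (real n * \<tau>) + (- (\<theta> * real l) + (real n * t + 2 * (\<eta> * real n) + 2 * c + \<theta> * real l / 4)))"
      by (simp only: powr_add)
    also have "ennreal (4608 * real (l + 1) * \<dots>) \<le> ennreal (4608 * real (l + 1) * 2 powr (2 * c + - (\<theta> * real l / 2)))"
    proof (intro ennreal_leI mult_left_mono powr_mono)
      have "real n * (t - \<tau>) \<le> real n * \<eta>" using \<tau> by (intro mult_left_mono) auto
      then have a: "real n * t \<le> real n * \<tau> + \<eta> * real n" by (simp add: algebra_simps)
      have "12 * (\<eta> * real n) \<le> 12 * (\<eta> * (real i * real l))"
        using n \<eta> by (intro mult_left_mono) auto
      also have "\<dots> = (12 * \<eta> * real i) * real l" by simp
      also have "\<dots> \<le> \<theta> * real l" using i(3) by (intro mult_right_mono) auto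
      finally have "12 * (\<eta> * real n) \<le> \<theta> * real l" .
      then show "- (real n * \<tau>) + (- (\<theta> * real l) + (real n * t + 2 * (\<eta> * real n) + 2 * c + \<theta> * real l / 4))
          \<le> 2 * c + - (\<theta> * real l / 2)" using a by linarith
    qed auto
    also have "4608 * real (l + 1) * 2 powr (2 * c + - (\<theta> * real l / 2)) = ?w"
      by (simp only: powr_add mult_ac)
    finally show ?thesis unfolding n_def .
  qed
  have "(\<integral>\<^sup>+\<omega>. bad_weight E \<tau> \<theta> i l (X \<omega>) \<partial>P) = (\<Sum>j<i. \<integral>\<^sup>+\<omega>. ennreal (2 * 2 powr - (real (j * l + l) * \<tau>)) *
     (ennreal (2 powr - (\<theta> * real l)) * total_crowd E (j * l) l (X \<omega>)) \<partial>P)"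
    unfolding bad_weight_def
    by (intro nn_integral_sum borel_measurable_times_ennreal borel_measurable_const
      total_crowd_measurable finite_cells_regular[OF E] X)
  also have "\<dots> \<le> (\<Sum>j<i. ennreal ?w)" by (intro sum_mono one) simp
  also have "\<dots> = ennreal (real i * ?w)" by (simp add: ennreal_mult'' ennreal_of_nat_eq_real_of_nat)
  also have "\<dots> \<le> ennreal (9216 * 2 powr (2 * c) * (real N * 2 powr - (\<theta> / 2 * (sqrt (real N) - 1))))"
  proof (rule ennreal_leI)
    have "i \<le> N" using i(1,2) by (metis le_square order_trans)
    then have "i * (l + 1) \<le> 2 * N" using il(1) by simp
    then have "real (i * (l + 1)) \<le> real (2 * N)" by (simp only: of_nat_le_iff)
    then have "real i * real (l + 1) \<le> 2 * real N" by (simp only: of_nat_mult of_nat_numeral)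
    moreover have "2 powr - (\<theta> * real l / 2) \<le> 2 powr - (\<theta> / 2 * (sqrt (real N) - 1))"
      using mult_left_mono[OF sq, of "\<theta> / 2"] \<theta> by (intro powr_mono) auto
    ultimately have "(real i * real (l + 1)) * 2 powr - (\<theta> * real l / 2) \<le> (2 * real N) * 2 powr - (\<theta> / 2 * (sqrt (real N) - 1))"
      by (rule mult_mono) auto
    then have "4608 * 2 powr (2 * c) * ((real i * real (l + 1)) * 2 powr - (\<theta> * real l / 2)) \<le> 4608 * 2 powr (2 * c) * ((2 * real N) * 2 powr - (\<theta> / 2 * (sqrt (real N) - 1)))"
      by (rule mult_left_mono) auto
    then show "real i * ?w \<le> 9216 * 2 powr (2 * c) * (real N * 2 powr - (\<theta> / 2 * (sqrt (real N) - 1)))"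
      by (simp add: mult_ac)
  qed
  finally show ?thesis unfolding l_def .
qed

lemma summable_stretched_exponential:
  assumes "0 < \<theta>"
  shows "summable (\<lambda>N. real N * 2 powr - (\<theta> / 2 * (sqrt (real N) - 1)))"
proof (rule summable_comparison_test_bigo)
  show "summable (\<lambda>N. norm (1 / real N ^ 2))"
    using inverse_power_summable[of 2, where 'a = real] by (simp add: inverse_eq_divide)
  show "(\<lambda>N. real N * 2 powr - (\<theta> / 2 * (sqrt (real N) - 1))) \<in> O(\<lambda>N. 1 / real N ^ 2)"
    using assms by real_asymp
qed

text \<open>The content of the good points need not depend measurably on the outcome. All
  probability is therefore put into the measurable majorant \<open>W\<close> of the deleted content,
  and \<open>N0\<close> makes the tail of the summable expectations small.\<close>

lemma exists_small_bad_weight: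
  assumes P: "prob_space P" and X: "X \<in> borel_measurable P" and X01: "\<And>\<omega>. 0 \<le> X \<omega> \<and> X \<omega> \<le> 1"
    and s: "0 \<le> s" "s \<le> 1" and E: "regular_counts E t \<eta> c" and ts: "t \<le> s"
    and \<tau>: "0 < \<tau>" "\<tau> \<le> 1" "t - \<eta> \<le> \<tau>" and \<eta>: "0 \<le> \<eta>" and \<theta>: "0 < \<theta>" and e: "0 < e"
    and i: "\<And>N. N1 \<le> N \<Longrightarrow> 1 \<le> i N \<and> i N * i N \<le> N \<and> 12 * \<eta> * real (i N) \<le> \<theta> \<and>
              spread_at P X s (N div i N) (\<theta> * real (N div i N) / 4)"
  obtains N0 W where "N1 \<le> N0" "W \<in> borel_measurable P" "(\<integral>\<^sup>+\<omega>. W \<omega> \<partial>P) \<le> ennreal e"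
    "\<And>\<omega>. hausdorff_content \<tau> E \<le> hausdorff_content \<tau> (good_points E \<theta> i N0 (X \<omega>)) + W \<omega>"
proof -
  define f where "f = (\<lambda>N. 9216 * 2 powr (2 * c) * (real N * 2 powr - (\<theta> / 2 * (sqrt (real N) - 1))))"
  have f: "summable f" unfolding f_def by (intro summable_mult summable_stretched_exponential \<theta>)
  have f0: "0 \<le> f N" for N by (simp add: f_def)
  obtain M where M: "\<And>n. n \<ge> M \<Longrightarrow> norm (\<Sum>k. f (k + n)) < e"
    using suminf_exist_split[OF e f] by auto
  define N0 where "N0 = max M N1"
  define W where "W = (\<lambda>\<omega>. \<Sum>k. bad_weight E \<tau> \<theta> (i (k + N0)) ((k + N0) div i (k + N0)) (X \<omega>))"
  have "(\<integral>\<^sup>+\<omega>. W \<omega> \<partial>P) = (\<Sum>k. \<integral>\<^sup>+\<omega>. bad_weight E \<tau> \<theta> (i (k + N0)) ((k + N0) div i (k + N0)) (X \<omega>) \<partial>P)"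
    unfolding W_def by (intro nn_integral_suminf bad_weight_measurable[OF E X])
  also have "\<dots> \<le> (\<Sum>k. ennreal (f (k + N0)))"
  proof (intro suminf_le)
    fix k
    have "N1 \<le> k + N0" by (simp add: N0_def)
    then show "(\<integral>\<^sup>+\<omega>. bad_weight E \<tau> \<theta> (i (k + N0)) ((k + N0) div i (k + N0)) (X \<omega>) \<partial>P) \<le> ennreal (f (k + N0))"
      unfolding f_def using i[of "k + N0"] \<theta>
      by (intro nn_integral_bad_weight_le[OF P X X01 s E ts \<tau>(3) \<eta>]) auto
  qed auto
  also have "\<dots> = ennreal (\<Sum>k. f (k + N0))"
    using f f0 by (intro suminf_ennreal2) (auto simp: summable_iff_shift)
  also have "\<dots> \<le> ennreal e"
    using M[of N0] by (intro ennreal_leI) (auto simp: N0_def)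
  finally have "(\<integral>\<^sup>+\<omega>. W \<omega> \<partial>P) \<le> ennreal e" .
  moreover have "W \<in> borel_measurable P"
    unfolding W_def by (intro borel_measurable_suminf_order bad_weight_measurable[OF E X])
  ultimately show ?thesis
    using that[of N0 W] hausdorff_content_le_good_plus_bad[OF E \<tau>(1,2), of \<theta> i N0]
    by (auto simp: N0_def W_def)
qed

section \<open>One direction for all errors\<close>

lemma hausdorff_measure_null_subset:
  assumes "A \<subseteq> B" "hausdorff_measure u B = 0" "0 < u"
  shows "hausdorff_measure u A = 0"
  using hausdorff_content_mono[OF assms(1), of u] assms(2,3) by (simp add: hausdorff_measure_eq_0_iff)

text \<open>For each tolerance \<open>1 / Suc k\<close> a piece of \<open>E\<close> with its own
  subdivision is used, and its deleted weight is divided by the content \<open>h\<close> of the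
  piece. The normalised weights have total expectation at most 1/2, so in one outcome all of them
  are below 1, and good points of positive content remain for every \<open>k\<close>.\<close>

lemma exists_direction_dim_ge:
  assumes P: "prob_space P" and X: "X \<in> borel_measurable P" and X01: "\<And>\<omega>. 0 \<le> X \<omega> \<and> X \<omega> \<le> 1"
    and s: "0 \<le> s" "s \<le> 1" and ts: "t \<le> s"
    and approx: "\<And>\<theta>. 0 < \<theta> \<Longrightarrow> \<exists>E0 \<eta> c \<tau> i N1. E0 \<subseteq> E \<and> regular_counts E0 t \<eta> c \<and> 0 \<le> \<eta> \<and> \<eta> \<le> \<theta> \<and>
       0 < \<tau> \<and> \<tau> \<le> 1 \<and> t - \<eta> \<le> \<tau> \<and> hausdorff_content \<tau> E0 \<noteq> 0 \<and>
       (\<forall>N\<ge>N1. 1 \<le> i N \<and> i N * i N \<le> N \<and> 12 * \<eta> * real (i N) \<le> \<theta> \<and>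
              spread_at P X s (N div i N) (\<theta> * real (N div i N) / 4))"
  shows "\<exists>\<omega>\<in>space P. ereal t \<le> hausdorff_dim (proj (direction (X \<omega>)) ` E)"
proof -
  interpret prob_space P by (rule P)
  define \<theta> where "\<theta> = (\<lambda>k. 1 / real (Suc k))"
  have \<theta>0: "0 < \<theta> k" for k by (simp add: \<theta>_def)
  have "\<exists>E0 \<tau> i N0 W. E0 \<subseteq> E \<and> (\<forall>y\<in>E0. \<forall>z\<in>E0. cell 0 y = cell 0 z) \<and> 0 < \<tau> \<and> \<tau> \<le> 1 \<and> t - \<theta> k \<le> \<tau> \<and>
      (\<forall>N\<ge>N0. 1 \<le> i N \<and> real (i N) \<le> \<theta> k * real N) \<and>
      W \<in> borel_measurable P \<and> (\<integral>\<^sup>+\<omega>. W \<omega> \<partial>P) \<le> ennreal ((1/2) ^ (k + 2)) \<and>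
      (\<forall>\<omega>. W \<omega> < 1 \<longrightarrow> hausdorff_content \<tau> (good_points E0 (\<theta> k) i N0 (X \<omega>)) \<noteq> 0)" for k
  proof -
    from approx[OF \<theta>0[of k]] obtain E0 \<eta> c \<tau> i N1 where
      E0: "E0 \<subseteq> E" "regular_counts E0 t \<eta> c" and \<eta>: "0 \<le> \<eta>" "\<eta> \<le> \<theta> k" and \<tau>: "0 < \<tau>" "\<tau> \<le> 1" "t - \<eta> \<le> \<tau>"
      and pos: "hausdorff_content \<tau> E0 \<noteq> 0"
      and i: "\<And>N. N1 \<le> N \<Longrightarrow> 1 \<le> i N \<and> i N * i N \<le> N \<and> 12 * \<eta> * real (i N) \<le> \<theta> k \<and>
              spread_at P X s (N div i N) (\<theta> k * real (N div i N) / 4)"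
      by blast
    \<comment> \<open>Multiplying \<open>i N * i N \<le> N\<close> and
      \<open>Suc k * Suc k \<le> N\<close> gives \<open>i N * Suc k \<le> N\<close>, the bound on
      the leftover levels.\<close>
    define N2 where "N2 = max N1 (Suc k * Suc k)"
    have same: "cell 0 y = cell 0 z" if "y \<in> E0" "z \<in> E0" for y z
      using regular_counts_same_cell[OF E0(2) that] .
    have "hausdorff_content \<tau> E0 \<le> ennreal (2 * 2 powr - (real 0 * \<tau>))"
      by (rule hausdorff_content_same_cell_le[OF same \<tau>(1,2)])
    then have "hausdorff_content \<tau> E0 < \<infinity>" by (simp add: le_less_trans)
    then obtain h where h: "hausdorff_content \<tau> E0 = ennreal h" "0 < h"
      using pos by (cases "hausdorff_content \<tau> E0") (auto simp: le_less)
    have e: "0 < h * (1/2) ^ (k + 2)" using h by simp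
    have i2: "1 \<le> i N \<and> i N * i N \<le> N \<and> 12 * \<eta> * real (i N) \<le> \<theta> k \<and>
              spread_at P X s (N div i N) (\<theta> k * real (N div i N) / 4)" if "N2 \<le> N" for N
      using that by (intro i) (simp add: N2_def)
    obtain N0 W where W: "N2 \<le> N0" "W \<in> borel_measurable P" "(\<integral>\<^sup>+\<omega>. W \<omega> \<partial>P) \<le> ennreal (h * (1/2) ^ (k + 2))"
      "\<And>\<omega>. hausdorff_content \<tau> E0 \<le> hausdorff_content \<tau> (good_points E0 (\<theta> k) i N0 (X \<omega>)) + W \<omega>"
      using exists_small_bad_weight[OF P X X01 s E0(2) ts \<tau> \<eta>(1) \<theta>0 e i2] by blast
    have c1: "real (i N) \<le> \<theta> k * real N" if "N0 \<le> N" for N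
    proof -
      have N: "N2 \<le> N" using that W(1) by simp
      have "i N * i N \<le> N" "Suc k * Suc k \<le> N" using i2[OF N] N by (auto simp: N2_def)
      then have "(i N * i N) * (Suc k * Suc k) \<le> N * N" by (intro mult_le_mono)
      then have "(i N * Suc k)^2 \<le> N^2" by (simp only: power2_eq_square mult_ac)
      then have "i N * Suc k \<le> N" by (simp only: power2_nat_le_eq_le)
      then have "real (i N * Suc k) \<le> real N" by (simp only: of_nat_le_iff)
      then show ?thesis by (simp add: \<theta>_def field_simps)
    qed
    have c2: "(\<integral>\<^sup>+\<omega>. W \<omega> / ennreal h \<partial>P) \<le> ennreal ((1/2) ^ (k + 2))"
    proof -
      have "(\<integral>\<^sup>+\<omega>. W \<omega> / ennreal h \<partial>P) = (\<integral>\<^sup>+\<omega>. W \<omega> \<partial>P) / ennreal h"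
        by (rule nn_integral_divide[OF W(2)])
      also have "\<dots> \<le> ennreal (h * (1/2) ^ (k + 2)) / ennreal h" by (rule divide_right_mono_ennreal[OF W(3)])
      also have "\<dots> = ennreal ((1/2) ^ (k + 2))" using h by (simp add: divide_ennreal)
      finally show ?thesis .
    qed
    have c3: "hausdorff_content \<tau> (good_points E0 (\<theta> k) i N0 (X \<omega>)) \<noteq> 0" if "W \<omega> / ennreal h < 1" for \<omega>
    proof
      assume "hausdorff_content \<tau> (good_points E0 (\<theta> k) i N0 (X \<omega>)) = 0"
      then have "ennreal h \<le> W \<omega>" using W(4)[of \<omega>] h by simp
      then have "ennreal h / ennreal h \<le> W \<omega> / ennreal h" by (rule divide_right_mono_ennreal)
      then show False using that h by (simp add: ennreal_divide_self)
    qed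
    have c4: "1 \<le> i N" if "N0 \<le> N" for N using i2[of N] that W(1) by simp
    have c5: "(\<lambda>\<omega>. W \<omega> / ennreal h) \<in> borel_measurable P" using W(2) by simp
    have c6: "t - \<theta> k \<le> \<tau>" using \<tau>(3) \<eta>(2) by linarith
    show ?thesis
      by (rule exI[of _ E0], rule exI[of _ \<tau>], rule exI[of _ i], rule exI[of _ N0], rule exI[of _ "\<lambda>\<omega>. W \<omega> / ennreal h"],
          intro conjI allI ballI impI)
         (fact E0(1) \<tau>(1) \<tau>(2) c6 c5 c2 | erule (1) same | erule c1 c4 c3)+
  qed
  then obtain E0 \<tau> i N0 W where E0: "\<And>k. E0 k \<subseteq> E" "\<And>k y z. y \<in> E0 k \<Longrightarrow> z \<in> E0 k \<Longrightarrow> cell 0 y = cell 0 z"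
    and \<tau>: "\<And>k. 0 < \<tau> k" "\<And>k. \<tau> k \<le> 1" "\<And>k. t - \<theta> k \<le> \<tau> k"
    and i: "\<And>k N. N0 k \<le> N \<Longrightarrow> 1 \<le> i k N \<and> real (i k N) \<le> \<theta> k * real N"
    and W: "\<And>k. W k \<in> borel_measurable P" "\<And>k. (\<integral>\<^sup>+\<omega>. W k \<omega> \<partial>P) \<le> ennreal ((1/2) ^ (k + 2))"
      "\<And>k \<omega>. W k \<omega> < 1 \<Longrightarrow> hausdorff_content (\<tau> k) (good_points (E0 k) (\<theta> k) (i k) (N0 k) (X \<omega>)) \<noteq> 0"
    by metis
  have "(\<integral>\<^sup>+\<omega>. (\<Sum>k. W k \<omega>) \<partial>P) = (\<Sum>k. \<integral>\<^sup>+\<omega>. W k \<omega> \<partial>P)"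
    by (rule nn_integral_suminf[OF W(1)])
  also have "\<dots> \<le> (\<Sum>k. ennreal ((1/2) ^ (k + 2)))" by (intro suminf_le W(2)) auto
  also have "\<dots> = ennreal (1 / 2)"
  proof (rule suminf_ennreal_eq)
    have "(\<lambda>k. (1/2) * (1/2) ^ Suc k :: real) sums ((1/2) * 1)" by (intro sums_mult power_half_series)
    then show "(\<lambda>k. (1/2) ^ (k + 2) :: real) sums (1/2)" by simp
  qed auto
  also have "\<dots> < 1" unfolding ennreal_1[symmetric] by (rule ennreal_lessI) auto
  finally have lt1: "(\<integral>\<^sup>+\<omega>. (\<Sum>k. W k \<omega>) \<partial>P) < 1" .
  have "\<exists>\<omega>\<in>space P. (\<Sum>k. W k \<omega>) < 1"
  proof (rule ccontr)
    assume "\<not> ?thesis"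
    then have "(\<integral>\<^sup>+\<omega>. 1 \<partial>P) \<le> (\<integral>\<^sup>+\<omega>. (\<Sum>k. W k \<omega>) \<partial>P)"
      by (intro nn_integral_mono) (auto simp: not_less)
    then show False using lt1 by (simp add: emeasure_space_1)
  qed
  then obtain \<omega> where \<omega>: "\<omega> \<in> space P" "(\<Sum>k. W k \<omega>) < 1" by blast
  have "ereal t \<le> hausdorff_dim (proj (direction (X \<omega>)) ` E)"
  proof (rule le_hausdorff_dim, rule notI)
    fix u assume u: "0 < u" "u < t" and null: "hausdorff_measure u (proj (direction (X \<omega>)) ` E) = 0"
    \<comment> \<open>A strip estimate loses \<open>2 * \<theta> k\<close>, and
      \<open>\<tau> k\<close> may fall short of \<open>t\<close> by another
      \<open>\<theta> k\<close>; hence the factor 3.\<close>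
    obtain k where k: "3 / (t - u) < real (Suc k)" using reals_Archimedean2[of "3 / (t - u)"] by (metis less_SucI of_nat_less_iff order_less_trans lessI)
    then have "3 * \<theta> k < t - u" using u by (simp add: \<theta>_def field_simps)
    then have u2: "u \<le> \<tau> k - 2 * \<theta> k" using \<tau>(3)[of k] by simp
    have "W k \<omega> \<le> (\<Sum>k. W k \<omega>)"
      using sum_le_suminf[of "\<lambda>k. W k \<omega>" "{k}"] by simp
    then have "W k \<omega> < 1" using \<omega>(2) by simp
    then have "hausdorff_measure u (proj (direction (X \<omega>)) ` E0 k) \<noteq> 0"
      using \<theta>0[of k] X01[of \<omega>]
      by (intro hausdorff_measure_proj_good_points[OF _ _ E0(2) \<tau>(1,2) _ u(1) u2 i W(3)]) auto
    moreover have "hausdorff_measure u (proj (direction (X \<omega>)) ` E0 k) = 0"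
      by (rule hausdorff_measure_null_subset[OF image_mono[OF E0(1)] null u(1)])
    ultimately show False by simp
  qed
  then show ?thesis using \<omega>(1) by blast
qed


section \<open>Separated points\<close>

definition separated :: "real \<Rightarrow> 'a::metric_space set \<Rightarrow> bool" where
  "separated \<rho> F \<longleftrightarrow> (\<forall>y\<in>F. \<forall>z\<in>F. y \<noteq> z \<longrightarrow> \<rho> \<le> dist y z)"

lemma separatedD: "separated \<rho> F \<Longrightarrow> y \<in> F \<Longrightarrow> z \<in> F \<Longrightarrow> y \<noteq> z \<Longrightarrow> \<rho> \<le> dist y z"
  by (simp add: separated_def)

lemma le_dist_if_floor_diff:
  assumes "2 \<le> \<bar>\<lfloor>2 ^ n * y $ i\<rfloor> - \<lfloor>2 ^ n * z $ i\<rfloor>\<bar>"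
  shows "2 powr - real n \<le> dist y (z :: real^2)"
proof -
  have "1 \<le> \<bar>2 ^ n * y $ i - 2 ^ n * z $ i\<bar>" using assms by linarith
  also have "\<dots> = 2 ^ n * \<bar>(y - z) $ i\<bar>" by (simp add: abs_mult right_diff_distrib[symmetric])
  also have "\<dots> \<le> 2 ^ n * dist y z" unfolding dist_norm by (intro mult_left_mono component_le_norm_cart) auto
  finally show ?thesis by (simp add: powr_minus powr_realpow field_simps)
qed

lemma abs_diff_ge_2_if_same_parity:
  fixes a b :: int
  assumes "a mod 2 = b mod 2" "a \<noteq> b"
  shows "2 \<le> \<bar>a - b\<bar>"
  using assms by presburger

text \<open>Two distinct cells of the same parity class are separated, and there are four classes.\<close>

lemma card_cells_le_if_separated_le:
  assumes B: "bounded B"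
    and L: "\<And>F. finite F \<Longrightarrow> F \<subseteq> B \<Longrightarrow> separated (2 powr - real n) F \<Longrightarrow> real (card F) \<le> L"
  shows "real (card (cell n ` B)) \<le> 4 * L"
proof -
  have fin: "finite (cell n ` B)" by (rule finite_cells_if_bounded[OF B])
  define g where "g = inv_into B (cell n)"
  have g: "g p \<in> B" "cell n (g p) = p" if "p \<in> cell n ` B" for p
    using that by (auto simp: g_def inv_into_into f_inv_into_f)
  define par :: "int \<times> int \<Rightarrow> int \<times> int" where "par = (\<lambda>p. (fst p mod 2, snd p mod 2))"
  let ?C = "\<lambda>r. {p \<in> cell n ` B. par p = r}"
  have one: "real (card (?C r)) \<le> L" for r
  proof -
    have inj: "inj_on g (?C r)" using g(2) by (intro inj_on_inverseI[of _ "cell n"]) auto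
    have "separated (2 powr - real n) (g ` ?C r)"
      unfolding separated_def
    proof (intro ballI impI)
      fix y z assume y: "y \<in> g ` ?C r" and z: "z \<in> g ` ?C r" and "y \<noteq> z"
      then obtain p q where p: "p \<in> ?C r" "y = g p" and q: "q \<in> ?C r" "z = g q" by blast
      then have c: "cell n y = p" "cell n z = q" using g(2)[of p] g(2)[of q] by simp_all
      have "p \<noteq> q" using \<open>y \<noteq> z\<close> p(2) q(2) by metis
      moreover have "fst p mod 2 = fst q mod 2" "snd p mod 2 = snd q mod 2" using p(1) q(1) by (auto simp: par_def)
      ultimately have "2 \<le> \<bar>fst p - fst q\<bar> \<or> 2 \<le> \<bar>snd p - snd q\<bar>"
        using abs_diff_ge_2_if_same_parity by (metis prod.expand)
      then show "2 powr - real n \<le> dist y z"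
        using le_dist_if_floor_diff[of n y 1 z] le_dist_if_floor_diff[of n y 2 z]
        unfolding c[symmetric] cell_def by auto
    qed
    then have "real (card (g ` ?C r)) \<le> L" using fin g(1) by (intro L) auto
    then show ?thesis by (simp add: card_image[OF inj])
  qed
  have "par p \<in> {0,1} \<times> {0,1}" for p by (auto simp: par_def)
  then have "cell n ` B \<subseteq> (\<Union>r\<in>{0,1} \<times> {0,1}. ?C r)" by blast
  then have "card (cell n ` B) \<le> card (\<Union>r\<in>{0,1} \<times> {0,1}. ?C r)"
    using fin by (intro card_mono) auto
  also have "\<dots> \<le> (\<Sum>r\<in>{0,1} \<times> {0,1}. card (?C r))" by (intro card_UN_le) auto
  finally have "real (card (cell n ` B)) \<le> (\<Sum>r\<in>{0,1} \<times> {0,1}. real (card (?C r)))"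
    by (simp only: of_nat_le_iff flip: of_nat_sum)
  also have "\<dots> \<le> (\<Sum>r\<in>{0,1::int} \<times> {0,1::int}. L)" by (intro sum_mono one)
  also have "\<dots> = 4 * L" by (simp add: card_cartesian_product)
  finally show ?thesis .
qed

text \<open>Radius \<open>\<rho> / 3\<close> instead of \<open>\<rho> / 2\<close>, since closed
  balls of radius \<open>\<rho> / 2\<close> could touch.\<close>

lemma packing_sum_ge_card_separated:
  assumes F: "finite F" "F \<subseteq> B" "separated \<rho> F" and \<rho>: "0 < \<rho>" "\<rho> / 3 \<le> \<delta>"
  shows "ennreal (real (card F) * (2 * (\<rho> / 3)) powr u)
     \<le> (SUP P \<in> packings \<delta> B. \<Sum>\<^sub>\<infinity>(x, r)\<in>P. ennreal ((2 * r) powr u))"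
proof -
  define P where "P = (\<lambda>x. (x, \<rho> / 3)) ` F"
  have inj: "inj_on (\<lambda>x. (x, \<rho> / 3)) F" by (auto intro: inj_onI)
  have "disjoint_family_on (\<lambda>(x, r). cball x r) P"
    unfolding disjoint_family_on_def
  proof (intro ballI impI)
    fix p q assume "p \<in> P" "q \<in> P" "p \<noteq> q"
    then obtain y z where yz: "p = (y, \<rho> / 3)" "q = (z, \<rho> / 3)" "y \<in> F" "z \<in> F" "y \<noteq> z" by (auto simp: P_def)
    have "\<rho> \<le> dist y z" using F(3) yz by (auto simp: separated_def)
    then have "cball y (\<rho> / 3) \<inter> cball z (\<rho> / 3) = {}"
      using \<rho> by (intro disjoint_cballI) auto
    then show "(\<lambda>(x, r). cball x r) p \<inter> (\<lambda>(x, r). cball x r) q = {}" using yz by simp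
  qed
  then have "P \<in> packings \<delta> B"
    using F \<rho> by (auto simp: packings_def P_def intro: countable_finite)
  then have "(\<Sum>\<^sub>\<infinity>(x, r)\<in>P. ennreal ((2 * r) powr u)) \<le> (SUP P \<in> packings \<delta> B. \<Sum>\<^sub>\<infinity>(x, r)\<in>P. ennreal ((2 * r) powr u))"
    by (rule SUP_upper)
  moreover have "(\<Sum>\<^sub>\<infinity>(x, r)\<in>P. ennreal ((2 * r) powr u)) = (\<Sum>(x, r)\<in>P. ennreal ((2 * r) powr u))"
    using F(1) by (intro infsum_finite) (simp add: P_def)
  moreover have "\<dots> = (\<Sum>x\<in>F. ennreal ((2 * (\<rho> / 3)) powr u))"
    unfolding P_def by (subst sum.reindex[OF inj]) simp
  moreover have "\<dots> = ennreal (real (card F) * (2 * (\<rho> / 3)) powr u)"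
    by (simp add: ennreal_mult'' ennreal_of_nat_eq_real_of_nat)
  ultimately show ?thesis by simp
qed

text \<open>A finite premeasure bounds the packings by balls of equal radius, hence separated
  points, hence occupied cells, at all fine levels. Counts decrease under coarsening, so the
  finitely many coarse levels are absorbed into \<open>K\<close>.\<close>

lemma card_cells_le_if_packing_premeasure_finite:
  assumes B: "bounded B" and u: "0 \<le> u" and fin: "packing_premeasure u B < \<infinity>"
  obtains K where "0 < K" "\<And>n. real (card (cell n ` B)) \<le> K * 2 powr (real n * u)"
proof -
  obtain \<delta> where \<delta>: "0 < \<delta>" and S: "(SUP P \<in> packings \<delta> B. \<Sum>\<^sub>\<infinity>(x, r)\<in>P. ennreal ((2 * r) powr u)) < \<infinity>"
    using fin unfolding packing_premeasure_def by (subst (asm) INF_less_iff) auto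
  then obtain S' where S': "(SUP P \<in> packings \<delta> B. \<Sum>\<^sub>\<infinity>(x, r)\<in>P. ennreal ((2 * r) powr u)) = ennreal S'" "0 \<le> S'"
    by (cases "SUP P \<in> packings \<delta> B. \<Sum>\<^sub>\<infinity>(x, r)\<in>P. ennreal ((2 * r) powr u)") auto
  obtain n0 where n0: "(1/2) ^ n0 < \<delta>" using real_arch_pow_inv[of \<delta> "1/2"] \<delta> by auto
  define K1 where "K1 = 4 * (S' * (3/2) powr u)"
  define K where "K = max 1 (max K1 (real (card (cell n0 ` B))))"
  have big: "real (card (cell n ` B)) \<le> K1 * 2 powr (real n * u)" if "n0 \<le> n" for n
  proof -
    have "real (card (cell n ` B)) \<le> 4 * (S' * (3/2) powr u * 2 powr (real n * u))"
    proof (rule card_cells_le_if_separated_le[OF B])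
      fix F assume F: "finite F" "F \<subseteq> B" "separated (2 powr - real n) F"
      have "(2::real) powr - real n / 3 \<le> 2 powr - real n" by simp
      also have "\<dots> \<le> 2 powr - real n0" using that by (intro powr_mono) auto
      also have "\<dots> \<le> \<delta>" using n0 by (simp add: powr_minus powr_realpow power_one_over inverse_eq_divide)
      finally have "ennreal (real (card F) * (2 * (2 powr - real n / 3)) powr u) \<le> ennreal S'"
        unfolding S'(1)[symmetric] by (intro packing_sum_ge_card_separated F) auto
      then have "real (card F) * (2 * (2 powr - real n / 3)) powr u \<le> S'" using S'(2) by (simp add: ennreal_le_iff)
      moreover have "(2 * (2 powr - real n / 3)) powr u = (2/3) powr u * 2 powr - (real n * u)"
        using powr_mult[of "2/3" "2 powr - real n" u] by (simp add: powr_powr)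
      ultimately have *: "real (card F) * ((2/3) powr u * 2 powr - (real n * u)) \<le> S'" by simp
      have "(2/3 :: real) powr u * (3/2) powr u = 1" by (simp flip: powr_mult)
      moreover have "(2::real) powr - (real n * u) * 2 powr (real n * u) = 1" by (simp flip: powr_add)
      ultimately have "real (card F) = real (card F) * (((2/3) powr u * (3/2) powr u) * (2 powr - (real n * u) * 2 powr (real n * u)))"
        by simp
      also have "\<dots> = real (card F) * ((2/3) powr u * 2 powr - (real n * u)) * ((3/2) powr u * 2 powr (real n * u))"
        by (simp only: mult_ac)
      also have "\<dots> \<le> S' * ((3/2) powr u * 2 powr (real n * u))" using * by (intro mult_right_mono) auto
      finally show "real (card F) \<le> S' * (3/2) powr u * 2 powr (real n * u)" by (simp only: mult.assoc)
    qed
    then show ?thesis by (simp only: K1_def mult.assoc)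
  qed
  have "real (card (cell n ` B)) \<le> K * 2 powr (real n * u)" for n
  proof (cases "n0 \<le> n")
    case True
    have "K1 * 2 powr (real n * u) \<le> K * 2 powr (real n * u)" by (intro mult_right_mono) (auto simp: K_def)
    then show ?thesis using big[OF True] by linarith
  next
    case False
    have "cell n ` B = coarsen (n0 - n) ` cell n0 ` B"
      using False by (simp add: image_image coarsen_cell)
    then have "card (cell n ` B) \<le> card (cell n0 ` B)"
      using finite_cells_if_bounded[OF B] by (metis card_image_le)
    then have "real (card (cell n ` B)) \<le> K" by (simp add: K_def)
    also have "\<dots> \<le> K * 2 powr (real n * u)"
      using u by (simp add: K_def ge_one_powr_ge_zero mult_le_cancel_left1)
    finally show ?thesis .
  qed
  moreover have "0 < K" by (simp add: K_def)
  ultimately show ?thesis using that by blast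
qed

section \<open>Regular pieces of weakly regular sets\<close>

lemma sum_card_fibres_le:
  assumes "finite C" "finite H"
  shows "(\<Sum>q\<in>H. card {p \<in> C. f p = q}) \<le> card C"
proof -
  have "(\<Sum>q\<in>H. card {p \<in> C. f p = q}) = card (\<Union>q\<in>H. {p \<in> C. f p = q})"
    using assms by (intro card_UN_disjoint[symmetric]) auto
  also have "\<dots> \<le> card C" using assms by (intro card_mono) auto
  finally show ?thesis .
qed

lemma exists_piece_in_cell:
  fixes E :: "(real^2) set"
  assumes "hausdorff_content \<tau> E \<noteq> 0"
  obtains p where "hausdorff_content \<tau> {y \<in> E. cell m y = p} \<noteq> 0"
proof (rule ccontr)
  assume "\<not> thesis"
  then have "hausdorff_content \<tau> (\<Union>p\<in>UNIV. {y \<in> E. cell m y = p}) = 0"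
    using that by (intro hausdorff_content_null_countable_UN) auto
  moreover have "(\<Union>p\<in>UNIV. {y \<in> E. cell m y = p}) = E" by blast
  ultimately show False using assms by simp
qed

lemma packing_premeasure_mono:
  assumes "A \<subseteq> B"
  shows "packing_premeasure u A \<le> packing_premeasure u B"
  unfolding packing_premeasure_def
proof (rule INF_mono)
  fix \<delta> :: real assume \<delta>: "\<delta> \<in> {0<..}"
  have "(SUP P \<in> packings \<delta> A. \<Sum>\<^sub>\<infinity>(x, r)\<in>P. ennreal ((2 * r) powr u)) \<le> (SUP P \<in> packings \<delta> B. \<Sum>\<^sub>\<infinity>(x, r)\<in>P. ennreal ((2 * r) powr u))"
    using assms by (intro SUP_subset_mono order_refl) (auto simp: packings_def)
  then show "\<exists>d\<in>{0<..}. (SUP P \<in> packings d A. \<Sum>\<^sub>\<infinity>(x, r)\<in>P. ennreal ((2 * r) powr u)) \<le> (SUP P \<in> packings \<delta> B. \<Sum>\<^sub>\<infinity>(x, r)\<in>P. ennreal ((2 * r) powr u))"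
    using \<delta> by blast
qed

text \<open>Packing dimension below \<open>v\<close> splits \<open>E\<close> into countably many
  sets of finite premeasure, and by countable subadditivity one of them, cut to a unit cell, keeps
  positive content. A bound on a dimension becomes a bound on box counts at every level.\<close>

lemma exists_piece_small_counts:
  fixes E :: "(real^2) set"
  assumes hp: "ereal \<tau> < hausdorff_dim E" "0 < \<tau>" and pk: "packing_dim E < ereal v"
  obtains B K where "B \<subseteq> E" "\<And>y z. y \<in> B \<Longrightarrow> z \<in> B \<Longrightarrow> cell 0 y = cell 0 z" "hausdorff_content \<tau> B \<noteq> 0"
    "0 < K" "\<And>n. real (card (cell n ` B)) \<le> K * 2 powr (real n * v)"
proof -
  obtain u where u: "0 \<le> u" "packing_measure u E = 0" "u < v"
    using pk unfolding packing_dim_def by (subst (asm) INF_less_iff) auto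
  have "packing_measure u E < 1" using u(2) by simp
  then obtain A :: "nat \<Rightarrow> (real^2) set" where A: "E \<subseteq> (\<Union>i. A i)" "(\<Sum>i. packing_premeasure u (A i)) < 1"
    unfolding packing_measure_def by (subst (asm) INF_less_iff) auto
  have fin: "packing_premeasure u (A i) < \<infinity>" for i
  proof -
    have "packing_premeasure u (A i) \<le> (\<Sum>i. packing_premeasure u (A i))"
      using sum_le_suminf[of "\<lambda>i. packing_premeasure u (A i)" "{i}"] by simp
    also have "\<dots> < \<infinity>" using A(2) by (rule order.strict_trans) simp
    finally show ?thesis .
  qed
  have "hausdorff_content \<tau> E \<noteq> 0"
    using hausdorff_measure_pos_of_less_dim[OF hp(1)] hp(2) by (simp add: hausdorff_measure_eq_0_iff)
  then obtain p where p: "hausdorff_content \<tau> {y \<in> E. cell 0 y = p} \<noteq> 0" by (rule exists_piece_in_cell)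
  have "\<exists>i. hausdorff_content \<tau> ({y \<in> E. cell 0 y = p} \<inter> A i) \<noteq> 0"
  proof (rule ccontr)
    assume "\<not> ?thesis"
    then have "hausdorff_content \<tau> (\<Union>i. {y \<in> E. cell 0 y = p} \<inter> A i) = 0"
      by (intro hausdorff_content_null_UN) auto
    moreover have "(\<Union>i. {y \<in> E. cell 0 y = p} \<inter> A i) = {y \<in> E. cell 0 y = p}" using A(1) by blast
    ultimately show False using p by simp
  qed
  then obtain i where i: "hausdorff_content \<tau> ({y \<in> E. cell 0 y = p} \<inter> A i) \<noteq> 0" by blast
  define B where "B = {y \<in> E. cell 0 y = p} \<inter> A i"
  have same: "cell 0 y = cell 0 z" if "y \<in> B" "z \<in> B" for y z using that by (simp add: B_def)
  have b: "bounded B" by (rule bounded_if_same_cell[OF same])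
  have "packing_premeasure u B < \<infinity>"
    using packing_premeasure_mono[of B "A i" u] fin[of i] by (auto simp: B_def)
  then obtain K where K: "0 < K" "\<And>n. real (card (cell n ` B)) \<le> K * 2 powr (real n * u)"
    using card_cells_le_if_packing_premeasure_finite[OF b u(1)] by blast
  have "real (card (cell n ` B)) \<le> K * 2 powr (real n * v)" for n
  proof -
    have "K * 2 powr (real n * u) \<le> K * 2 powr (real n * v)"
      using K(1) u(3) by (intro mult_left_mono powr_mono) (auto intro: mult_left_mono)
    then show ?thesis using K(2)[of n] by linarith
  qed
  moreover have "B \<subseteq> E" by (auto simp: B_def)
  ultimately show ?thesis using that[OF _ same] i K(1) unfolding B_def by blast
qed

text \<open>Only the Hausdorff dimension from below and box counts from above are known for a piece of
  a weakly regular set. Since the box counts are global, a cell can still contain too many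
  subcells; but there are few such cells, so they can be deleted.\<close>

lemma weakly_regular_extraction:
  fixes E :: "(real^2) set"
  assumes hd: "hausdorff_dim E = ereal t" and pd: "packing_dim E = ereal t"
    and t: "t \<le> 1" and \<eta>: "0 < \<eta>" "\<eta> < t"
  obtains E0 c \<tau> where "E0 \<subseteq> E" "regular_counts E0 t \<eta> c" "0 < \<tau>" "\<tau> \<le> 1" "t - \<eta> \<le> \<tau>"
    "hausdorff_content \<tau> E0 \<noteq> 0"
proof -
  \<comment> \<open>With \<open>\<tau> = t - h\<close> and counts of exponent \<open>t + h\<close>,
    the heavy cells of level \<open>m\<close> have weight at most a constant times
    \<open>2 powr (h * m - 3 * h * n)\<close>. As \<open>m \<le> n\<close>, this decays
    geometrically in both indices.\<close>
  define h where "h = \<eta> / 4"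
  define \<tau> where "\<tau> = t - h"
  have h: "0 < h" "\<eta> = 4 * h" using \<eta> by (auto simp: h_def)
  have \<tau>: "0 < \<tau>" "\<tau> \<le> 1" "t - \<eta> \<le> \<tau>" using \<eta> t h by (auto simp: \<tau>_def)
  have h1: "ereal \<tau> < hausdorff_dim E" and h2: "packing_dim E < ereal (t + h)"
    using hd pd h by (simp_all add: \<tau>_def)
  obtain B K where B: "B \<subseteq> E" "\<And>y z. y \<in> B \<Longrightarrow> z \<in> B \<Longrightarrow> cell 0 y = cell 0 z" "hausdorff_content \<tau> B \<noteq> 0"
    and K: "0 < K" "\<And>n. real (card (cell n ` B)) \<le> K * 2 powr (real n * (t + h))"
    using exists_piece_small_counts[OF h1 \<tau>(1) h2] by blast
  have finB: "finite (cell n ` B)" for n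
    by (rule finite_cells_if_bounded[OF bounded_if_same_cell[OF B(2)]])
  have "hausdorff_content \<tau> B \<le> ennreal (2 * 2 powr - (real 0 * \<tau>))"
    by (rule hausdorff_content_same_cell_le[OF B(2) \<tau>(1,2)])
  then have "hausdorff_content \<tau> B < \<infinity>" by (simp add: le_less_trans)
  then obtain b where b: "hausdorff_content \<tau> B = ennreal b" "0 < b"
    using B(3) by (cases "hausdorff_content \<tau> B") (auto simp: le_less)
  define a where "a = 2 powr - h"
  have a: "0 < a" "a < 1" using h by (auto simp: a_def powr_less_one)
  have apow: "a ^ k = 2 powr - (h * real k)" for k
    using powr_realpow[OF a(1), of k] by (simp add: a_def powr_powr)
  define S where "S = 1 / (1 - a)"
  have S: "0 < S" using a by (simp add: S_def)
  \<comment> \<open>Makes the total weight of all heavy cells,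
    \<open>2 * K * 2 powr - c * S * S\<close>, equal to half the content \<open>b\<close>.\<close>
  define c where "c = - log 2 (b / (4 * K * S * S))"
  have c: "2 powr - c = b / (4 * K * S * S)" using b K S by (simp add: c_def)
  \<comment> \<open>Including \<open>m \<le> n\<close> empties the remaining sets, so that the
    deleted weights form a full double geometric series.\<close>
  define heavy where "heavy = (\<lambda>m n. {q \<in> cell m ` B. m \<le> n \<and>
     2 powr ((real n - real m) * t + \<eta> * real n + c) < real (card {p \<in> cell n ` B. coarsen (n - m) p = q})})"
  have finH: "finite (heavy m n)" for m n
    by (rule finite_subset[OF _ finB[of m]]) (auto simp: heavy_def)
  have card_heavy: "real (card (heavy m n)) * (2 * 2 powr - (real m * \<tau>)) \<le> 2 * K * 2 powr - c * a ^ m * a ^ n" for m n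
  proof (cases "m \<le> n")
    case True
    let ?w = "2 powr ((real n - real m) * t + \<eta> * real n + c)"
    have "real (card (heavy m n)) * ?w = (\<Sum>q\<in>heavy m n. ?w)" by simp
    also have "\<dots> \<le> (\<Sum>q\<in>heavy m n. real (card {p \<in> cell n ` B. coarsen (n - m) p = q}))"
      by (intro sum_mono) (auto simp: heavy_def)
    also have "\<dots> = real (\<Sum>q\<in>heavy m n. card {p \<in> cell n ` B. coarsen (n - m) p = q})" by simp
    also have "\<dots> \<le> real (card (cell n ` B))"
      unfolding of_nat_le_iff by (rule sum_card_fibres_le[OF finB finH])
    also have "\<dots> \<le> K * 2 powr (real n * (t + h))" by (rule K(2))
    finally have *: "real (card (heavy m n)) * ?w \<le> K * 2 powr (real n * (t + h))" .
    have w0: "0 < ?w" by simp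
    have "real (card (heavy m n)) \<le> K * 2 powr (real n * (t + h)) / ?w"
      using * by (simp add: pos_le_divide_eq)
    then have "real (card (heavy m n)) * (2 * 2 powr - (real m * \<tau>)) \<le> K * 2 powr (real n * (t + h)) / ?w * (2 * 2 powr - (real m * \<tau>))"
      by (intro mult_right_mono) auto
    also have "\<dots> = 2 * K * (2 powr (real n * (t + h)) / ?w * 2 powr - (real m * \<tau>))" by simp
    also have "2 powr (real n * (t + h)) / ?w * 2 powr - (real m * \<tau>)
       = 2 powr ((real n * (t + h) - ((real n - real m) * t + \<eta> * real n + c)) + - (real m * \<tau>))"
      by (simp only: powr_add powr_diff)
    also have "(real n * (t + h) - ((real n - real m) * t + \<eta> * real n + c)) + - (real m * \<tau>) = - c + (h * real m - 3 * (h * real n))"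
      by (simp add: \<tau>_def h(2) algebra_simps)
    also have "2 * K * 2 powr (- c + (h * real m - 3 * (h * real n))) \<le> 2 * K * 2 powr (- c + (- (h * real m) + - (h * real n)))"
    proof -
      have "h * real m \<le> h * real n" using True h by (intro mult_left_mono) auto
      then show ?thesis using K(1) by (intro mult_left_mono powr_mono) auto
    qed
    also have "\<dots> = 2 * K * 2 powr - c * a ^ m * a ^ n"
      by (simp only: apow powr_add mult.assoc)
    finally show ?thesis .
  next
    case False
    then have "heavy m n = {}" by (auto simp: heavy_def)
    then show ?thesis using K(1) a by simp
  qed
  define E0 where "E0 = {y \<in> B. \<forall>m n. m \<le> n \<longrightarrow> cell m y \<notin> heavy m n}"
  have reg: "regular_counts E0 t \<eta> c"
    unfolding regular_counts_def
  proof (intro conjI ballI allI impI)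
    fix y z assume "y \<in> E0" "z \<in> E0"
    then show "cell 0 y = cell 0 z" by (intro B(2)) (auto simp: E0_def)
  next
    fix m n :: nat and y assume mn: "m \<le> n" and y: "y \<in> E0"
    \<comment> \<open>Heaviness is measured in \<open>B\<close>, not in \<open>E0\<close>; deleting
      points only lowers counts, so a single round of deletions is enough.\<close>
    have "cell n ` {z \<in> E0. cell m z = cell m y} \<subseteq> {p \<in> cell n ` B. coarsen (n - m) p = cell m y}"
      using mn by (auto simp: E0_def coarsen_cell)
    then have "card (cell n ` {z \<in> E0. cell m z = cell m y}) \<le> card {p \<in> cell n ` B. coarsen (n - m) p = cell m y}"
      using finB by (intro card_mono) auto
    then have "real (card (cell n ` {z \<in> E0. cell m z = cell m y})) \<le> real (card {p \<in> cell n ` B. coarsen (n - m) p = cell m y})"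
      by (simp only: of_nat_le_iff)
    also have "\<dots> \<le> 2 powr ((real n - real m) * t + \<eta> * real n + c)"
    proof (rule ccontr)
      assume "\<not> ?thesis"
      moreover have "y \<in> B" using y by (simp add: E0_def)
      ultimately have "cell m y \<in> heavy m n" using mn by (auto simp: heavy_def not_le)
      then show False using y mn by (auto simp: E0_def)
    qed
    finally show "real (card (cell n ` {z \<in> E0. cell m z = cell m y})) \<le> 2 powr ((real n - real m) * t + \<eta> * real n + c)" .
  qed
  have "hausdorff_content \<tau> E0 \<noteq> 0"
  proof
    assume 0: "hausdorff_content \<tau> E0 = 0"
    let ?H = "\<lambda>m n. (\<Union>q\<in>heavy m n. {y. cell m y = q})"
    have one: "hausdorff_content \<tau> (?H m n) \<le> ennreal (2 * K * 2 powr - c * a ^ m * a ^ n)" for m n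
    proof -
      have "hausdorff_content \<tau> (?H m n) \<le> (\<Sum>q\<in>heavy m n. hausdorff_content \<tau> {y. cell m y = q})"
        by (rule hausdorff_content_finite_UN_le[OF finH])
      also have "\<dots> \<le> (\<Sum>q\<in>heavy m n. ennreal (2 * 2 powr - (real m * \<tau>)))"
        by (intro sum_mono hausdorff_content_same_cell_le[where n = m] \<tau>) simp
      also have "\<dots> = ennreal (real (card (heavy m n)) * (2 * 2 powr - (real m * \<tau>)))"
        by (simp add: ennreal_mult'' ennreal_of_nat_eq_real_of_nat)
      also have "\<dots> \<le> ennreal (2 * K * 2 powr - c * a ^ m * a ^ n)" by (intro ennreal_leI card_heavy)
      finally show ?thesis .
    qed
    have geo: "(\<lambda>n. a ^ n) sums S" unfolding S_def by (rule geometric_sums) (use a in auto)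
    have "B \<subseteq> E0 \<union> (\<Union>m. \<Union>n. ?H m n)" by (auto simp: E0_def)
    then have "hausdorff_content \<tau> B \<le> hausdorff_content \<tau> (E0 \<union> (\<Union>m. \<Union>n. ?H m n))" by (rule hausdorff_content_mono)
    also have "\<dots> \<le> hausdorff_content \<tau> E0 + hausdorff_content \<tau> (\<Union>m. \<Union>n. ?H m n)" by (rule hausdorff_content_Un_le)
    also have "\<dots> = hausdorff_content \<tau> (\<Union>m. \<Union>n. ?H m n)" using 0 by simp
    also have "\<dots> \<le> (\<Sum>m. hausdorff_content \<tau> (\<Union>n. ?H m n))" by (rule hausdorff_content_UN_le)
    also have "\<dots> \<le> (\<Sum>m. \<Sum>n. hausdorff_content \<tau> (?H m n))" by (intro suminf_le hausdorff_content_UN_le) auto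
    also have "\<dots> \<le> (\<Sum>m. \<Sum>n. ennreal (2 * K * 2 powr - c * a ^ m * a ^ n))" by (intro suminf_le one) auto
    also have "\<dots> = (\<Sum>m. ennreal (2 * K * 2 powr - c * a ^ m * S))"
    proof (intro arg_cong[where f = suminf] ext)
      fix m
      show "(\<Sum>n. ennreal (2 * K * 2 powr - c * a ^ m * a ^ n)) = ennreal (2 * K * 2 powr - c * a ^ m * S)"
        by (rule suminf_ennreal_eq) (use K a in \<open>auto intro!: sums_mult geo\<close>)
    qed
    also have "\<dots> = ennreal (2 * K * 2 powr - c * S * S)"
    proof (rule suminf_ennreal_eq)
      have "(\<lambda>m. 2 * K * 2 powr - c * S * a ^ m) sums (2 * K * 2 powr - c * S * S)" by (intro sums_mult geo)
      then show "(\<lambda>m. 2 * K * 2 powr - c * a ^ m * S) sums (2 * K * 2 powr - c * S * S)" by (simp only: mult_ac)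
    qed (use K a S in auto)
    also have "2 * K * 2 powr - c * S * S = b / 2" unfolding c using K S by (simp add: field_simps)
    finally have "ennreal b \<le> ennreal (b / 2)" using b(1) by simp
    then show False using b(2) by (simp add: ennreal_le_iff)
  qed
  moreover have "E0 \<subseteq> E" using B(1) by (auto simp: E0_def)
  ultimately show ?thesis using that[OF _ reg \<tau>] by blast
qed


section \<open>Regular pieces of AD-regular sets\<close>

lemma hausdorff_premeasure_antimono:
  "\<delta> \<le> \<delta>' \<Longrightarrow> hausdorff_premeasure \<tau> \<delta>' A \<le> hausdorff_premeasure \<tau> \<delta> A"
  unfolding hausdorff_premeasure_def by (intro INF_superset_mono) (auto intro: order_trans)

lemma hausdorff_measure_mono:
  assumes "A \<subseteq> B"
  shows "hausdorff_measure \<tau> A \<le> hausdorff_measure \<tau> B"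
proof -
  have "hausdorff_premeasure \<tau> \<delta> A \<le> hausdorff_premeasure \<tau> \<delta> B" for \<delta>
    unfolding hausdorff_premeasure_def using assms by (intro INF_superset_mono) auto
  then show ?thesis unfolding hausdorff_measure_def by (intro SUP_mono) auto
qed

text \<open>A set of diameter at most \<open>\<delta> < g\<close> meets at most one
  \<open>A i\<close>, so a cover of the union splits into disjoint families covering the single
  \<open>A i\<close>.\<close>

lemma hausdorff_premeasure_superadditive:
  fixes A :: "'i \<Rightarrow> 'a::metric_space set"
  assumes I: "finite I" and \<delta>: "\<delta> < g"
    and gap: "\<And>i j y z. i \<in> I \<Longrightarrow> j \<in> I \<Longrightarrow> i \<noteq> j \<Longrightarrow> y \<in> A i \<Longrightarrow> z \<in> A j \<Longrightarrow> g \<le> dist y z"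
  shows "(\<Sum>i\<in>I. hausdorff_premeasure \<tau> \<delta> (A i)) \<le> hausdorff_premeasure \<tau> \<delta> (\<Union>i\<in>I. A i)"
  unfolding hausdorff_premeasure_def[of _ _ "\<Union>i\<in>I. A i"]
proof (rule INF_greatest)
  fix U :: "nat \<Rightarrow> 'a set" assume "U \<in> {U. (\<Union>i\<in>I. A i) \<subseteq> (\<Union>k. U k) \<and> (\<forall>k. bounded (U k) \<and> diameter (U k) \<le> \<delta>)}"
  then have U: "(\<Union>i\<in>I. A i) \<subseteq> (\<Union>k. U k)" "\<And>k. bounded (U k)" "\<And>k. diameter (U k) \<le> \<delta>" by auto
  define V where "V = (\<lambda>i k. if U k \<inter> A i = {} then {} else U k)"
  have "hausdorff_premeasure \<tau> \<delta> (A i) \<le> (\<Sum>k. diam_weight \<tau> (V i k))" if i: "i \<in> I" for i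
    unfolding hausdorff_premeasure_def
  proof (rule INF_lower, intro CollectI conjI allI)
    show "A i \<subseteq> (\<Union>k. V i k)"
    proof
      fix y assume y: "y \<in> A i"
      then obtain k where "y \<in> U k" using U(1) i by blast
      then have "y \<in> V i k" using y by (auto simp: V_def)
      then show "y \<in> (\<Union>k. V i k)" by blast
    qed
    have "0 \<le> \<delta>" using diameter_ge_0[OF U(2)[of 0]] U(3)[of 0] by linarith
    then show "bounded (V i k)" "diameter (V i k) \<le> \<delta>" for k using U(2,3) by (auto simp: V_def)
  qed
  then have "(\<Sum>i\<in>I. hausdorff_premeasure \<tau> \<delta> (A i)) \<le> (\<Sum>i\<in>I. \<Sum>k. diam_weight \<tau> (V i k))"
    by (rule sum_mono)
  also have "\<dots> = (\<Sum>k. \<Sum>i\<in>I. diam_weight \<tau> (V i k))"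
    by (rule suminf_sum[symmetric]) auto
  also have "\<dots> \<le> (\<Sum>k. diam_weight \<tau> (U k))"
  proof (intro suminf_le)
    fix k
    show "(\<Sum>i\<in>I. diam_weight \<tau> (V i k)) \<le> diam_weight \<tau> (U k)"
    proof (cases "\<exists>i\<in>I. U k \<inter> A i \<noteq> {}")
      case True
      then obtain i y where i: "i \<in> I" and y: "y \<in> U k" "y \<in> A i" by blast
      have "U k \<inter> A j = {}" if j: "j \<in> I" "j \<noteq> i" for j
      proof (rule ccontr)
        assume "U k \<inter> A j \<noteq> {}"
        then obtain z where z: "z \<in> U k" "z \<in> A j" by blast
        have "g \<le> dist y z" using gap[OF i j(1) _ y(2) z(2)] j(2) by auto
        also have "\<dots> \<le> diameter (U k)" by (rule diameter_bounded_bound[OF U(2) y(1) z(1)])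
        finally show False using U(3)[of k] \<delta> by simp
      qed
      then have "(\<Sum>j\<in>I. diam_weight \<tau> (V j k)) = (\<Sum>j\<in>{i}. diam_weight \<tau> (V j k))"
        using I i by (intro sum.mono_neutral_right) (auto simp: V_def)
      also have "\<dots> \<le> diam_weight \<tau> (U k)" by (simp add: V_def)
      finally show ?thesis .
    next
      case False
      then have "(\<Sum>i\<in>I. diam_weight \<tau> (V i k)) = 0" by (intro sum.neutral) (auto simp: V_def)
      then show ?thesis by simp
    qed
  qed auto
  finally show "(\<Sum>i\<in>I. hausdorff_premeasure \<tau> \<delta> (A i)) \<le> (\<Sum>k. diam_weight \<tau> (U k))" .
qed

text \<open>Additivity on separated sets, as for any metric outer measure, without measurability.
  The truncation \<open>max h 0\<close> matches \<open>ennreal\<close>, which sends negative reals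
  to 0.\<close>

lemma card_mult_le_hausdorff_measure:
  assumes I: "finite I" and g: "0 < g" and a: "0 \<le> a"
    and gap: "\<And>i j y z. i \<in> I \<Longrightarrow> j \<in> I \<Longrightarrow> i \<noteq> j \<Longrightarrow> y \<in> A i \<Longrightarrow> z \<in> A j \<Longrightarrow> g \<le> dist y z"
    and ge: "\<And>i. i \<in> I \<Longrightarrow> ennreal a \<le> hausdorff_measure \<tau> (A i)"
    and le: "hausdorff_measure \<tau> (\<Union>i\<in>I. A i) \<le> ennreal h"
  shows "real (card I) * a \<le> max h 0"
proof (cases "I = {}")
  case False
  then have c: "0 < real (card I)" using I by (simp add: card_gt_0_iff)
  \<comment> \<open>The measure is a supremum over \<open>\<delta>\<close>, so only values strictly
    below \<open>a\<close> are known to be reached by a premeasure; finitely many sets then share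
    one \<open>\<delta>\<close>.\<close>
  have "a' \<le> max h 0 / real (card I)" if a': "a' < a" for a'
  proof -
    have "\<exists>\<delta>>0. ennreal a' \<le> hausdorff_premeasure \<tau> \<delta> (A i)" if i: "i \<in> I" for i
    proof (cases "a' < 0")
      case True
      then show ?thesis by (intro exI[of _ 1]) (simp add: ennreal_neg)
    next
      case False
      then have "ennreal a' < ennreal a" using a' by (simp add: ennreal_less_iff)
      then have "ennreal a' < hausdorff_measure \<tau> (A i)" using ge[OF i] by (rule order.strict_trans2)
      then show ?thesis unfolding hausdorff_measure_def less_SUP_iff by (auto intro: less_imp_le)
    qed
    then obtain d where d: "\<And>i. i \<in> I \<Longrightarrow> 0 < d i" "\<And>i. i \<in> I \<Longrightarrow> ennreal a' \<le> hausdorff_premeasure \<tau> (d i) (A i)"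
      by metis
    define \<delta> where "\<delta> = min (Min (d ` I)) (g / 2)"
    have \<delta>: "0 < \<delta>" "\<delta> < g" using d(1) I False g by (auto simp: \<delta>_def)
    have "\<delta> \<le> d i" if "i \<in> I" for i using I that unfolding \<delta>_def by (meson Min_le finite_imageI image_eqI min.coboundedI1)
    then have "ennreal a' \<le> hausdorff_premeasure \<tau> \<delta> (A i)" if "i \<in> I" for i
      using d(2)[OF that] hausdorff_premeasure_antimono that by (meson order_trans)
    then have "(\<Sum>i\<in>I. ennreal a') \<le> (\<Sum>i\<in>I. hausdorff_premeasure \<tau> \<delta> (A i))" by (rule sum_mono)
    also have "\<dots> \<le> hausdorff_premeasure \<tau> \<delta> (\<Union>i\<in>I. A i)"
      by (rule hausdorff_premeasure_superadditive[OF I \<delta>(2) gap])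
    also have "\<dots> \<le> hausdorff_measure \<tau> (\<Union>i\<in>I. A i)"
      unfolding hausdorff_measure_def using \<delta>(1) by (intro SUP_upper) auto
    also have "\<dots> \<le> ennreal (max h 0)" by (rule order_trans[OF le ennreal_leI]) simp
    finally have "ennreal (real (card I) * a') \<le> ennreal (max h 0)"
      by (simp add: ennreal_mult' ennreal_of_nat_eq_real_of_nat)
    then have "real (card I) * a' \<le> max h 0" by (subst (asm) ennreal_le_iff) auto
    then show ?thesis using c by (simp add: pos_le_divide_eq mult.commute)
  qed
  then have "a \<le> max h 0 / real (card I)" by (rule dense_le)
  then show ?thesis using c by (simp add: pos_le_divide_eq mult.commute)
qed simp

text \<open>A volume argument: separated points of \<open>E\<close> in a large ball carry disjoint
  small balls, whose measures are bounded below and whose total is bounded above. Before this, the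
  regularity exponent must be identified with the dimension \<open>t\<close>.\<close>

lemma AD_regular_extraction:
  fixes E :: "(real^2) set"
  assumes AD: "AD_regular E" and hd: "hausdorff_dim E = ereal t" and t: "0 < t"
  obtains E0 c where "E0 \<subseteq> E" "regular_counts E0 t 0 c" "hausdorff_content t E0 \<noteq> 0"
proof -
  obtain \<alpha> C where \<alpha>: "0 \<le> \<alpha>" and C: "1 \<le> C" and reg: "AD_regular_with \<alpha> C E"
    using AD by (auto simp: AD_regular_def)
  have lower: "ennreal (inverse C * r powr \<alpha>) \<le> hausdorff_measure \<alpha> (E \<inter> cball x r)"
    and upper: "hausdorff_measure \<alpha> (E \<inter> cball x r) \<le> ennreal (C * r powr \<alpha>)"
    if "x \<in> E" "0 < r" "bounded E \<longrightarrow> r < diameter E" for x r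
    using reg that unfolding AD_regular_with_def by auto
  \<comment> \<open>On a set of diameter 0 no radius is admissible and regularity says nothing;
    positive dimension excludes this case.\<close>
  have pos_diam: "0 < diameter E" if bd: "bounded E"
  proof (rule ccontr)
    assume "\<not> 0 < diameter E"
    then have d0: "diameter E = 0" using diameter_ge_0[OF bd] by simp
    have "hausdorff_measure \<tau> E = 0" if \<tau>: "0 < \<tau>" for \<tau>
    proof -
      have "hausdorff_content \<tau> E \<le> diam_weight \<tau> E" by (rule hausdorff_content_le_diam_weight[OF bd])
      then show ?thesis using \<tau> d0 by (simp add: hausdorff_measure_eq_0_iff diam_weight_def split: if_splits)
    qed
    then have "hausdorff_dim E \<le> ereal 0" by (intro hausdorff_dim_le) auto
    then show False using hd t by simp
  qed
  obtain r0 where r0: "0 < r0" "bounded E \<longrightarrow> r0 < diameter E"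
  proof (cases "bounded E")
    case True
    then show ?thesis using that[of "diameter E / 2"] pos_diam by auto
  qed (use that[of 1] in auto)
  have hposu: "hausdorff_content u E \<noteq> 0" if "0 < u" "u < t" for u
    using hausdorff_measure_pos_of_less_dim[of u E] hd that by (simp add: hausdorff_measure_eq_0_iff)
  have "E \<noteq> {}" using hposu[of "t/2"] t by auto
  then obtain x0 where x0: "x0 \<in> E" by auto
  have pos0: "hausdorff_measure \<alpha> (E \<inter> cball x0 r0) \<noteq> 0"
  proof
    assume "hausdorff_measure \<alpha> (E \<inter> cball x0 r0) = 0"
    then have "ennreal (inverse C * r0 powr \<alpha>) \<le> 0" using lower[OF x0 r0] by simp
    moreover have "0 < inverse C * r0 powr \<alpha>" using C r0(1) by simp
    ultimately show False by (metis ennreal_less_zero_iff leD)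
  qed
  have "t \<le> \<alpha>"
  proof (rule ccontr)
    assume "\<not> t \<le> \<alpha>"
    define u where "u = (\<alpha> + t) / 2"
    have u: "\<alpha> < u" "u < t" "0 < u" using \<open>\<not> t \<le> \<alpha>\<close> \<alpha> by (auto simp: u_def)
    have null: "hausdorff_content u (E \<inter> cball x r0) = 0" if "x \<in> E" for x
    proof -
      have "hausdorff_measure \<alpha> (E \<inter> cball x r0) < \<infinity>" using upper[OF that r0] by (simp add: le_less_trans)
      then have "hausdorff_measure u (E \<inter> cball x r0) = 0" by (rule hausdorff_measure_null_of_finite[OF \<alpha> u(1)])
      then show ?thesis using u(3) by (simp add: hausdorff_measure_eq_0_iff)
    qed
    \<comment> \<open>Separability gives countably many balls of one admissible radius covering
      \<open>E\<close>, each of finite \<open>\<alpha>\<close>-dimensional measure.\<close>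
    obtain T where T: "countable T" "T \<subseteq> E" "E \<subseteq> closure T" using separable[of E] by blast
    have "hausdorff_content u (\<Union>x\<in>T. E \<inter> cball x r0) = 0"
      using T null by (intro hausdorff_content_null_countable_UN) auto
    moreover have "E \<subseteq> (\<Union>x\<in>T. E \<inter> cball x r0)"
    proof
      fix y assume y: "y \<in> E"
      then obtain x where "x \<in> T" "dist x y < r0" using T(3) r0(1) closure_approachable by blast
      then show "y \<in> (\<Union>x\<in>T. E \<inter> cball x r0)" using y by (auto intro!: bexI[of _ x])
    qed
    ultimately have "hausdorff_content u E = 0" using hausdorff_content_mono[of E "\<Union>x\<in>T. E \<inter> cball x r0" u] by simp
    then show False using hposu[OF u(3,2)] by simp
  qed
  moreover have "\<alpha> \<le> t"
  proof (rule ccontr)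
    assume "\<not> \<alpha> \<le> t"
    then have "hausdorff_measure \<alpha> E = 0" using hd by (intro hausdorff_measure_null_of_dim_less) simp
    then have "hausdorff_measure \<alpha> (E \<inter> cball x0 r0) = 0"
      by (rule hausdorff_measure_null_subset[OF Int_lower1]) (use \<open>\<not> \<alpha> \<le> t\<close> t in simp)
    then show False using pos0 by simp
  qed
  ultimately have \<alpha>t: "\<alpha> = t" by simp
  \<comment> \<open>Regularity holds below the diameter only; from level \<open>m0\<close> on the
    radius \<open>3 * 2 powr - real m\<close> is at most \<open>r0\<close> and hence
    admissible.\<close>
  obtain m0 where m0: "(1/2) ^ m0 < r0 / 3" using real_arch_pow_inv[of "r0 / 3" "1/2"] r0 by auto
  then have m0: "3 * 2 powr - real m0 \<le> r0" by (simp add: powr_minus powr_realpow power_one_over inverse_eq_divide)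
  have "hausdorff_content t E \<noteq> 0"
    using pos0 t hausdorff_measure_null_subset[of "E \<inter> cball x0 r0" E t] by (auto simp: \<alpha>t hausdorff_measure_eq_0_iff)
  then obtain p where p: "hausdorff_content t {y \<in> E. cell m0 y = p} \<noteq> 0" by (rule exists_piece_in_cell)
  define E0 where "E0 = {y \<in> E. cell m0 y = p}"
  \<comment> \<open>One \<open>C\<close> comes from each regularity bound, and 9 is the ratio of the
    radii \<open>3 * 2 powr - m\<close> and \<open>2 powr - n / 3\<close>, apart from
    \<open>2 powr (n - m)\<close>.\<close>
  define K where "K = C * C * 9 powr t"
  have K: "1 \<le> K" using C t mult_mono[of 1 C 1 C] ge_one_powr_ge_zero[of 9 t] mult_mono[of 1 "C*C" 1 "9 powr t"] by (simp add: K_def)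
  have sep: "real (card F) \<le> K * 2 powr ((real n - real m) * t)"
    if F: "finite F" "F \<subseteq> E" "separated (2 powr - real n) F" and y: "y \<in> E" "F \<subseteq> cball y (2 * 2 powr - real m)"
      and mn: "m0 \<le> m" "m \<le> n" for F y m n
  proof -
    \<comment> \<open>Around centres at distance \<open>2 powr - n\<close> balls of a third of this
      radius leave a gap of another third. They stay in the ball of radius \<open>?R\<close> because
      \<open>2 * 2 powr - m + ?\<rho> \<le> ?R\<close>.\<close>
    let ?\<rho> = "2 powr - real n / 3" and ?R = "3 * 2 powr - real m"
    have nm: "2 powr - real n \<le> 2 powr - real m" "2 powr - real m \<le> 2 powr - real m0"
      using mn by (auto intro!: powr_mono)
    have "0 < (2::real) powr - real n" "0 < (2::real) powr - real m" by simp_all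
    then have \<rho>: "0 < ?\<rho>" "?\<rho> \<le> ?R" "?R \<le> r0" "0 < ?R" using nm m0 by linarith+
    have adm: "bounded E \<longrightarrow> ?\<rho> < diameter E" "bounded E \<longrightarrow> ?R < diameter E" using r0(2) \<rho> by linarith+
    have "real (card F) * (inverse C * ?\<rho> powr t) \<le> max (C * ?R powr t) 0"
    proof (rule card_mult_le_hausdorff_measure[where g = ?\<rho> and \<tau> = t and A = "\<lambda>f. E \<inter> cball f ?\<rho>"])
      show "?\<rho> \<le> dist a b" if f: "f \<in> F" "f' \<in> F" "f \<noteq> f'" and ab: "a \<in> E \<inter> cball f ?\<rho>" "b \<in> E \<inter> cball f' ?\<rho>" for f f' a b
      proof -
        have "2 powr - real n \<le> dist f f'" using separatedD[OF F(3)] f by blast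
        also have "\<dots> \<le> dist f a + dist a b + dist b f'" by metric
        also have "dist b f' = dist f' b" by (rule dist_commute)
        finally show ?thesis using ab by simp
      qed
      show "ennreal (inverse C * ?\<rho> powr t) \<le> hausdorff_measure t (E \<inter> cball f ?\<rho>)" if "f \<in> F" for f
        using lower[of f ?\<rho>] F(2) that \<rho>(1) adm(1) by (auto simp: \<alpha>t)
      have "(\<Union>f\<in>F. E \<inter> cball f ?\<rho>) \<subseteq> E \<inter> cball y ?R"
      proof (rule UN_least, rule subsetI)
        fix f z assume "f \<in> F" "z \<in> E \<inter> cball f ?\<rho>"
        then have f: "f \<in> F" "z \<in> cball f ?\<rho>" and z: "z \<in> E" by auto
        have "dist y z \<le> dist y f + dist f z" by (rule dist_triangle)
        moreover have "dist y f \<le> 2 * 2 powr - real m" using f y(2) by auto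
        moreover have "dist f z \<le> ?\<rho>" using f(2) by simp
        ultimately have "dist y z \<le> ?R" using nm(1) \<rho>(1) by linarith
        then show "z \<in> E \<inter> cball y ?R" using z by simp
      qed
      have up: "hausdorff_measure t (E \<inter> cball y ?R) \<le> ennreal (C * ?R powr t)"
        using upper[OF y(1) \<rho>(4) adm(2)] by (simp add: \<alpha>t)
      have "hausdorff_measure t (\<Union>f\<in>F. E \<inter> cball f ?\<rho>) \<le> hausdorff_measure t (E \<inter> cball y ?R)"
        by (rule hausdorff_measure_mono) fact
      then show "hausdorff_measure t (\<Union>f\<in>F. E \<inter> cball f ?\<rho>) \<le> ennreal (C * ?R powr t)" using up by (rule order_trans)
    qed (use F C \<rho> in auto)
    then have "real (card F) * (inverse C * ?\<rho> powr t) \<le> C * ?R powr t" using C by simp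
    then have "real (card F) * ?\<rho> powr t \<le> C * C * ?R powr t" using C by (simp add: field_simps)
    also have "?R = (9 * 2 powr (real n - real m)) * ?\<rho>" by (simp add: powr_diff powr_minus field_simps)
    also have "((9 * 2 powr (real n - real m)) * ?\<rho>) powr t = (9 powr t * 2 powr ((real n - real m) * t)) * ?\<rho> powr t"
      by (simp only: powr_mult powr_powr)
    finally have "real (card F) * ?\<rho> powr t \<le> (C * C * (9 powr t * 2 powr ((real n - real m) * t))) * ?\<rho> powr t"
      by (simp only: mult.assoc)
    moreover have "0 < ?\<rho> powr t" by simp
    ultimately have "real (card F) \<le> C * C * (9 powr t * 2 powr ((real n - real m) * t))" by (rule mult_right_le_imp_le)
    then show ?thesis by (simp only: K_def mult.assoc)
  qed
  have "regular_counts E0 t 0 (log 2 (4 * K))"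
    unfolding regular_counts_def
  proof (intro conjI ballI allI impI)
    fix y z assume "y \<in> E0" "z \<in> E0"
    then show "cell 0 y = cell 0 z" by (intro cell_eq_mono[of 0 m0]) (auto simp: E0_def)
  next
    fix m n :: nat and y assume mn: "m \<le> n" and y: "y \<in> E0"
    \<comment> \<open>All of \<open>E0\<close> lies in one cell of level \<open>m0\<close>, so
      sharing a cell at a coarser level \<open>m\<close> already means sharing one at level
      \<open>m0\<close>.\<close>
    define m' where "m' = max m m0"
    let ?Z = "{z \<in> E0. cell m z = cell m y}"
    have cm: "cell m' z = cell m' y" if "z \<in> ?Z" for z
      using that y by (auto simp: m'_def max_def E0_def)
    have "real (card (cell n ` ?Z)) \<le> 4 * K * 2 powr ((real n - real m) * t)"
    proof (cases "m' \<le> n")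
      case True
      have Zb: "?Z \<subseteq> cball y (2 * 2 powr - real m')"
      proof
        fix z assume "z \<in> ?Z"
        from dist_less_if_cell_eq[OF cm[OF this, symmetric]] show "z \<in> cball y (2 * 2 powr - real m')" by simp
      qed
      then have "bounded ?Z" by (rule bounded_subset[OF bounded_cball])
      then have "real (card (cell n ` ?Z)) \<le> 4 * (K * 2 powr ((real n - real m') * t))"
      proof (rule card_cells_le_if_separated_le)
        fix F assume F: "finite F" "F \<subseteq> ?Z" "separated (2 powr - real n) F"
        have FE: "F \<subseteq> E" "y \<in> E" using F(2) y by (auto simp: E0_def)
        show "real (card F) \<le> K * 2 powr ((real n - real m') * t)"
          by (rule sep[OF F(1) FE(1) F(3) FE(2) subset_trans[OF F(2) Zb] _ True]) (simp add: m'_def)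
      qed
      also have "\<dots> \<le> 4 * (K * 2 powr ((real n - real m) * t))"
        using K t by (intro mult_left_mono powr_mono mult_right_mono) (auto simp: m'_def)
      finally show ?thesis by (simp only: mult.assoc)
    next
      case False
      have "cell n z = cell n y" if "z \<in> ?Z" for z
        using False by (intro cell_eq_mono[OF _ cm[OF that]]) simp
      then have "cell n ` ?Z \<subseteq> {cell n y}" by blast
      then have "card (cell n ` ?Z) \<le> card {cell n y}" by (intro card_mono) auto
      then have "real (card (cell n ` ?Z)) \<le> 1 * 1" by simp
      also have "\<dots> \<le> 4 * K * 2 powr ((real n - real m) * t)"
        using K mn t by (intro mult_mono ge_one_powr_ge_zero) auto
      finally show ?thesis .
    qed
    also have "\<dots> = 2 powr ((real n - real m) * t + 0 * real n + log 2 (4 * K))"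
      using K by (simp add: powr_add)
    finally show "real (card (cell n ` ?Z)) \<le> 2 powr ((real n - real m) * t + 0 * real n + log 2 (4 * K))" .
  qed
  then show ?thesis using that[of E0] p by (auto simp: E0_def)
qed

section \<open>Random slopes with prescribed free binary digits\<close>

definition digit :: "nat set \<Rightarrow> (nat \<Rightarrow> bool) \<Rightarrow> nat \<Rightarrow> nat" where
  "digit S \<omega> i = of_bool (i \<in> S \<and> \<omega> i)"

definition slope :: "nat set \<Rightarrow> (nat \<Rightarrow> bool) \<Rightarrow> real" where
  "slope S \<omega> = (\<Sum>i. real (digit S \<omega> i) * (1/2) ^ Suc i)"

text \<open>The first \<open>m\<close> binary digits read as an integer \<open>v\<close>. The slope
  then lies in the closed interval from \<open>v / 2 ^ m\<close> to \<open>(v + 1) / 2 ^ m\<close>;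
  a tail of ones reaches the right end, so adjacent prefixes may share a slope.\<close>

primrec digit_prefix :: "nat set \<Rightarrow> nat \<Rightarrow> (nat \<Rightarrow> bool) \<Rightarrow> nat" where
  "digit_prefix S 0 \<omega> = 0"
| "digit_prefix S (Suc m) \<omega> = 2 * digit_prefix S m \<omega> + digit S \<omega> m"

definition free_count :: "nat set \<Rightarrow> nat \<Rightarrow> nat" where
  "free_count S m = card (S \<inter> {..<m})"

lemma digit_le_1: "digit S \<omega> i \<le> 1"
  by (simp add: digit_def)

lemma slope_term_le: "real (digit S \<omega> i) * (1/2) ^ Suc i \<le> (1/2) ^ Suc i"
  using digit_le_1[of S \<omega> i] by (intro mult_left_le_one_le) auto

lemma slope_summable: "summable (\<lambda>i. real (digit S \<omega> i) * (1/2) ^ Suc i)"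
  by (rule summable_comparison_test'[OF sums_summable[OF power_half_series], of 0])
     (use slope_term_le in auto)

lemma sum_digits_eq_prefix: "(\<Sum>i<m. real (digit S \<omega> i) * (1/2) ^ Suc i) = real (digit_prefix S m \<omega>) / 2 ^ m"
  by (induction m) (auto simp: field_simps)

lemma slope_bounds:
  "real (digit_prefix S m \<omega>) / 2 ^ m \<le> slope S \<omega>" "slope S \<omega> \<le> (real (digit_prefix S m \<omega>) + 1) / 2 ^ m"
proof -
  let ?f = "\<lambda>i. real (digit S \<omega> i) * (1/2) ^ Suc i"
  have eq: "slope S \<omega> = (\<Sum>i. ?f (i + m)) + real (digit_prefix S m \<omega>) / 2 ^ m"
    unfolding slope_def sum_digits_eq_prefix[symmetric] by (rule suminf_split_initial_segment[OF slope_summable])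
  have sm: "summable (\<lambda>i. ?f (i + m))" using slope_summable by (subst summable_iff_shift)
  have "0 \<le> (\<Sum>i. ?f (i + m))" by (rule suminf_nonneg[OF sm]) simp
  then show "real (digit_prefix S m \<omega>) / 2 ^ m \<le> slope S \<omega>" using eq by simp
  have s2: "(\<lambda>i. (1/2) ^ m * (1/2) ^ Suc i :: real) sums ((1/2) ^ m * 1)" by (intro sums_mult power_half_series)
  have "(\<Sum>i. ?f (i + m)) \<le> (\<Sum>i. (1/2) ^ m * (1/2) ^ Suc i)"
  proof (rule suminf_le[OF _ sm sums_summable[OF s2]])
    fix i
    show "?f (i + m) \<le> (1/2) ^ m * (1/2) ^ Suc i"
      using slope_term_le[of S \<omega> "i + m"] by (simp add: power_add mult_ac)
  qed
  also have "\<dots> = 1 / 2 ^ m" unfolding sums_unique[OF s2, symmetric] by (simp add: power_one_over)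
  finally show "slope S \<omega> \<le> (real (digit_prefix S m \<omega>) + 1) / 2 ^ m" using eq by (simp add: add_divide_distrib)
qed

lemma slope_nonneg: "0 \<le> slope S \<omega>" and slope_le_1: "slope S \<omega> \<le> 1"
  using slope_bounds[where m = 0] by auto

lemma prefix_cong: "(\<And>i. i \<in> S \<Longrightarrow> i < m \<Longrightarrow> \<omega> i = \<omega>' i) \<Longrightarrow> digit_prefix S m \<omega> = digit_prefix S m \<omega>'"
  by (induction m) (auto simp: digit_def)

lemma prefix_eqD:
  assumes "digit_prefix S m \<omega> = digit_prefix S m \<omega>'" "i \<in> S" "i < m"
  shows "\<omega> i = \<omega>' i"
  using assms
proof (induction m)
  case (Suc m)
  have d: "digit S \<omega> m \<le> 1" "digit S \<omega>' m \<le> 1" by (rule digit_le_1)+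
  have "digit_prefix S m \<omega> = digit_prefix S m \<omega>'" "digit S \<omega> m = digit S \<omega>' m"
    using Suc.prems(1) d by simp_all presburger+
  then show ?case using Suc by (cases "i = m") (auto simp: digit_def of_bool_def split: if_splits)
qed simp

lemma card_range_prefix: "card (range (digit_prefix S m)) = 2 ^ free_count S m" and finite_range_prefix: "finite (range (digit_prefix S m))"
proof -
  let ?g = "\<lambda>A. digit_prefix S m (\<lambda>i. i \<in> A)"
  have r: "range (digit_prefix S m) = ?g ` Pow (S \<inter> {..<m})"
  proof (intro equalityI subsetI)
    fix v assume "v \<in> range (digit_prefix S m)"
    then obtain \<omega> where "v = digit_prefix S m \<omega>" by auto
    also have "\<dots> = ?g {i \<in> S \<inter> {..<m}. \<omega> i}" by (rule prefix_cong) auto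
    finally show "v \<in> ?g ` Pow (S \<inter> {..<m})" by blast
  qed auto
  have "inj_on ?g (Pow (S \<inter> {..<m}))"
  proof (rule inj_onI)
    fix A B assume AB: "A \<in> Pow (S \<inter> {..<m})" "B \<in> Pow (S \<inter> {..<m})" "?g A = ?g B"
    then show "A = B" using prefix_eqD[OF AB(3)] by blast
  qed
  then show "card (range (digit_prefix S m)) = 2 ^ free_count S m"
    unfolding r free_count_def by (simp only: card_image card_Pow[OF finite_Int[OF disjI2[OF finite_lessThan]]])
  show "finite (range (digit_prefix S m))" unfolding r by simp
qed

section \<open>The coin measure and the concentration of random slopes\<close>

definition coins :: "(nat \<Rightarrow> bool) measure" where
  "coins = PiM UNIV (\<lambda>_. measure_pmf (bernoulli_pmf (1/2)))"

interpretation coins: product_prob_space "\<lambda>_. measure_pmf (bernoulli_pmf (1/2))" "UNIV :: nat set" ..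

lemma prob_space_coins: "prob_space coins"
  unfolding coins_def by (rule coins.prob_space_axioms)

lemma space_coins [simp]: "space coins = UNIV"
  by (simp add: coins_def space_PiM)

lemma coin_measurable: "(\<lambda>\<omega>. \<omega> i) \<in> coins \<rightarrow>\<^sub>M count_space UNIV"
  unfolding coins_def
  using measurable_component_singleton[of i UNIV "\<lambda>_. measure_pmf (bernoulli_pmf (1/2))"]
  by (simp cong: measurable_cong_sets)

lemma digit_measurable: "(\<lambda>\<omega>. real (digit S \<omega> i)) \<in> borel_measurable coins"
proof -
  have "(\<lambda>\<omega>. (\<lambda>b. real (of_bool (i \<in> S \<and> b))) (\<omega> i)) \<in> borel_measurable coins"
    by (rule measurable_compose[OF coin_measurable]) simp
  then show ?thesis by (simp add: digit_def)
qed

lemma slope_measurable: "slope S \<in> borel_measurable coins"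
proof -
  have "(\<lambda>\<omega>. \<Sum>i. real (digit S \<omega> i) * (1/2) ^ Suc i) \<in> borel_measurable coins"
    by (intro borel_measurable_suminf borel_measurable_times digit_measurable borel_measurable_const)
  then show ?thesis by (simp add: slope_def[abs_def])
qed

text \<open>A prefix that occurs fixes exactly the free digits below \<open>m\<close>: the event is
  a cylinder of \<open>free_count S m\<close> fair coins. Other values give the empty event.\<close>

lemma prob_prefix_eq:
  "{\<omega>. digit_prefix S m \<omega> = v} \<in> sets coins" "measure coins {\<omega>. digit_prefix S m \<omega> = v} \<le> (1/2) ^ free_count S m"
proof -
  let ?J = "S \<inter> {..<m}"
  have "{\<omega>. digit_prefix S m \<omega> = v} \<in> sets coins \<and> measure coins {\<omega>. digit_prefix S m \<omega> = v} \<le> (1/2) ^ free_count S m"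
  proof (cases "\<exists>\<omega>0. digit_prefix S m \<omega>0 = v")
    case True
    then obtain \<omega>0 where w: "digit_prefix S m \<omega>0 = v" by blast
    have eq: "{\<omega>. digit_prefix S m \<omega> = v} = prod_emb UNIV (\<lambda>_. measure_pmf (bernoulli_pmf (1/2))) ?J (PiE ?J (\<lambda>i. {\<omega>0 i}))"
    proof (intro equalityI subsetI)
      fix \<omega> assume "\<omega> \<in> {\<omega>. digit_prefix S m \<omega> = v}"
      then have "digit_prefix S m \<omega> = digit_prefix S m \<omega>0" using w by simp
      then have "\<omega> i = \<omega>0 i" if "i \<in> ?J" for i using prefix_eqD that by blast
      then show "\<omega> \<in> prod_emb UNIV (\<lambda>_. measure_pmf (bernoulli_pmf (1/2))) ?J (PiE ?J (\<lambda>i. {\<omega>0 i}))"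
        by (auto simp: prod_emb_def)
    next
      fix \<omega> assume *: "\<omega> \<in> prod_emb UNIV (\<lambda>_. measure_pmf (bernoulli_pmf (1/2))) ?J (PiE ?J (\<lambda>i. {\<omega>0 i}))"
      have "\<omega> i = \<omega>0 i" if "i \<in> ?J" for i
      proof -
        have "restrict \<omega> ?J \<in> PiE ?J (\<lambda>i. {\<omega>0 i})" using * by (simp add: prod_emb_def)
        then have "restrict \<omega> ?J i \<in> {\<omega>0 i}" using that by (rule PiE_mem)
        then show ?thesis using that by simp
      qed
      then have "digit_prefix S m \<omega> = digit_prefix S m \<omega>0" by (intro prefix_cong) auto
      then show "\<omega> \<in> {\<omega>. digit_prefix S m \<omega> = v}" using w by simp
    qed
    have half: "measure (measure_pmf (bernoulli_pmf (1/2))) {x} = 1/2" for x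
      by (cases x) (simp_all add: measure_pmf_single)
    have "measure coins {\<omega>. digit_prefix S m \<omega> = v} = (\<Prod>i\<in>?J. measure (measure_pmf (bernoulli_pmf (1/2))) {\<omega>0 i})"
      unfolding eq coins_def by (rule coins.measure_PiM_emb) auto
    also have "\<dots> = (1/2) ^ free_count S m" unfolding half by (simp add: free_count_def)
    finally have "measure coins {\<omega>. digit_prefix S m \<omega> = v} = (1/2) ^ free_count S m" .
    moreover have "{\<omega>. digit_prefix S m \<omega> = v} \<in> sets coins"
      unfolding eq coins_def by (rule sets_PiM_I) auto
    ultimately show ?thesis by simp
  next
    case False
    then have "{\<omega>. digit_prefix S m \<omega> = v} = {}" by auto
    then show ?thesis by simp
  qed
  then show "{\<omega>. digit_prefix S m \<omega> = v} \<in> sets coins" "measure coins {\<omega>. digit_prefix S m \<omega> = v} \<le> (1/2) ^ free_count S m"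
    by auto
qed

lemma prob_prefix_in:
  assumes "finite V"
  shows "{\<omega>. digit_prefix S m \<omega> \<in> V} \<in> sets coins"
    "measure coins {\<omega>. digit_prefix S m \<omega> \<in> V} \<le> real (card V) * (1/2) ^ free_count S m"
proof -
  interpret prob_space coins by (rule prob_space_coins)
  have eq: "{\<omega>. digit_prefix S m \<omega> \<in> V} = (\<Union>v\<in>V. {\<omega>. digit_prefix S m \<omega> = v})" by auto
  show "{\<omega>. digit_prefix S m \<omega> \<in> V} \<in> sets coins"
    unfolding eq using assms prob_prefix_eq(1) by (intro sets.finite_UN) auto
  have "measure coins {\<omega>. digit_prefix S m \<omega> \<in> V} \<le> (\<Sum>v\<in>V. measure coins {\<omega>. digit_prefix S m \<omega> = v})"
    unfolding eq using assms prob_prefix_eq(1) by (intro finite_measure_subadditive_finite) auto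
  also have "\<dots> \<le> (\<Sum>v\<in>V. (1/2) ^ free_count S m)" by (intro sum_mono prob_prefix_eq(2))
  finally show "measure coins {\<omega>. digit_prefix S m \<omega> \<in> V} \<le> real (card V) * (1/2) ^ free_count S m" by simp
qed

text \<open>A slope in the interval forces its prefix \<open>v\<close> to satisfy
  \<open>2 ^ k * c - 1 \<le> v \<le> 2 ^ k * c + 1\<close>, which leaves at most three
  values.\<close>

lemma prob_slope_in_interval:
  "measure coins {\<omega> \<in> space coins. c \<le> slope S \<omega> \<and> slope S \<omega> \<le> c + 2 powr - real k} \<le> 3 * (1/2) ^ free_count S k"
proof -
  interpret prob_space coins by (rule prob_space_coins)
  define v0 where "v0 = \<lceil>2 ^ k * c - 1\<rceil>"
  define V where "V = nat ` {v0, v0 + 1, v0 + 2}"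
  have cV: "card V \<le> 3"
    unfolding V_def by (rule order_trans[OF card_image_le]) (auto simp: card_insert_if)
  have "digit_prefix S k \<omega> \<in> V" if w: "c \<le> slope S \<omega>" "slope S \<omega> \<le> c + 2 powr - real k" for \<omega>
  proof -
    have "c \<le> (real (digit_prefix S k \<omega>) + 1) / 2 ^ k" using slope_bounds(2)[of S \<omega> k] w(1) by linarith
    then have "2 ^ k * c \<le> real (digit_prefix S k \<omega>) + 1" by (simp add: field_simps)
    moreover have "real (digit_prefix S k \<omega>) / 2 ^ k \<le> c + 1 / 2 ^ k"
      using slope_bounds(1)[of S k \<omega>] w(2) by (simp add: powr_minus powr_realpow inverse_eq_divide)
    then have "real (digit_prefix S k \<omega>) \<le> 2 ^ k * c + 1" by (simp add: field_simps)
    ultimately have "v0 \<le> int (digit_prefix S k \<omega>)" "int (digit_prefix S k \<omega>) \<le> v0 + 2"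
      unfolding v0_def by linarith+
    then have "int (digit_prefix S k \<omega>) \<in> {v0, v0 + 1, v0 + 2}" by auto
    then have "nat (int (digit_prefix S k \<omega>)) \<in> V" unfolding V_def by (rule imageI)
    then show ?thesis by simp
  qed
  then have "{\<omega> \<in> space coins. c \<le> slope S \<omega> \<and> slope S \<omega> \<le> c + 2 powr - real k} \<subseteq> {\<omega>. digit_prefix S k \<omega> \<in> V}" by auto
  then have "measure coins {\<omega> \<in> space coins. c \<le> slope S \<omega> \<and> slope S \<omega> \<le> c + 2 powr - real k} \<le> measure coins {\<omega>. digit_prefix S k \<omega> \<in> V}"
    by (intro finite_measure_mono prob_prefix_in) (auto simp: V_def)
  also have "\<dots> \<le> real (card V) * (1/2) ^ free_count S k" by (intro prob_prefix_in) (auto simp: V_def)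
  also have "\<dots> \<le> 3 * (1/2) ^ free_count S k" using cV by (intro mult_right_mono) auto
  finally show ?thesis .
qed

section \<open>Free digits of density \<open>s\<close> in lacunary windows\<close>

text \<open>The jumps of the floor of \<open>s * i\<close>; the number of elements below
  \<open>m\<close> telescopes to exactly the floor of \<open>s * m\<close>, so the density is
  correct up to 1 at every length.\<close>

definition density_set :: "real \<Rightarrow> nat set" where
  "density_set s = {i. \<lfloor>s * real i\<rfloor> < \<lfloor>s * real (Suc i)\<rfloor>}"

lemma free_count_Suc: "free_count S (Suc m) = free_count S m + of_bool (m \<in> S)"
  by (simp add: free_count_def lessThan_Suc Int_insert_right)

lemma free_count_density_set:
  assumes "0 \<le> s" "s \<le> 1"
  shows "int (free_count (density_set s) m) = \<lfloor>s * real m\<rfloor>"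
proof (induction m)
  case (Suc m)
  have "\<lfloor>s * real m\<rfloor> \<le> \<lfloor>s * real (Suc m)\<rfloor>" using assms by (intro floor_mono mult_left_mono) auto
  moreover have "\<lfloor>s * real (Suc m)\<rfloor> \<le> \<lfloor>s * real m + 1\<rfloor>" using assms by (intro floor_mono) (simp add: algebra_simps)
  ultimately show ?case using Suc by (auto simp: free_count_Suc density_set_def)
qed (simp add: free_count_def)

lemma free_count_density_set_bounds:
  assumes "0 \<le> s" "s \<le> 1"
  shows "real (free_count (density_set s) m) \<le> s * real m" "s * real m - 1 \<le> real (free_count (density_set s) m)"
proof -
  have "real (free_count (density_set s) m) = real_of_int \<lfloor>s * real m\<rfloor>"
    using free_count_density_set[OF assms, of m] by (metis of_int_of_nat_eq)
  then show "real (free_count (density_set s) m) \<le> s * real m" "s * real m - 1 \<le> real (free_count (density_set s) m)"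
    by linarith+
qed

text \<open>The windows \<open>[a k, b k)\<close>; no digit is free in the gaps \<open>[b k, a (k+1))\<close>, whose
  relative length is controlled by \<open>R k\<close>.\<close>

primrec win_start :: "(nat \<Rightarrow> nat) \<Rightarrow> nat \<Rightarrow> nat" where
  "win_start R 0 = 1"
| "win_start R (Suc k) = R k * (win_start R k * Suc k ^ 3)"

definition win_end :: "(nat \<Rightarrow> nat) \<Rightarrow> nat \<Rightarrow> nat" where
  "win_end R k = win_start R k * Suc k ^ 3"

definition window_set :: "real \<Rightarrow> (nat \<Rightarrow> nat) \<Rightarrow> nat set" where
  "window_set s R = density_set s \<inter> (\<Union>k. {win_start R k..<win_end R k})"

lemma win_start_Suc: "win_start R (Suc k) = R k * win_end R k"
  by (simp add: win_end_def)

context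
  fixes R :: "nat \<Rightarrow> nat"
  assumes R1: "\<And>k. 1 \<le> R k"
begin

lemma win_start_le_end: "win_start R k \<le> win_end R k"
  by (simp add: win_end_def)

lemma win_end_le_start: "win_end R k \<le> win_start R (Suc k)"
  using mult_le_mono1[OF R1[of k], of "win_end R k"] by (simp only: win_start_Suc mult_1)

lemma win_start_mono: "mono (win_start R)"
  by (rule incseq_SucI) (rule order_trans[OF win_start_le_end win_end_le_start])

lemma win_end_mono: "mono (win_end R)"
  by (rule incseq_SucI) (rule order_trans[OF win_end_le_start win_start_le_end])

lemma win_start_ge: "Suc k \<le> win_start R (Suc k)" and win_start_pos: "1 \<le> win_start R k"
proof -
  show pos: "1 \<le> win_start R k" for k
    using win_start_mono monoD[of "win_start R" 0 k] by simp
  have "1 * Suc k \<le> win_start R k * Suc k ^ 3" using pos by (intro mult_le_mono) (auto intro: self_le_power)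
  then show "Suc k \<le> win_start R (Suc k)" using win_end_le_start[of k] unfolding win_end_def mult_1 by (rule order_trans)
qed

lemma free_count_window_set_le:
  assumes "0 \<le> s" "s \<le> 1"
  shows "real (free_count (window_set s R) m) \<le> s * real m"
proof -
  have "free_count (window_set s R) m \<le> free_count (density_set s) m"
    unfolding free_count_def window_set_def by (intro card_mono) auto
  then show ?thesis using free_count_density_set_bounds(1)[OF assms, of m] by linarith
qed

lemma free_count_window_set_gap:
  assumes "0 \<le> s" "s \<le> 1"
  shows "real (free_count (window_set s R) (win_start R (Suc k))) \<le> s * real (win_end R k)"
proof -
  have "window_set s R \<inter> {..<win_start R (Suc k)} \<subseteq> density_set s \<inter> {..<win_end R k}"
  proof
    fix i assume i: "i \<in> window_set s R \<inter> {..<win_start R (Suc k)}"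
    then obtain j where j: "win_start R j \<le> i" "i < win_end R j" by (auto simp: window_set_def)
    have "j \<le> k"
    proof (rule ccontr)
      assume "\<not> j \<le> k"
      then have "win_start R (Suc k) \<le> win_start R j" by (intro monoD[OF win_start_mono]) simp
      then show False using i j by simp
    qed
    then have "win_end R j \<le> win_end R k" by (rule monoD[OF win_end_mono])
    then show "i \<in> density_set s \<inter> {..<win_end R k}" using i j by (auto simp: window_set_def)
  qed
  then have "free_count (window_set s R) (win_start R (Suc k)) \<le> free_count (density_set s) (win_end R k)"
    unfolding free_count_def by (intro card_mono) auto
  then show ?thesis using free_count_density_set_bounds(1)[OF assms, of "win_end R k"] by linarith
qed

text \<open>Every digit before the current window is treated as frozen. This wastes at most
  \<open>s * win_start R k\<close>, which is little for \<open>m\<close> much larger than the start;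
  the 1 is the rounding in \<open>density_set\<close>.\<close>

lemma free_count_window_set_ge:
  assumes s: "0 \<le> s" "s \<le> 1" and m: "m \<le> win_end R k"
  shows "s * (real m - real (win_start R k)) - 1 \<le> real (free_count (window_set s R) m)"
proof (cases "win_start R k \<le> m")
  case True
  let ?a = "win_start R k"
  have "density_set s \<inter> {..<m} \<subseteq> (density_set s \<inter> {..<?a}) \<union> (window_set s R \<inter> {..<m})"
  proof
    fix i assume i: "i \<in> density_set s \<inter> {..<m}"
    show "i \<in> (density_set s \<inter> {..<?a}) \<union> (window_set s R \<inter> {..<m})"
    proof (cases "i < ?a")
      case False
      then have "i \<in> {?a..<win_end R k}" using i m by simp
      then show ?thesis using i by (auto simp: window_set_def)
    qed (use i in simp)
  qed
  then have "free_count (density_set s) m \<le> card ((density_set s \<inter> {..<?a}) \<union> (window_set s R \<inter> {..<m}))"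
    unfolding free_count_def by (intro card_mono) auto
  also have "\<dots> \<le> free_count (density_set s) ?a + free_count (window_set s R) m"
    unfolding free_count_def by (rule card_Un_le)
  finally have "real (free_count (density_set s) m) \<le> real (free_count (density_set s) ?a) + real (free_count (window_set s R) m)"
    by (simp only: of_nat_le_iff flip: of_nat_add)
  then show ?thesis
    using free_count_density_set_bounds(1)[OF s, of ?a] free_count_density_set_bounds(2)[OF s, of m]
    by (simp add: right_diff_distrib)
next
  case False
  then have "s * (real m - real (win_start R k)) \<le> 0" using s by (intro mult_nonneg_nonpos) auto
  then show ?thesis by simp
qed

text \<open>The last window with \<open>M * win_start R k \<le> N\<close> is used. If
  \<open>N\<close> lies beyond its end, it is divided into equal parts that just fit; maximality of
  \<open>k\<close> gives \<open>N < M * R k * win_end R k\<close> and so bounds their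
  number.\<close>

lemma exists_window_block:
  assumes M: "1 \<le> M" and R0: "\<And>k. R k \<le> R0 * Suc k"
  obtains N0 where "\<And>N. N0 \<le> N \<Longrightarrow> \<exists>i k. 1 \<le> i \<and> i * i \<le> N \<and> i \<le> M * R k \<and>
     M * win_start R k \<le> N div i \<and> N div i \<le> win_end R k"
proof -
  \<comment> \<open>From \<open>k0\<close> on the cube in \<open>win_end\<close> dominates:
    \<open>Suc k ^ 3\<close> exceeds both \<open>2 * M\<close> and
    \<open>(M * R k) * (M * R k)\<close>, the latter because \<open>R\<close> grows at most
    linearly.\<close>
  define k0 where "k0 = (M * R0) * (M * R0) + 2 * M"
  have "\<exists>i k. 1 \<le> i \<and> i * i \<le> N \<and> i \<le> M * R k \<and> M * win_start R k \<le> N div i \<and> N div i \<le> win_end R k"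
    if N: "M * win_start R k0 \<le> N" for N
  proof -
    define K where "K = {k. M * win_start R k \<le> N}"
    have "k \<le> N" if "k \<in> K" for k
    proof (cases k)
      case (Suc j)
      then have "k \<le> win_start R k" using win_start_ge[of j] by simp
      also have "\<dots> \<le> M * win_start R k" using M by simp
      finally show ?thesis using that by (simp add: K_def)
    qed simp
    then have finK: "finite K" by (meson finite_nat_set_iff_bounded_le)
    define k where "k = Max K"
    have k0K: "k0 \<in> K" using N by (simp add: K_def)
    then have kK: "k \<in> K" unfolding k_def using finK by (intro Max_in) auto
    have kk0: "k0 \<le> k" unfolding k_def by (rule Max_ge[OF finK k0K])
    have "Suc k \<notin> K" using Max_ge[OF finK, of "Suc k"] by (auto simp: k_def)
    then have Nlt: "N < M * (R k * win_end R k)" by (simp add: K_def win_start_Suc del: win_start.simps)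
    have Nge: "M * win_start R k \<le> N" using kK by (simp add: K_def)
    show ?thesis
    proof (cases "N \<le> win_end R k")
      case True
      have "1 * 1 \<le> M * R k" using M R1[of k] by (intro mult_le_mono)
      moreover have "1 * 1 \<le> N" using Nge mult_le_mono[OF M win_start_pos[of k]] by linarith
      ultimately show ?thesis using True Nge by (intro exI[of _ 1] exI[of _ k]) auto
    next
      case False
      \<comment> \<open>With one part more than the quotient no part is longer than
        \<open>win_end R k\<close>. Since \<open>win_end R k < N\<close>, still
        \<open>i * win_end R k \<le> 2 * N\<close>, so the parts are not much shorter than half of
        it.\<close>
      define i where "i = N div win_end R k + 1"
      have bpos: "0 < win_end R k" using win_start_pos[of k] by (simp add: win_end_def)
      have "N div win_end R k < M * R k" using Nlt bpos by (simp add: div_less_iff_less_mult mult.assoc)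
      then have iMR: "i \<le> M * R k" by (simp add: i_def)
      have k3: "(M * R0) * (M * R0) \<le> Suc k" "2 * M \<le> Suc k" using kk0 by (auto simp: k0_def)
      have "(M * R k) * (M * R k) \<le> (M * (R0 * Suc k)) * (M * (R0 * Suc k))"
        using R0[of k] by (intro mult_le_mono) auto
      also have "\<dots> = ((M * R0) * (M * R0)) * (Suc k * Suc k)" by (simp only: mult_ac)
      also have "\<dots> \<le> Suc k * (Suc k * Suc k)" using k3(1) by (rule mult_le_mono1)
      also have "\<dots> = 1 * Suc k ^ 3" by (simp only: power3_eq_cube mult_ac mult_1)
      also have "\<dots> \<le> win_end R k" unfolding win_end_def by (rule mult_le_mono1[OF win_start_pos])
      finally have MR: "(M * R k) * (M * R k) \<le> win_end R k" .
      have ii: "i * i \<le> N" using mult_le_mono[OF iMR iMR] MR False by linarith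
      have ib: "N < i * win_end R k"
        using bpos unfolding i_def by (metis dividend_less_div_times add.commute mult.commute add_mult_distrib mult_1 )
      have up: "N div i \<le> win_end R k" using ib by (simp add: div_less_iff_less_mult i_def less_imp_le mult.commute)
      have "i * win_end R k \<le> 2 * N"
      proof -
        have "N div win_end R k * win_end R k \<le> N" by simp
        then show ?thesis using False unfolding i_def add_mult_distrib mult_1 by linarith
      qed
      moreover have "2 * M * win_start R k \<le> win_end R k"
      proof -
        have "2 * M \<le> Suc k ^ 3" using k3(2) self_le_power[of "Suc k" 3] by linarith
        then show ?thesis unfolding win_end_def by (simp add: mult.commute mult_le_mono)
      qed
      then have "i * (2 * M * win_start R k) \<le> i * win_end R k" by (rule mult_le_mono2)
      ultimately have "2 * (i * (M * win_start R k)) \<le> 2 * N" by (simp only: mult_ac)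
      then have "i * (M * win_start R k) \<le> N" by simp
      then have "M * win_start R k \<le> N div i" by (simp add: less_eq_div_iff_mult_less_eq i_def mult.commute)
      then show ?thesis using iMR ii up by (intro exI[of _ i] exI[of _ k]) (auto simp: i_def)
    qed
  qed
  then show ?thesis using that by blast
qed

text \<open>\<open>M \<ge> 4 / \<theta>\<close> bounds the digits before the window by
  \<open>\<theta> * l / 4\<close>. Three prefixes and a factor 2 for the rounding give 6, within the
  8 of \<open>spread_at\<close>.\<close>

lemma spread_at_window:
  assumes s: "0 \<le> s" "s \<le> 1" and l: "M * win_start R k \<le> l" "l \<le> win_end R k" and M: "4 / \<theta> \<le> real M" and \<theta>: "0 < \<theta>"
  shows "spread_at coins (slope (window_set s R)) s l (\<theta> * real l / 4)"
  unfolding spread_at_def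
proof (intro allI impI)
  fix m c assume m: "m \<le> l"
  let ?S = "window_set s R"
  have "s * real m - s * real (win_start R k) - 1 \<le> real (free_count ?S m)"
    using free_count_window_set_ge[OF s, of m k] m l(2) by (simp add: right_diff_distrib)
  moreover have "s * real (win_start R k) \<le> \<theta> * real l / 4"
  proof -
    have "4 / \<theta> * real (win_start R k) \<le> real M * real (win_start R k)" using M by (intro mult_right_mono) auto
    also have "\<dots> \<le> real l" using l(1) by (simp only: of_nat_le_iff flip: of_nat_mult)
    finally have "real (win_start R k) \<le> \<theta> * real l / 4" using \<theta> by (simp add: field_simps)
    moreover have "s * real (win_start R k) \<le> 1 * real (win_start R k)" using s by (intro mult_right_mono) auto
    ultimately show ?thesis by linarith
  qed
  ultimately have e: "- real (free_count ?S m) \<le> 1 + (\<theta> * real l / 4 - s * real m)" by linarith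
  have "measure coins {\<omega> \<in> space coins. c \<le> slope ?S \<omega> \<and> slope ?S \<omega> \<le> c + 2 powr - real m} \<le> 3 * (1/2) ^ free_count ?S m"
    by (rule prob_slope_in_interval)
  also have "(1/2) ^ free_count ?S m = (2::real) powr - real (free_count ?S m)"
    by (simp add: powr_minus powr_realpow power_one_over inverse_eq_divide)
  also have "3 * \<dots> \<le> 3 * 2 powr (1 + (\<theta> * real l / 4 - s * real m))" using e by (intro mult_left_mono powr_mono) auto
  also have "\<dots> = 6 * 2 powr (\<theta> * real l / 4 - s * real m)" by (simp only: powr_add) simp
  also have "\<dots> \<le> 8 * 2 powr (\<theta> * real l / 4 - s * real m)" by (intro mult_right_mono) auto
  finally show "measure coins {\<omega> \<in> space coins. c \<le> slope ?S \<omega> \<and> slope ?S \<omega> \<le> c + 2 powr - real m} \<le> 8 * 2 powr (\<theta> * real l / 4 - s * real m)" .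
qed

end

section \<open>Covering numbers and packing dimension of sets of directions\<close>

lemma dist_normalize_le:
  fixes v w :: "'a::real_normed_vector"
  assumes "1 \<le> norm v" "1 \<le> norm w"
  shows "dist ((1 / norm v) *\<^sub>R v) ((1 / norm w) *\<^sub>R w) \<le> 2 * dist v w"
proof -
  have "(1 / norm v) *\<^sub>R v - (1 / norm w) *\<^sub>R w = (1 / norm v) *\<^sub>R (v - w) + (1 / norm v - 1 / norm w) *\<^sub>R w"
    by (simp add: algebra_simps)
  then have "dist ((1 / norm v) *\<^sub>R v) ((1 / norm w) *\<^sub>R w) \<le> norm ((1 / norm v) *\<^sub>R (v - w)) + norm ((1 / norm v - 1 / norm w) *\<^sub>R w)"
    unfolding dist_norm by (simp only: norm_triangle_ineq)
  also have "norm ((1 / norm v) *\<^sub>R (v - w)) \<le> norm (v - w)"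
  proof -
    have "0 < norm v" using assms by linarith
    then have "\<bar>1 / norm v\<bar> \<le> 1" using assms by (simp add: divide_le_eq)
    then show ?thesis unfolding norm_scaleR by (intro mult_left_le_one_le) auto
  qed
  also have "norm ((1 / norm v - 1 / norm w) *\<^sub>R w) = \<bar>norm w - norm v\<bar> / norm v"
  proof -
    have nz: "norm v \<noteq> 0" "norm w \<noteq> 0" using assms by linarith+
    have "1 / norm v - 1 / norm w = (norm w - norm v) / (norm v * norm w)" 
      using nz by (subst diff_frac_eq) simp_all
    then show ?thesis using nz by (simp add: abs_mult)
  qed
  also have "\<dots> \<le> \<bar>norm w - norm v\<bar>"
  proof -
    have "0 < norm v" using assms by linarith
    moreover have "\<bar>norm w - norm v\<bar> * 1 \<le> \<bar>norm w - norm v\<bar> * norm v" using assms by (intro mult_left_mono) auto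
    ultimately show ?thesis by (simp add: pos_divide_le_eq)
  qed
  also have "\<dots> \<le> norm (v - w)" using norm_triangle_ineq3[of w v] by (simp add: norm_minus_commute)
  finally show ?thesis by (simp add: dist_norm)
qed

lemma dist_direction_le: "dist (direction x) (direction y) \<le> 2 * \<bar>x - y\<bar>"
proof -
  define v :: "real \<Rightarrow> real^2" where "v = (\<lambda>x. \<chi> i. if i = 1 then 1 else x)"
  have n: "norm (v x) = sqrt (1 + x\<^sup>2)" for x by (simp add: v_def norm_vec_def L2_set_def sum_2)
  have n1: "1 \<le> norm (v x)" for x by (simp add: n)
  have d: "direction x = (1 / norm (v x)) *\<^sub>R v x" for x by (simp add: direction_def n) (simp add: v_def)
  have "dist (v x) (v y) = \<bar>x - y\<bar>"
    by (simp add: v_def dist_norm norm_vec_def L2_set_def sum_2)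
  then show ?thesis using dist_normalize_le[OF n1 n1, of x y] by (simp add: d)
qed

text \<open>The determinant of the two unit vectors is \<open>(x - y) / (?s * ?t)\<close> up to
  sign. It is at most twice their distance, and \<open>?s * ?t \<le> 2\<close>.\<close>

lemma dist_direction_ge:
  assumes "0 \<le> x" "x \<le> 1" "0 \<le> y" "y \<le> 1"
  shows "\<bar>x - y\<bar> / 4 \<le> dist (direction x) (direction y)"
proof -
  let ?s = "sqrt (1 + x\<^sup>2)" and ?t = "sqrt (1 + y\<^sup>2)"
  have sq: "x\<^sup>2 \<le> 1" "y\<^sup>2 \<le> 1" using assms by (simp_all add: power_le_one)
  have st: "1 \<le> ?s" "1 \<le> ?t" by auto
  have "?s * ?t = sqrt ((1 + x\<^sup>2) * (1 + y\<^sup>2))" by (simp add: real_sqrt_mult)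
  also have "\<dots> \<le> sqrt (2 * 2)" using sq by (intro real_sqrt_le_mono mult_mono) auto
  finally have st2: "?s * ?t \<le> 2" by simp
  have c: "direction x $ 1 = 1 / ?s" "direction x $ 2 = x / ?s" "direction y $ 1 = 1 / ?t" "direction y $ 2 = y / ?t"
    by (simp_all add: direction_def)
  let ?d = "dist (direction x) (direction y)"
  have d: "\<bar>direction x $ i - direction y $ i\<bar> \<le> ?d" for i
    using component_le_norm_cart[of "direction x - direction y" i] by (simp add: dist_norm)
  have "(x - y) / (?s * ?t) = direction x $ 2 * direction y $ 1 - direction x $ 1 * direction y $ 2"
    by (simp add: c diff_divide_distrib)
  also have "\<dots> = (direction x $ 2 - direction y $ 2) * (1 / ?t) - (direction x $ 1 - direction y $ 1) * (y / ?t)"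
    unfolding c by (simp add: algebra_simps)
  finally have "\<bar>x - y\<bar> / (?s * ?t) \<le> \<bar>(direction x $ 2 - direction y $ 2) * (1 / ?t)\<bar> + \<bar>(direction x $ 1 - direction y $ 1) * (y / ?t)\<bar>"
  proof -
    assume eq: "(x - y) / (?s * ?t) = (direction x $ 2 - direction y $ 2) * (1 / ?t) - (direction x $ 1 - direction y $ 1) * (y / ?t)"
    have "\<bar>x - y\<bar> / (?s * ?t) = \<bar>(x - y) / (?s * ?t)\<bar>" using st by (simp add: abs_mult)
    also have "\<dots> \<le> \<bar>(direction x $ 2 - direction y $ 2) * (1 / ?t)\<bar> + \<bar>(direction x $ 1 - direction y $ 1) * (y / ?t)\<bar>"
      unfolding eq by (rule abs_triangle_ineq4)
    finally show ?thesis .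
  qed
  also have "\<dots> \<le> ?d * 1 + ?d * 1"
  proof -
    have t: "0 < ?t" using st by linarith
    have "y \<le> ?t" using st assms by linarith
    then have "1 / ?t \<le> 1" "y / ?t \<le> 1" using st by (simp_all only: pos_divide_le_eq[OF t] mult_1)
    moreover have "0 \<le> 1 / ?t" "0 \<le> y / ?t" using t assms by (simp_all only: zero_le_divide_iff) auto
    ultimately have "\<bar>1 / ?t\<bar> \<le> 1" "\<bar>y / ?t\<bar> \<le> 1" by (simp_all only: abs_of_nonneg)
    then show ?thesis unfolding abs_mult using d by (intro add_mono mult_mono) auto
  qed
  finally have "\<bar>x - y\<bar> / (?s * ?t) \<le> 2 * ?d" by (simp only: mult_1_right mult_2)
  moreover have "0 < ?s * ?t" using st by (intro mult_pos_pos) linarith+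
  ultimately have "\<bar>x - y\<bar> \<le> 2 * ?d * (?s * ?t)" by (simp only: pos_divide_le_eq)
  also have "\<dots> \<le> 2 * ?d * 2" using st2 by (intro mult_left_mono) auto
  finally show ?thesis by simp
qed

section \<open>Direction sets described by digit prefixes\<close>

definition direction_set :: "nat set \<Rightarrow> (nat \<Rightarrow> bool) set \<Rightarrow> (real^2) set" where
  "direction_set S W = (\<lambda>\<omega>. direction (slope S \<omega>)) ` W"

lemma direction_set_subset_sphere: "direction_set S W \<subseteq> sphere 0 1"
  by (auto simp: direction_set_def)

lemma abs_slope_diff_le:
  assumes "digit_prefix S m \<omega> = digit_prefix S m \<omega>'"
  shows "\<bar>slope S \<omega> - slope S \<omega>'\<bar> \<le> 2 powr - real m"
proof -
  have "\<bar>slope S \<omega> - slope S \<omega>'\<bar> \<le> 1 / 2 ^ m"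
    using slope_bounds[where S = S and m = m and \<omega> = \<omega>] slope_bounds[where S = S and m = m and \<omega> = \<omega>'] assms
    by (simp add: add_divide_distrib abs_le_iff)
  then show ?thesis by (simp add: powr_minus powr_realpow inverse_eq_divide)
qed

lemma dist_direction_slope_le:
  assumes "digit_prefix S m \<omega> = digit_prefix S m \<omega>'"
  shows "dist (direction (slope S \<omega>)) (direction (slope S \<omega>')) \<le> 2 * 2 powr - real m"
  by (rule order_trans[OF dist_direction_le mult_left_mono[OF abs_slope_diff_le[OF assms]]]) simp

lemma dist_direction_slope_ge:
  "\<bar>slope S \<omega> - slope S \<omega>'\<bar> / 4 \<le> dist (direction (slope S \<omega>)) (direction (slope S \<omega>'))"
  by (intro dist_direction_ge slope_nonneg slope_le_1)

lemma direction_set_cover: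
  obtains F where "finite F" "card F \<le> 2 ^ free_count S m" "direction_set S W \<subseteq> \<Union>F"
    "\<And>U. U \<in> F \<Longrightarrow> bounded U \<and> diameter U \<le> 2 * 2 powr - real m"
proof -
  define F where "F = (\<lambda>v. (\<lambda>\<omega>. direction (slope S \<omega>)) ` {\<omega>. digit_prefix S m \<omega> = v}) ` range (digit_prefix S m)"
  have f: "finite F" unfolding F_def by (intro finite_imageI finite_range_prefix)
  have "card F \<le> 2 ^ free_count S m"
    unfolding F_def card_range_prefix[symmetric] by (rule card_image_le[OF finite_range_prefix])
  moreover have "direction_set S W \<subseteq> \<Union>F" by (auto simp: direction_set_def F_def)
  moreover have "bounded U \<and> diameter U \<le> 2 * 2 powr - real m" if "U \<in> F" for U
  proof
    from that obtain v where U: "U = (\<lambda>\<omega>. direction (slope S \<omega>)) ` {\<omega>. digit_prefix S m \<omega> = v}" by (auto simp: F_def)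
    have "U \<subseteq> sphere 0 1" unfolding U by auto
    then show "bounded U" using bounded_sphere bounded_subset by blast
    show "diameter U \<le> 2 * 2 powr - real m"
    proof (rule diameter_le)
      fix x y assume "x \<in> U" "y \<in> U"
      then obtain \<omega> \<omega>' where "x = direction (slope S \<omega>)" "y = direction (slope S \<omega>')" "digit_prefix S m \<omega> = digit_prefix S m \<omega>'"
        unfolding U by auto
      then show "norm (x - y) \<le> 2 * 2 powr - real m" using dist_direction_slope_le by (simp add: dist_norm)
    qed simp
  qed
  ultimately show ?thesis using that f by blast
qed

lemma card_separated_direction_set_le:
  assumes "finite Q" "Q \<subseteq> direction_set S W" "\<And>x y. x \<in> Q \<Longrightarrow> y \<in> Q \<Longrightarrow> x \<noteq> y \<Longrightarrow> 2 * 2 powr - real m < dist x y"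
  shows "card Q \<le> 2 ^ free_count S m"
proof -
  have "\<exists>\<omega>. x = direction (slope S \<omega>)" if "x \<in> Q" for x using assms(2) that by (auto simp: direction_set_def)
  then obtain w where w: "\<And>x. x \<in> Q \<Longrightarrow> x = direction (slope S (w x))" by metis
  have "inj_on (\<lambda>x. digit_prefix S m (w x)) Q"
  proof (rule inj_onI, rule ccontr)
    fix x y assume xy: "x \<in> Q" "y \<in> Q" "digit_prefix S m (w x) = digit_prefix S m (w y)" "x \<noteq> y"
    have "dist x y \<le> 2 * 2 powr - real m" using dist_direction_slope_le[OF xy(3)] w[OF xy(1)] w[OF xy(2)] by metis
    then show False using assms(3)[OF xy(1,2,4)] by simp
  qed
  then have "card Q \<le> card (range (digit_prefix S m))"
    by (rule card_inj_on_le) (auto intro: finite_range_prefix)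
  then show ?thesis by (simp add: card_range_prefix)
qed

lemma slope_eq_prefix_if_support:
  assumes "\<And>i. m \<le> i \<Longrightarrow> \<not> \<omega> i"
  shows "slope S \<omega> = real (digit_prefix S m \<omega>) / 2 ^ m"
proof -
  have "slope S \<omega> = (\<Sum>i<m. real (digit S \<omega> i) * (1/2) ^ Suc i)"
    unfolding slope_def by (rule suminf_finite) (use assms in \<open>auto simp: digit_def\<close>)
  then show ?thesis by (simp only: sum_digits_eq_prefix)
qed

text \<open>A finitely supported digit sequence has slope exactly
  \<open>digit_prefix / 2 ^ m\<close>, so distinct prefixes are \<open>2 ^ -m\<close> apart. A
  countable set of directions thus already has the full box counts, while it is invisible to packing
  measures of positive exponent.\<close>

lemma exists_separated_directions:
  obtains Q where "finite Q" "card Q = 2 ^ free_count S m" "Q \<subseteq> direction_set S {\<omega>. finite {i. \<omega> i}}"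
    "\<And>x y. x \<in> Q \<Longrightarrow> y \<in> Q \<Longrightarrow> x \<noteq> y \<Longrightarrow> 2 powr - real m / 4 \<le> dist x y"
proof -
  let ?P = "Pow (S \<inter> {..<m})"
  let ?d = "\<lambda>A. direction (slope S (\<lambda>i. i \<in> A))"
  have sep: "2 powr - real m / 4 \<le> dist (?d A) (?d B)" if AB: "A \<in> ?P" "B \<in> ?P" "A \<noteq> B" for A B
  proof -
    let ?p = "\<lambda>A. digit_prefix S m (\<lambda>i. i \<in> A)"
    have "?p A \<noteq> ?p B"
    proof
      assume "?p A = ?p B"
      then have "i \<in> A \<longleftrightarrow> i \<in> B" if "i \<in> S" "i < m" for i using prefix_eqD[of S m] that by blast
      then show False using AB by blast
    qed
    then have "1 \<le> \<bar>real (?p A) - real (?p B)\<bar>" by linarith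
    then have "1 / 2 ^ m \<le> \<bar>real (?p A) - real (?p B)\<bar> / 2 ^ m" by (intro divide_right_mono) auto
    also have "\<dots> = \<bar>slope S (\<lambda>i. i \<in> A) - slope S (\<lambda>i. i \<in> B)\<bar>"
    proof -
      have "slope S (\<lambda>i. i \<in> A) = real (?p A) / 2 ^ m" "slope S (\<lambda>i. i \<in> B) = real (?p B) / 2 ^ m"
        using AB by (auto intro!: slope_eq_prefix_if_support)
      then show ?thesis by (simp add: diff_divide_distrib[symmetric])
    qed
    finally have "1 / 2 ^ m / 4 \<le> \<bar>slope S (\<lambda>i. i \<in> A) - slope S (\<lambda>i. i \<in> B)\<bar> / 4" by (rule divide_right_mono) simp
    also have "\<dots> \<le> dist (?d A) (?d B)" by (rule dist_direction_slope_ge)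
    finally have "1 / 2 ^ m / 4 \<le> dist (?d A) (?d B)" .
    then show ?thesis by (simp add: powr_minus powr_realpow inverse_eq_divide)
  qed
  have inj: "inj_on ?d ?P"
  proof (rule inj_onI, rule ccontr)
    fix A B assume "A \<in> ?P" "B \<in> ?P" "?d A = ?d B" "A \<noteq> B"
    then have "(2::real) powr - real m / 4 \<le> 0" using sep[of A B] by simp
    moreover have "0 < (2::real) powr - real m" by simp
    ultimately show False by linarith
  qed
  have "card (?d ` ?P) = 2 ^ free_count S m"
    unfolding free_count_def by (simp only: card_image[OF inj] card_Pow[OF finite_Int[OF disjI2[OF finite_lessThan]]])
  moreover have "?d ` ?P \<subseteq> direction_set S {\<omega>. finite {i. \<omega> i}}"
  proof (rule image_subsetI)
    fix A assume "A \<in> ?P"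
    then have "finite A" by (meson PowD finite_Int finite_lessThan finite_subset)
    then show "?d A \<in> direction_set S {\<omega>. finite {i. \<omega> i}}" unfolding direction_set_def by (intro imageI) simp
  qed
  moreover have "finite (?d ` ?P)" by simp
  ultimately show ?thesis using that[of "?d ` ?P"] sep by blast
qed

lemma countable_direction_set_finite: "countable (direction_set S {\<omega>. finite {i. \<omega> i}})"
proof -
  have "{\<omega> :: nat \<Rightarrow> bool. finite {i. \<omega> i}} = (\<lambda>A i. i \<in> A) ` {A. finite A}"
  proof (intro equalityI subsetI)
    fix \<omega> :: "nat \<Rightarrow> bool" assume "\<omega> \<in> {\<omega>. finite {i. \<omega> i}}"
    then show "\<omega> \<in> (\<lambda>A i. i \<in> A) ` {A. finite A}" by (intro image_eqI[of _ _ "{i. \<omega> i}"]) auto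
  qed auto
  then show ?thesis unfolding direction_set_def
    using countable_Collect_finite[where 'a = nat] by (metis countable_image)
qed

section \<open>Covering numbers and separated counts\<close>

lemma covering_number_le_card:
  assumes "finite F" "E \<subseteq> \<Union>F" "\<And>U. U \<in> F \<Longrightarrow> bounded U \<and> diameter U \<le> \<delta>"
  shows "covering_number \<delta> E \<le> card F"
  unfolding covering_number_def by (rule Least_le) (use assms in blast)

text \<open>The \<open>LEAST\<close> in \<open>covering_number\<close> is meaningful only if some
  admissible finite cover exists, which \<open>F\<close> certifies; its size is irrelevant.\<close>

lemma card_le_covering_number:
  assumes F: "finite F" "E \<subseteq> \<Union>F" "\<And>U. U \<in> F \<Longrightarrow> bounded U \<and> diameter U \<le> \<delta>"
    and Q: "Q \<subseteq> E" "\<And>x y. x \<in> Q \<Longrightarrow> y \<in> Q \<Longrightarrow> x \<noteq> y \<Longrightarrow> \<delta> < dist x y"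
  shows "card Q \<le> covering_number \<delta> E"
proof -
  let ?P = "\<lambda>n. \<exists>F. finite F \<and> card F = n \<and> E \<subseteq> \<Union>F \<and> (\<forall>U\<in>F. bounded U \<and> diameter U \<le> \<delta>)"
  have "?P (covering_number \<delta> E)"
    unfolding covering_number_def by (rule LeastI[of ?P "card F"]) (use F in blast)
  then obtain G where G: "finite G" "card G = covering_number \<delta> E" "E \<subseteq> \<Union>G" "\<And>U. U \<in> G \<Longrightarrow> bounded U \<and> diameter U \<le> \<delta>"
    by blast
  have "\<exists>U\<in>G. x \<in> U" if "x \<in> Q" for x using that Q(1) G(3) by blast
  then obtain g where g: "\<And>x. x \<in> Q \<Longrightarrow> g x \<in> G \<and> x \<in> g x" by metis
  have "inj_on g Q"
  proof (rule inj_onI, rule ccontr)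
    fix x y assume xy: "x \<in> Q" "y \<in> Q" "g x = g y" "x \<noteq> y"
    have "dist x y \<le> diameter (g x)" using G(4) g[OF xy(1)] g[OF xy(2)] xy(3) by (intro diameter_bounded_bound) auto
    then show False using Q(2)[OF xy(1,2,4)] G(4) g[OF xy(1)] by fastforce
  qed
  then have "card Q \<le> card G" using g G(1) by (intro card_inj_on_le[of g]) auto
  then show ?thesis using G(2) by simp
qed

text \<open>The balls of a packing are sorted by dyadic radius. Those of radius about
  \<open>2 ^ -N\<close> have separated centres, so there are at most about
  \<open>2 powr (N * v)\<close> of them, and their weights decay like
  \<open>2 powr (N * (v - u))\<close>. Small \<open>\<delta>\<close> leaves only a tail of this
  geometric series.\<close>

lemma packing_premeasure_eq_0_if_separated_counts:
  fixes A :: "'a::euclidean_space set"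
  assumes K: "0 \<le> K" and vu: "v < u" "0 \<le> u"
    and count: "\<And>m F. finite F \<Longrightarrow> F \<subseteq> A \<Longrightarrow> separated (2 powr - real m) F \<Longrightarrow> real (card F) \<le> K * 2 powr (real m * v)"
  shows "packing_premeasure u A = 0"
proof -
  define g where "g = (\<lambda>N. K * 2 powr (real (Suc N) * v) * (2 * 2 powr - real N) powr u)"
  have g_eq: "g N = K * 2 powr (v + u) * (2 powr (v - u)) ^ N" for N
  proof -
    have "(2 * 2 powr - real N) powr u = 2 powr u * 2 powr - (real N * u)" by (simp add: powr_mult powr_powr)
    then have "g N = K * (2 powr (real (Suc N) * v) * (2 powr u * 2 powr - (real N * u)))" by (simp add: g_def)
    also have "2 powr (real (Suc N) * v) * (2 powr u * 2 powr - (real N * u)) = 2 powr (real (Suc N) * v + (u + - (real N * u)))"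
      by (simp only: powr_add)
    also have "real (Suc N) * v + (u + - (real N * u)) = (v + u) + real N * (v - u)" by (simp add: algebra_simps)
    also have "2 powr ((v + u) + real N * (v - u)) = 2 powr (v + u) * (2 powr (v - u)) ^ N"
      by (simp add: powr_add powr_powr powr_realpow[symmetric] mult.commute)
    finally show ?thesis by (simp only: mult.assoc)
  qed
  have "summable (\<lambda>N. (2 powr (v - u)) ^ N)" using vu by (intro summable_geometric) (simp add: powr_less_one)
  then have sg: "summable g" unfolding g_eq[abs_def] by (rule summable_mult)
  have g0: "0 \<le> g N" for N using K by (simp add: g_def)
  have "packing_premeasure u A \<le> 0"
  proof (rule ennreal_le_epsilon)
    fix e :: real assume e: "0 < e"
    obtain m0 where m0: "norm (\<Sum>i. g (i + m0)) < e" using suminf_exist_split[OF e sg] by blast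
    define \<delta> :: real where "\<delta> = 2 powr - real m0"
    have "(\<Sum>\<^sub>\<infinity>(x, r)\<in>P. ennreal ((2 * r) powr u)) \<le> ennreal e" if P: "P \<in> packings \<delta> A" for P
    proof (subst nonneg_infsum_complete, simp, rule SUP_least)
      fix Q assume "Q \<in> {F. finite F \<and> F \<subseteq> P}"
      then have Q: "finite Q" "Q \<subseteq> P" by auto
      have PA: "P \<subseteq> A \<times> {0<..\<delta>}" and dis: "disjoint_family_on (\<lambda>(x, r). cball x r) P" using P by (auto simp: packings_def)
      have d1: "\<delta> \<le> 1" unfolding \<delta>_def using powr_mono[of "- real m0" 0 2] by simp
      have "\<exists>N. 2 powr - real (Suc N) < r \<and> r \<le> 2 powr - real N" if "0 < r" "r \<le> \<delta>" for r
        using two_powr_scale[of r] that d1 by (metis order_trans)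
      then obtain lev where lev: "\<And>r. 0 < r \<Longrightarrow> r \<le> \<delta> \<Longrightarrow> 2 powr - real (Suc (lev r)) < r \<and> r \<le> 2 powr - real (lev r)"
        by metis
      have rQ: "0 < snd p" "snd p \<le> \<delta>" "fst p \<in> A" if "p \<in> Q" for p using that Q PA by auto
      have levm: "m0 \<le> lev (snd p)" if "p \<in> Q" for p
      proof (rule ccontr)
        assume "\<not> m0 \<le> lev (snd p)"
        then have "(2::real) powr - real m0 \<le> 2 powr - real (Suc (lev (snd p)))" by (intro powr_mono) auto
        also have "\<dots> < snd p" using lev rQ[OF that] by blast
        finally show False using rQ(2)[OF that] unfolding \<delta>_def by linarith
      qed
      let ?L = "(\<lambda>p. lev (snd p)) ` Q"
      let ?Q = "\<lambda>N. {p \<in> Q. lev (snd p) = N}"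
      have one: "(\<Sum>p\<in>?Q N. (2 * snd p) powr u) \<le> g N" for N
      proof -
        \<comment> \<open>The centre of one ball lies outside the other ball, so the distance
          exceeds that ball's radius and hence \<open>2 powr - real (Suc N)\<close>.\<close>
        have apart: "2 powr - real (Suc N) \<le> dist (fst p) (fst q)" if pq: "p \<in> ?Q N" "q \<in> ?Q N" "p \<noteq> q" for p q
        proof -
          have "cball (fst p) (snd p) \<inter> cball (fst q) (snd q) = {}"
            using dis pq Q unfolding disjoint_family_on_def by (force simp: case_prod_beta)
          moreover have "fst q \<in> cball (fst q) (snd q)" using rQ[of q] pq by auto
          ultimately have "fst q \<notin> cball (fst p) (snd p)" by blast
          then have "snd p < dist (fst p) (fst q)" by simp
          moreover have "p \<in> Q" "lev (snd p) = N" using pq by auto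
          then have "2 powr - real (Suc N) < snd p" using lev[OF rQ(1,2)] by blast
          ultimately show ?thesis by linarith
        qed
        have inj: "inj_on fst (?Q N)"
        proof (rule inj_onI, rule ccontr)
          fix p q assume "p \<in> ?Q N" "q \<in> ?Q N" "fst p = fst q" "p \<noteq> q"
          then have "(2::real) powr - real (Suc N) \<le> 0" using apart[of p q] by simp
          moreover have "0 < (2::real) powr - real (Suc N)" by (simp only: powr_gt_zero)
          ultimately show False by linarith
        qed
        have "real (card (fst ` ?Q N)) \<le> K * 2 powr (real (Suc N) * v)"
        proof (rule count)
          show "separated (2 powr - real (Suc N)) (fst ` ?Q N)"
            unfolding separated_def
          proof (intro ballI impI)
            fix y z assume "y \<in> fst ` ?Q N" "z \<in> fst ` ?Q N" "y \<noteq> z"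
            then obtain p q where "p \<in> ?Q N" "q \<in> ?Q N" "y = fst p" "z = fst q" "p \<noteq> q" by blast
            then show "2 powr - real (Suc N) \<le> dist y z" using apart by blast
          qed
        qed (use Q rQ in auto)
        then have c: "real (card (?Q N)) \<le> K * 2 powr (real (Suc N) * v)" by (simp add: card_image[OF inj])
        have "(\<Sum>p\<in>?Q N. (2 * snd p) powr u) \<le> (\<Sum>p\<in>?Q N. (2 * 2 powr - real N) powr u)"
          using lev rQ vu by (intro sum_mono powr_mono2) (auto simp: less_imp_le)
        also have "\<dots> = real (card (?Q N)) * (2 * 2 powr - real N) powr u" by simp
        also have "\<dots> \<le> g N" unfolding g_def by (intro mult_right_mono c) auto
        finally show ?thesis .
      qed
      have "(\<Sum>p\<in>Q. (2 * snd p) powr u) = (\<Sum>N\<in>?L. \<Sum>p\<in>?Q N. (2 * snd p) powr u)"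
        by (rule sum.image_gen[OF Q(1)])
      also have "\<dots> \<le> (\<Sum>N\<in>?L. g N)" by (intro sum_mono one)
      also have "\<dots> \<le> (\<Sum>i. g (i + m0))"
      proof -
        have im: "?L = (\<lambda>i. i + m0) ` ((\<lambda>N. N - m0) ` ?L)"
          using levm by (force simp: image_image)
        have "(\<Sum>N\<in>?L. g N) = (\<Sum>i\<in>(\<lambda>N. N - m0) ` ?L. g (i + m0))"
          by (subst im, subst sum.reindex) (auto simp: inj_on_def)
        also have "\<dots> \<le> (\<Sum>i. g (i + m0))"
          using sg Q(1) g0 by (intro sum_le_suminf) (auto simp: summable_iff_shift)
        finally show ?thesis .
      qed
      also have "\<dots> \<le> e" using m0 by simp
      finally have "ennreal (\<Sum>p\<in>Q. (2 * snd p) powr u) \<le> ennreal e" by (rule ennreal_leI)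
      moreover have "(\<Sum>(x, r)\<in>Q. ennreal ((2 * r) powr u)) = ennreal (\<Sum>p\<in>Q. (2 * snd p) powr u)"
        by (simp add: case_prod_beta)
      ultimately show "(\<Sum>(x, r)\<in>Q. ennreal ((2 * r) powr u)) \<le> ennreal e" by simp
    qed
    then have "(SUP P \<in> packings \<delta> A. \<Sum>\<^sub>\<infinity>(x, r)\<in>P. ennreal ((2 * r) powr u)) \<le> ennreal e" by (rule SUP_least)
    moreover have "packing_premeasure u A \<le> (SUP P \<in> packings \<delta> A. \<Sum>\<^sub>\<infinity>(x, r)\<in>P. ennreal ((2 * r) powr u))"
      unfolding packing_premeasure_def by (rule INF_lower) (simp add: \<delta>_def)
    ultimately show "packing_premeasure u A \<le> 0 + ennreal e" by simp
  qed
  then show ?thesis by simp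
qed

text \<open>The two parts of the union have separate tasks: the countable one bounds the covering
  number from below at every scale, and the random one is cheap to cover along the scales given by
  \<open>A\<close>, where few digits are free.\<close>

lemma lower_box_dim_direction_set:
  fixes A :: "nat \<Rightarrow> nat"
  assumes \<epsilon>: "0 \<le> \<epsilon>" "\<epsilon> \<le> 1" and A: "filterlim A at_top sequentially"
    and S: "\<And>\<gamma>. \<epsilon> < \<gamma> \<Longrightarrow> eventually (\<lambda>k. real (free_count S (A k)) \<le> \<gamma> * real (A k)) sequentially"
  shows "lower_box_dim (direction_set S UNIV \<union> direction_set (density_set \<epsilon>) {\<omega>. finite {i. \<omega> i}}) = ereal \<epsilon>"
    (is "lower_box_dim ?D = _")
proof -
  let ?f = "\<lambda>\<delta>. ln (real (covering_number \<delta> ?D)) / (- ln \<delta>)"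
  let ?S' = "density_set \<epsilon>"
  have cover: "\<exists>F. finite F \<and> card F \<le> 2 ^ free_count S m + 2 ^ free_count ?S' m \<and> ?D \<subseteq> \<Union>F \<and> (\<forall>U\<in>F. bounded U \<and> diameter U \<le> 2 * 2 powr - real m)" for m
  proof -
    obtain F1 where F1: "finite F1" "card F1 \<le> 2 ^ free_count S m" "direction_set S UNIV \<subseteq> \<Union>F1"
      "\<And>U. U \<in> F1 \<Longrightarrow> bounded U \<and> diameter U \<le> 2 * 2 powr - real m"
      using direction_set_cover[of S m UNIV] by blast
    obtain F2 where F2: "finite F2" "card F2 \<le> 2 ^ free_count ?S' m" "direction_set ?S' {\<omega>. finite {i. \<omega> i}} \<subseteq> \<Union>F2"
      "\<And>U. U \<in> F2 \<Longrightarrow> bounded U \<and> diameter U \<le> 2 * 2 powr - real m"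
      using direction_set_cover[of ?S' m "{\<omega>. finite {i. \<omega> i}}"] by blast
    have "card (F1 \<union> F2) \<le> 2 ^ free_count S m + 2 ^ free_count ?S' m"
      using card_Un_le[of F1 F2] F1(2) F2(2) by linarith
    moreover have "?D \<subseteq> \<Union>(F1 \<union> F2)" using F1(3) F2(3) by blast
    ultimately show ?thesis using F1 F2 by (intro exI[of _ "F1 \<union> F2"]) blast
  qed
  have lower: "\<epsilon> - 5 / (- log 2 \<delta>) \<le> ?f \<delta>" if \<delta>: "0 < \<delta>" "\<delta> < 1/8" for \<delta>
  proof -
    define L where "L = - log 2 \<delta>"
    have L: "0 < L" using \<delta> by (simp add: L_def)
    have "0 < 4 * \<delta>" "4 * \<delta> \<le> 1" using \<delta> by auto
    then obtain N where N: "2 powr - real (Suc N) < 4 * \<delta>" "4 * \<delta> \<le> 2 powr - real N"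
      using two_powr_scale by blast
    have "N \<noteq> 0"
    proof
      assume "N = 0"
      then have "1/2 < 4 * \<delta>" using N(1) by (simp add: powr_minus)
      then show False using \<delta> by simp
    qed
    \<comment> \<open>One level coarser than \<open>N\<close>, so that the separation
      \<open>2 powr - real m / 4\<close> strictly exceeds \<open>\<delta>\<close>.\<close>
    then obtain m where m: "N = Suc m" by (cases N) auto
    obtain Q where Q: "finite Q" "card Q = 2 ^ free_count ?S' m" "Q \<subseteq> direction_set ?S' {\<omega>. finite {i. \<omega> i}}"
      "\<And>x y. x \<in> Q \<Longrightarrow> y \<in> Q \<Longrightarrow> x \<noteq> y \<Longrightarrow> 2 powr - real m / 4 \<le> dist x y"
      using exists_separated_directions[of ?S' m] by blast
    have "4 * \<delta> \<le> 2 powr - real m / 2" using N(2) by (simp add: m powr_diff powr_minus field_simps)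
    then have \<delta>m: "\<delta> < 2 powr - real m / 4" using \<delta>(1) by linarith
    obtain M :: nat where "(1/2) ^ M < \<delta> / 2" using real_arch_pow_inv[of "\<delta> / 2" "1/2"] \<delta> by auto
    then have M: "2 * 2 powr - real M \<le> \<delta>" by (simp add: powr_minus powr_realpow power_one_over inverse_eq_divide field_simps)
    obtain F where F: "finite F" "?D \<subseteq> \<Union>F" "\<And>U. U \<in> F \<Longrightarrow> bounded U \<and> diameter U \<le> 2 * 2 powr - real M"
      using cover[of M] by blast
    have cQ: "2 ^ free_count ?S' m \<le> covering_number \<delta> ?D"
      unfolding Q(2)[symmetric]
    proof (rule card_le_covering_number[OF F(1,2)])
      show "bounded U \<and> diameter U \<le> \<delta>" if "U \<in> F" for U using F(3)[OF that] M by linarith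
      show "Q \<subseteq> ?D" using Q(3) by blast
      show "\<delta> < dist x y" if "x \<in> Q" "y \<in> Q" "x \<noteq> y" for x y using Q(4)[OF that] \<delta>m by linarith
    qed
    have "2 powr - real (N + 3) < \<delta>" using N(1) by (simp add: powr_diff powr_minus field_simps)
    then have "log 2 (2 powr - real (N + 3)) < log 2 \<delta>" using \<delta> by (subst log_less_cancel_iff) auto
    then have LN: "L < real N + 3" by (simp add: L_def)
    \<comment> \<open>\<open>L < m + 4\<close> costs at most 4 and the rounding in
      \<open>density_set\<close> 1.\<close>
    have "\<epsilon> * L - 5 \<le> \<epsilon> * real m - 1"
    proof -
      have "\<epsilon> * L \<le> \<epsilon> * (real m + 4)" using LN \<epsilon> by (intro mult_left_mono) (auto simp: m)
      then show ?thesis using \<epsilon> by (simp add: distrib_left)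
    qed
    also have "\<dots> \<le> real (free_count ?S' m)" by (rule free_count_density_set_bounds(2)[OF \<epsilon>])
    finally have *: "(\<epsilon> * L - 5) * ln 2 \<le> real (free_count ?S' m) * ln 2" by (rule mult_right_mono) simp
    also have "\<dots> = ln (2 ^ free_count ?S' m)" by (simp add: ln_realpow)
    also have "\<dots> \<le> ln (real (covering_number \<delta> ?D))"
    proof -
      have "real (2 ^ free_count ?S' m) \<le> real (covering_number \<delta> ?D)" using cQ by (simp only: of_nat_le_iff)
      then have r: "2 ^ free_count ?S' m \<le> real (covering_number \<delta> ?D)" by simp
      have p: "(0::real) < 2 ^ free_count ?S' m" by simp
      show ?thesis by (subst ln_le_cancel_iff[OF p order.strict_trans2[OF p r]]) (rule r)
    qed
    finally have "(\<epsilon> * L - 5) * ln 2 / (L * ln 2) \<le> ln (real (covering_number \<delta> ?D)) / (L * ln 2)"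
      using L by (intro divide_right_mono) auto
    moreover have eL: "- ln \<delta> = L * ln 2" by (simp add: L_def log_def)
    moreover have "(\<epsilon> * L - 5) * ln 2 / (L * ln 2) = \<epsilon> - 5 / L" using L by (simp add: field_simps)
    ultimately show ?thesis unfolding L_def[symmetric] eL by linarith
  qed
  have "ereal \<epsilon> = Liminf (at_right 0) (\<lambda>\<delta>. ereal (\<epsilon> - 5 / (- log 2 \<delta>)))"
  proof (rule lim_imp_Liminf[symmetric])
    have "((\<lambda>\<delta>::real. \<epsilon> - 5 / (- log 2 \<delta>)) \<longlongrightarrow> \<epsilon>) (at_right 0)" by real_asymp
    then show "((\<lambda>\<delta>. ereal (\<epsilon> - 5 / (- log 2 \<delta>))) \<longlongrightarrow> ereal \<epsilon>) (at_right 0)" by simp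
  qed simp
  also have "\<dots> \<le> Liminf (at_right 0) (\<lambda>\<delta>. ereal (?f \<delta>))"
  proof (rule Liminf_mono)
    have "eventually (\<lambda>\<delta>::real. 0 < \<delta> \<and> \<delta> < 1/8) (at_right 0)"
      using eventually_at_right_real[of 0 "1/8 :: real"] by (simp add: greaterThanLessThan_iff)
    then show "eventually (\<lambda>\<delta>. ereal (\<epsilon> - 5 / (- log 2 \<delta>)) \<le> ereal (?f \<delta>)) (at_right 0)"
      by eventually_elim (use lower in auto)
  qed
  finally have ge: "ereal \<epsilon> \<le> lower_box_dim ?D" by (simp add: lower_box_dim_def)
  have "\<not> ereal \<epsilon> < lower_box_dim ?D"
  proof
    assume "ereal \<epsilon> < lower_box_dim ?D"
    then obtain y where y: "\<epsilon> < y" "ereal y < lower_box_dim ?D" using ereal_dense2 by fastforce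
    define \<gamma> where "\<gamma> = (\<epsilon> + y) / 2"
    have \<gamma>: "\<epsilon> < \<gamma>" "\<gamma> < y" using y by (auto simp: \<gamma>_def)
    have "eventually (\<lambda>\<delta>. y < ?f \<delta>) (at_right 0)"
      using less_LiminfD[OF y(2)[unfolded lower_box_dim_def]] by simp
    moreover have "filterlim (\<lambda>a. 2 * 2 powr - real a) (at_right 0) sequentially" by real_asymp
    then have "filterlim (\<lambda>k. 2 * 2 powr - real (A k)) (at_right 0) sequentially" by (rule filterlim_compose[OF _ A])
    ultimately have ev1: "eventually (\<lambda>k. y < ?f (2 * 2 powr - real (A k))) sequentially"
      unfolding filterlim_iff by blast
    have "((\<lambda>a::nat. (1 + \<gamma> * real a) / (real a - 1)) \<longlongrightarrow> \<gamma>) sequentially" by real_asymp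
    then have "((\<lambda>k. (1 + \<gamma> * real (A k)) / (real (A k) - 1)) \<longlongrightarrow> \<gamma>) sequentially" by (rule filterlim_compose[OF _ A])
    then have ev2: "eventually (\<lambda>k. (1 + \<gamma> * real (A k)) / (real (A k) - 1) < y) sequentially"
      using \<gamma>(2) by (rule order_tendstoD)
    have ev3: "eventually (\<lambda>k. 2 \<le> A k) sequentially" using A by (simp add: filterlim_at_top)
    have "eventually (\<lambda>k. False) sequentially"
      using ev1 ev2 ev3 S[OF \<gamma>(1)]
    proof eventually_elim
      case (elim k)
      define a where "a = A k"
      let ?\<delta> = "2 * 2 powr - real a"
      obtain F where F: "finite F" "card F \<le> 2 ^ free_count S a + 2 ^ free_count ?S' a" "?D \<subseteq> \<Union>F" "\<And>U. U \<in> F \<Longrightarrow> bounded U \<and> diameter U \<le> ?\<delta>"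
        using cover[of a] by blast
      have "covering_number ?\<delta> ?D \<le> 2 ^ free_count S a + 2 ^ free_count ?S' a"
        using covering_number_le_card[OF F(1,3,4)] F(2) by linarith
      then have "real (covering_number ?\<delta> ?D) \<le> real (2 ^ free_count S a + 2 ^ free_count ?S' a)" by (simp only: of_nat_le_iff)
      also have "\<dots> = 2 powr real (free_count S a) + 2 powr real (free_count ?S' a)" by (simp add: powr_realpow)
      also have "\<dots> \<le> 2 powr (\<gamma> * real a) + 2 powr (\<gamma> * real a)"
      proof (intro add_mono powr_mono)
        show "real (free_count S a) \<le> \<gamma> * real a" using elim(4) by (simp add: a_def)
        have "real (free_count ?S' a) \<le> \<epsilon> * real a" by (rule free_count_density_set_bounds(1)[OF \<epsilon>])
        also have "\<dots> \<le> \<gamma> * real a" using \<gamma> by (intro mult_right_mono) auto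
        finally show "real (free_count ?S' a) \<le> \<gamma> * real a" .
      qed auto
      also have "\<dots> = 2 powr (1 + \<gamma> * real a)" by (simp add: powr_add)
      finally have c: "real (covering_number ?\<delta> ?D) \<le> 2 powr (1 + \<gamma> * real a)" .
      have g0: "0 \<le> (1 + \<gamma> * real a) * ln 2" using \<gamma> \<epsilon> by simp
      have ln: "ln (real (covering_number ?\<delta> ?D)) \<le> (1 + \<gamma> * real a) * ln 2"
      proof (cases "covering_number ?\<delta> ?D = 0")
        case True
        then show ?thesis using g0 by simp
      next
        case False
        then have "ln (real (covering_number ?\<delta> ?D)) \<le> ln (2 powr (1 + \<gamma> * real a))"
          using c by (subst ln_le_cancel_iff) auto
        then show ?thesis by (simp add: ln_powr)
      qed
      have "ln ?\<delta> = ln 2 + ln (2 powr - real a)" by (rule ln_mult_pos) auto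
      then have l\<delta>: "- ln ?\<delta> = (real a - 1) * ln 2" by (simp only: ln_powr) (simp add: algebra_simps)
      have a2: "1 < real a" using elim(3) by (simp add: a_def)
      have "?f ?\<delta> \<le> (1 + \<gamma> * real a) * ln 2 / ((real a - 1) * ln 2)"
        unfolding l\<delta> using ln a2 by (intro divide_right_mono) auto
      also have "\<dots> = (1 + \<gamma> * real a) / (real a - 1)" by simp
      finally show False using elim(1,2) by (simp add: a_def)
    qed
    then show False by simp
  qed
  then show ?thesis using ge by simp
qed

section \<open>Packing dimension of the direction sets\<close>

lemma packing_dim_le_if_null:
  assumes "\<And>u. s < u \<Longrightarrow> packing_measure u D = 0" "0 \<le> s"
  shows "packing_dim D \<le> ereal s"
proof (rule ereal_le_epsilon2)
  fix e :: real assume "0 < e"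
  then have "packing_dim D \<le> ereal (s + e)"
    unfolding packing_dim_def using assms(1)[of "s + e"] assms(2) by (intro INF_lower) auto
  then show "packing_dim D \<le> ereal s + ereal e" by simp
qed

text \<open>The random part has few prefixes at every level, so its premeasure itself vanishes. The
  countable part is split into singletons, which is possible for the measure though not for the
  premeasure.\<close>

lemma packing_measure_direction_set_null:
  assumes s: "0 \<le> s" "s < u" and S: "\<And>m. real (free_count S m) \<le> s * real m" and C: "countable C"
  shows "packing_measure u (direction_set S UNIV \<union> C) = 0"
proof -
  define g where "g = from_nat_into C"
  define A where "A = (\<lambda>n. case n of 0 \<Rightarrow> direction_set S UNIV | Suc i \<Rightarrow> {g i})"
  have D0: "packing_premeasure u (direction_set S UNIV) = 0"
  proof (rule packing_premeasure_eq_0_if_separated_counts[where K = "4 powr s" and v = s])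
    fix m and F :: "(real^2) set"
    assume F: "finite F" "F \<subseteq> direction_set S UNIV" "separated (2 powr - real m) F"
    \<comment> \<open>Two extra digits make equal prefixes imply a distance of at most half the
      separation; they cost the factor \<open>4 powr s\<close>.\<close>
    have "card F \<le> 2 ^ free_count S (m + 2)"
    proof (rule card_separated_direction_set_le[OF F(1,2)])
      fix x y assume "x \<in> F" "y \<in> F" "x \<noteq> y"
      then have "2 powr - real m \<le> dist x y" using F(3) by (rule separatedD[rotated])
      moreover have "2 * 2 powr - real (m + 2) = (2 powr - real m) / 2" by (simp add: powr_diff powr_minus field_simps)
      moreover have "0 < (2::real) powr - real m" by simp
      ultimately show "2 * 2 powr - real (m + 2) < dist x y" by linarith
    qed
    then have "real (card F) \<le> real (2 ^ free_count S (m + 2))" by (simp only: of_nat_le_iff)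
    also have "\<dots> = 2 powr real (free_count S (m + 2))" by (simp add: powr_realpow)
    also have "\<dots> \<le> 2 powr (s * real (m + 2))" by (intro powr_mono S) auto
    also have "\<dots> = 2 powr (2 * s) * 2 powr (real m * s)" by (simp add: powr_add[symmetric] algebra_simps)
    also have "2 powr (2 * s) = (2 powr 2) powr s" by (simp only: powr_powr)
    also have "(2::real) powr 2 = 4" by simp
    finally show "real (card F) \<le> 4 powr s * 2 powr (real m * s)" .
  qed (use s in auto)
  have pt: "packing_premeasure u {c} = 0" for c :: "real^2"
  proof (rule packing_premeasure_eq_0_if_separated_counts[where K = 1 and v = 0])
    fix m F assume "F \<subseteq> {c}"
    then have "card F \<le> card {c}" by (intro card_mono) auto
    then show "real (card F) \<le> 1 * 2 powr (real m * 0)" by simp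
  qed (use s in auto)
  have "packing_premeasure u (A n) = 0" for n using D0 pt by (simp add: A_def split: nat.split)
  then have z: "(\<Sum>n. packing_premeasure u (A n)) = 0" by simp
  have "direction_set S UNIV \<union> C \<subseteq> (\<Union>n. A n)"
  proof
    fix x assume "x \<in> direction_set S UNIV \<union> C"
    then consider "x \<in> direction_set S UNIV" | "x \<in> C" by blast
    then show "x \<in> (\<Union>n. A n)"
    proof cases
      case 1
      then have "x \<in> A 0" by (simp add: A_def)
      then show ?thesis by blast
    next
      case 2
      then obtain i where "g i = x" unfolding g_def using from_nat_into_surj[OF C] by blast
      then have "x \<in> A (Suc i)" by (simp add: A_def)
      then show ?thesis by blast
    qed
  qed
  then have "packing_measure u (direction_set S UNIV \<union> C) \<le> (\<Sum>n. packing_premeasure u (A n))"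
    unfolding packing_measure_def by (intro INF_lower) auto
  then show ?thesis using z by simp
qed

text \<open>Countable subadditivity of the coin measure gives one member of the cover that works for all
  \<open>k\<close> at once.\<close>

lemma exists_cover_member_with_many_prefixes:
  assumes A: "direction_set S UNIV \<subseteq> (\<Union>i. A i)"
  obtains i :: nat where "\<And>k :: nat. (1/2) ^ (i + 2) * 2 ^ free_count S (b k)
      \<le> real (card {v. \<exists>\<omega>. digit_prefix S (b k) \<omega> = v \<and> direction (slope S \<omega>) \<in> A i})"
proof (rule ccontr)
  interpret prob_space coins by (rule prob_space_coins)
  let ?V = "\<lambda>i m. {v. \<exists>\<omega>. digit_prefix S m \<omega> = v \<and> direction (slope S \<omega>) \<in> A i}"
  have finV: "finite (?V i m)" for i m by (rule finite_subset[OF _ finite_range_prefix[of S m]]) auto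
  assume nt: "\<not> thesis"
  have "\<exists>k. real (card (?V i (b k))) < (1/2) ^ (i + 2) * 2 ^ free_count S (b k)" for i
  proof (rule ccontr)
    assume "\<not> ?thesis"
    then have "(1/2) ^ (i + 2) * 2 ^ free_count S (b k) \<le> real (card (?V i (b k)))" for k
      unfolding not_ex not_less by (rule spec)
    then have thesis by (rule that)
    then show False using nt by contradiction
  qed
  then have "\<forall>i. \<exists>k. real (card (?V i (b k))) < (1/2) ^ (i + 2) * 2 ^ free_count S (b k)" by (rule allI)
  then have "\<exists>k. \<forall>i. real (card (?V i (b (k i)))) < (1/2) ^ (i + 2) * 2 ^ free_count S (b (k i))" by (rule choice)
  then obtain k where "\<forall>i. real (card (?V i (b (k i)))) < (1/2) ^ (i + 2) * 2 ^ free_count S (b (k i))" by (rule exE)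
  then have k: "real (card (?V i (b (k i)))) < (1/2) ^ (i + 2) * 2 ^ free_count S (b (k i))" for i by (rule spec)
  let ?X = "\<lambda>i. {\<omega>. digit_prefix S (b (k i)) \<omega> \<in> ?V i (b (k i))}"
  have X: "emeasure coins (?X i) \<le> ennreal ((1/2) ^ (i + 2))" for i
  proof -
    have "measure coins (?X i) \<le> real (card (?V i (b (k i)))) * (1/2) ^ free_count S (b (k i))"
      by (rule prob_prefix_in(2)[OF finV])
    also have "\<dots> \<le> ((1/2) ^ (i + 2) * 2 ^ free_count S (b (k i))) * (1/2) ^ free_count S (b (k i))"
      using k[of i] by (intro mult_right_mono) auto
    also have "\<dots> = (1/2) ^ (i + 2)" by (simp add: power_one_over)
    finally show ?thesis unfolding emeasure_eq_measure by (rule ennreal_leI)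
  qed
  have sets: "?X i \<in> sets coins" for i by (rule prob_prefix_in(1)[OF finV])
  have "UNIV \<subseteq> (\<Union>i. ?X i)"
  proof
    fix \<omega> :: "nat \<Rightarrow> bool"
    have "direction (slope S \<omega>) \<in> direction_set S UNIV" by (auto simp: direction_set_def)
    then obtain i where "direction (slope S \<omega>) \<in> A i" using A by blast
    then have "\<omega> \<in> ?X i" by blast
    then show "\<omega> \<in> (\<Union>i. ?X i)" by blast
  qed
  then have "(\<Union>i. ?X i) = space coins" by auto
  then have "1 = emeasure coins (\<Union>i. ?X i)" using emeasure_space_1 by simp
  also have "\<dots> \<le> (\<Sum>i. emeasure coins (?X i))" using sets by (intro emeasure_subadditive_countably) auto
  also have "\<dots> \<le> (\<Sum>i. ennreal ((1/2) ^ (i + 2)))" by (intro suminf_le X) auto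
  also have "\<dots> = ennreal (1 / 2)"
  proof (rule suminf_ennreal_eq)
    have "(\<lambda>k. (1/2) * (1/2) ^ Suc k :: real) sums ((1/2) * 1)" by (intro sums_mult power_half_series)
    then show "(\<lambda>k. (1/2) ^ (k + 2) :: real) sums (1/2)" by simp
  qed auto
  also have "\<dots> < 1" unfolding ennreal_1[symmetric] by (rule ennreal_lessI) auto
  finally show False by simp
qed

text \<open>A prefix determines the slope only up to \<open>2 ^ -b\<close>, and adjacent prefixes
  can have arbitrarily close slopes. Prefixes of one parity differ by at least 2, and one of the two
  parities keeps half of them.\<close>

lemma separated_points_of_prefixes:
  fixes A :: "(real^2) set"
  assumes c: "c \<le> real (card {v. \<exists>\<omega>. digit_prefix S b \<omega> = v \<and> direction (slope S \<omega>) \<in> A})"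
  obtains F where "finite F" "F \<subseteq> A" "separated (2 powr - real b / 4) F" "c / 2 \<le> real (card F)"
proof -
  let ?V = "{v. \<exists>\<omega>. digit_prefix S b \<omega> = v \<and> direction (slope S \<omega>) \<in> A}"
  have fin: "finite ?V" by (rule finite_subset[OF _ finite_range_prefix[of S b]]) auto
  have "\<forall>v\<in>?V. \<exists>\<omega>. digit_prefix S b \<omega> = v \<and> direction (slope S \<omega>) \<in> A" by blast
  then have "\<exists>w. \<forall>v\<in>?V. digit_prefix S b (w v) = v \<and> direction (slope S (w v)) \<in> A" by (rule bchoice)
  then obtain w where w: "\<And>v. v \<in> ?V \<Longrightarrow> digit_prefix S b (w v) = v \<and> direction (slope S (w v)) \<in> A" by blast
  let ?W = "\<lambda>r. {v \<in> ?V. v mod 2 = r}"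
  have "?V = ?W 0 \<union> ?W 1" by auto
  then have "card ?V \<le> card (?W 0) + card (?W 1)" by (metis (no_types, lifting) card_Un_le)
  then have "c / 2 \<le> real (card (?W 0)) \<or> c / 2 \<le> real (card (?W 1))" using c by linarith
  then obtain r where r: "c / 2 \<le> real (card (?W r))" by blast
  let ?e = "\<lambda>v. direction (slope S (w v))"
  have sep: "2 powr - real b / 4 \<le> dist (?e v) (?e v')" if v: "v \<in> ?W r" "v' \<in> ?W r" "v \<noteq> v'" for v v'
  proof -
    have "v mod 2 = v' mod 2" "v \<noteq> v'" using v by auto
    then have "2 \<le> \<bar>int v - int v'\<bar>" by presburger
    then have v2: "2 \<le> \<bar>real v - real v'\<bar>" by linarith
    have p: "digit_prefix S b (w v) = v" "digit_prefix S b (w v') = v'" using w v by auto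
    have "real v / 2 ^ b \<le> slope S (w v)" "slope S (w v) \<le> real v / 2 ^ b + 1 / 2 ^ b"
      "real v' / 2 ^ b \<le> slope S (w v')" "slope S (w v') \<le> real v' / 2 ^ b + 1 / 2 ^ b"
      using slope_bounds[where S = S and m = b and \<omega> = "w v"] slope_bounds[where S = S and m = b and \<omega> = "w v'"] p
      by (simp_all add: add_divide_distrib)
    moreover have "2 * (1 / 2 ^ b) \<le> \<bar>real v / 2 ^ b - real v' / 2 ^ b\<bar>"
    proof -
      have "2 / 2 ^ b \<le> \<bar>real v - real v'\<bar> / 2 ^ b" using v2 by (intro divide_right_mono) auto
      then show ?thesis by (simp add: diff_divide_distrib[symmetric])
    qed
    ultimately have "1 / 2 ^ b \<le> \<bar>slope S (w v) - slope S (w v')\<bar>" by linarith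
    then have "1 / 2 ^ b / 4 \<le> \<bar>slope S (w v) - slope S (w v')\<bar> / 4" by (rule divide_right_mono) simp
    also have "\<dots> \<le> dist (?e v) (?e v')" by (rule dist_direction_slope_ge)
    finally show ?thesis by (simp add: powr_minus powr_realpow inverse_eq_divide)
  qed
  have inj: "inj_on ?e (?W r)"
  proof (rule inj_onI, rule ccontr)
    fix v v' assume v: "v \<in> ?W r" "v' \<in> ?W r" "?e v = ?e v'" "v \<noteq> v'"
    have "(2::real) powr - real b / 4 \<le> 0" using sep[OF v(1,2,4)] v(3) by (simp only: dist_self)
    moreover have "0 < (2::real) powr - real b" by simp
    ultimately show False by linarith
  qed
  have "separated (2 powr - real b / 4) (?e ` ?W r)"
    unfolding separated_def
  proof (intro ballI impI)
    fix x y assume x: "x \<in> ?e ` ?W r" and y: "y \<in> ?e ` ?W r" and xy: "x \<noteq> y"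
    from x obtain v where v: "x = ?e v" "v \<in> ?W r" by (rule imageE)
    from y obtain v' where v': "y = ?e v'" "v' \<in> ?W r" by (rule imageE)
    have "v \<noteq> v'" using xy v(1) v'(1) by metis
    then show "2 powr - real b / 4 \<le> dist x y" unfolding v(1) v'(1) by (rule sep[OF v(2) v'(2)])
  qed
  moreover have "?e ` ?W r \<subseteq> A"
  proof (rule image_subsetI)
    fix v assume "v \<in> ?W r"
    then have "v \<in> ?V" by simp
    then show "?e v \<in> A" using w by simp
  qed
  moreover have "c / 2 \<le> real (card (?e ` ?W r))" using r by (simp only: card_image[OF inj])
  moreover have "finite (?e ` ?W r)" using fin by simp
  ultimately show ?thesis using that by blast
qed


text \<open>At a window end almost all digits have had density \<open>s\<close>, so one member of
  any countable cover contains about \<open>2 powr (s * win_end R k)\<close> separated directions,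
  for all \<open>k\<close> at once. As the premeasure is an infimum over \<open>\<delta>\<close>,
  such packings are needed at arbitrarily fine scales within the same member.\<close>

lemma packing_measure_window_nonzero:
  assumes R: "\<And>k. 1 \<le> R k" and s: "s \<le> 1" and u: "0 \<le> u" "u < s"
    and D: "direction_set (window_set s R) UNIV \<subseteq> D"
  shows "packing_measure u D \<noteq> 0"
proof
  let ?S = "window_set s R" and ?a = "win_start R" and ?b = "win_end R"
  assume "packing_measure u D = 0"
  then have "packing_measure u D < 1" by simp
  then obtain A :: "nat \<Rightarrow> (real^2) set" where A: "D \<subseteq> (\<Union>i. A i)" "(\<Sum>i. packing_premeasure u (A i)) < 1"
    unfolding packing_measure_def by (subst (asm) INF_less_iff) auto
  have "direction_set ?S UNIV \<subseteq> (\<Union>i. A i)" using D A(1) by blast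
  then obtain i where i: "\<And>k. (1/2) ^ (i + 2) * 2 ^ free_count ?S (?b k)
      \<le> real (card {v. \<exists>\<omega>. digit_prefix ?S (?b k) \<omega> = v \<and> direction (slope ?S \<omega>) \<in> A i})"
    using exists_cover_member_with_many_prefixes[of ?S A ?b] by blast
  have "1 \<le> packing_premeasure u (A i)"
    unfolding packing_premeasure_def
  proof (rule INF_greatest)
    fix \<delta> :: real assume "\<delta> \<in> {0<..}"
    then have \<delta>: "0 < \<delta>" by simp
    obtain k1 where k1: "(1/2) ^ k1 < \<delta>" using real_arch_pow_inv[of \<delta> "1/2"] \<delta> by auto
    \<comment> \<open>The losses to be absorbed are \<open>i + 3\<close> from the share of prefixes,
      1 from rounding, \<open>3 * u\<close> from the radius and \<open>s * a\<close> from the start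
      of the window; as \<open>1 \<le> a\<close>, together they are at most
      \<open>(i + 9) * a\<close>.\<close>
    obtain k2 where k2: "real (i + 9) / (s - u) < real k2" using reals_Archimedean2 by blast
    define k where "k = max k1 k2"
    define a where "a = ?a k"
    define b where "b = ?b k"
    have a1: "1 \<le> a" unfolding a_def by (rule win_start_pos[OF R])
    have bk: "b = a * Suc k ^ 3" by (simp add: b_def a_def win_end_def)
    have k3: "Suc k \<le> Suc k ^ 3" by (rule self_le_power) auto
    have "k \<le> b"
    proof -
      have "1 * Suc k \<le> a * Suc k ^ 3" using a1 k3 by (rule mult_le_mono)
      then show ?thesis unfolding bk mult_1 by (rule order_trans[rotated]) simp
    qed
    then have "(2::real) powr - real b \<le> 2 powr - real k1" by (intro powr_mono) (auto simp: k_def)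
    also have "\<dots> < \<delta>" using k1 by (simp add: powr_minus powr_realpow power_one_over inverse_eq_divide)
    finally have b\<delta>: "2 powr - real b < \<delta>" .
    obtain F where F: "finite F" "F \<subseteq> A i" "separated (2 powr - real b / 4) F"
      "(1/2) ^ (i + 2) * 2 ^ free_count ?S b / 2 \<le> real (card F)"
      using separated_points_of_prefixes[OF i[of k, folded b_def]] by blast
    have pb: "0 < (2::real) powr - real b" by simp
    have p1: "ennreal (real (card F) * (2 * (2 powr - real b / 4 / 3)) powr u)
       \<le> (SUP P \<in> packings \<delta> (A i). \<Sum>\<^sub>\<infinity>(x, r)\<in>P. ennreal ((2 * r) powr u))"
      using b\<delta> pb by (intro packing_sum_ge_card_separated F) (simp, linarith)
    have p2: "1 \<le> real (card F) * (2 * (2 powr - real b / 4 / 3)) powr u"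
    proof -
      have e: "0 \<le> - real (i + 3) + real (free_count ?S b) + (- real b - 3) * u"
      proof -
        have "s * (real b - real a) - 1 \<le> real (free_count ?S b)"
          unfolding a_def b_def using s u by (intro free_count_window_set_ge[OF R]) auto
        moreover have "(real (i + 9)) * real a \<le> (s - u) * real b"
        proof -
          have "real (i + 9) < real k2 * (s - u)" using k2 u by (simp add: pos_divide_less_eq)
          also have "\<dots> \<le> real (Suc k ^ 3) * (s - u)" using k3 u by (intro mult_right_mono) (auto simp: k_def simp del: of_nat_power)
          finally have "real (i + 9) * real a \<le> real (Suc k ^ 3) * (s - u) * real a" by (intro mult_right_mono) auto
          also have "\<dots> = (s - u) * real b" by (simp only: bk of_nat_mult mult_ac)
          finally show ?thesis .
        qed
        moreover have "s * real a \<le> 1 * real a" using s by (intro mult_right_mono) auto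
        moreover have "real (i + 8) * 1 \<le> real (i + 8) * real a" using a1 by (intro mult_left_mono) auto
        ultimately show ?thesis using u s by (simp add: algebra_simps)
      qed
      have "1 \<le> (2::real) powr (- real (i + 3) + real (free_count ?S b) + (- real b - 3) * u)"
        using e by (intro ge_one_powr_ge_zero) auto
      also have "\<dots> = (2 powr - real (i + 3) * 2 powr real (free_count ?S b)) * (2 powr (- real b - 3)) powr u"
        by (simp only: powr_add powr_powr)
      also have "2 powr - real (i + 3) * 2 powr real (free_count ?S b) = (1/2) ^ (i + 2) * 2 ^ free_count ?S b / 2"
      proof -
        have "2 powr - real (i + 3) = (1/2::real) ^ (i + 3)" by (simp only: powr_minus powr_realpow power_one_over inverse_eq_divide zero_less_numeral)
        moreover have "2 powr real (free_count ?S b) = (2::real) ^ free_count ?S b" by (simp add: powr_realpow)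
        moreover have "(1/2::real) ^ (i + 3) = (1/2) ^ (i + 2) / 2" by (simp add: power_add power3_eq_cube power2_eq_square)
        ultimately show ?thesis by simp
      qed
      also have "(1/2) ^ (i + 2) * 2 ^ free_count ?S b / 2 * (2 powr (- real b - 3)) powr u \<le> real (card F) * (2 * (2 powr - real b / 4 / 3)) powr u"
      proof (rule mult_mono[OF F(4)])
        \<comment> \<open>The packing balls have diameter \<open>2 powr - b / 6\<close>, rounded
          down to a power of 2.\<close>
        have "(2::real) powr (- real b - 3) = 2 powr - real b / 8" by (simp add: powr_diff)
        also have "\<dots> \<le> 2 * (2 powr - real b / 4 / 3)" using pb by simp
        finally show "(2 powr (- real b - 3)) powr u \<le> (2 * (2 powr - real b / 4 / 3)) powr u"
          using u by (intro powr_mono2) auto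
      qed auto
      finally show ?thesis .
    qed
    show "1 \<le> (SUP P \<in> packings \<delta> (A i). \<Sum>\<^sub>\<infinity>(x, r)\<in>P. ennreal ((2 * r) powr u))"
      using order_trans[OF ennreal_leI[OF p2] p1] by (simp only: ennreal_1)
  qed
  also have "\<dots> \<le> (\<Sum>i. packing_premeasure u (A i))"
    using sum_le_suminf[of "\<lambda>i. packing_premeasure u (A i)" "{i}"] by simp
  finally show False using A(2) by simp
qed

text \<open>At scale \<open>win_start R (Suc k)\<close> a gap has just ended, and the proportion of
  free digits is at most \<open>s / R k\<close>. Hence \<open>R\<close> must tend to infinity for
  \<open>\<epsilon> = 0\<close>, while a constant suffices for
  \<open>\<epsilon> > 0\<close>.\<close>

lemma window_direction_set_dims:
  assumes R: "\<And>k. 1 \<le> R k" and s: "0 \<le> s" "s \<le> 1" and \<epsilon>: "0 \<le> \<epsilon>" "\<epsilon> \<le> 1"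
    and gap: "\<And>\<gamma>. \<epsilon> < \<gamma> \<Longrightarrow> eventually (\<lambda>k. s \<le> \<gamma> * real (R k)) sequentially"
  defines "D \<equiv> direction_set (window_set s R) UNIV \<union> direction_set (density_set \<epsilon>) {\<omega>. finite {i. \<omega> i}}"
  shows "D \<subseteq> sphere 0 1" "lower_box_dim D = ereal \<epsilon>" "packing_dim D = ereal s"
proof -
  show "D \<subseteq> sphere 0 1" unfolding D_def using direction_set_subset_sphere by (meson Un_least)
  show "lower_box_dim D = ereal \<epsilon>"
    unfolding D_def
  proof (rule lower_box_dim_direction_set[OF \<epsilon>, where A = "\<lambda>k. win_start R (Suc k)"])
    have "filterlim Suc at_top sequentially" by (rule filterlim_Suc)
    then show "filterlim (\<lambda>k. win_start R (Suc k)) at_top sequentially"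
      by (rule filterlim_at_top_mono) (use win_start_ge[of R, OF R] in auto)
    fix \<gamma> assume \<gamma>: "\<epsilon> < \<gamma>"
    show "eventually (\<lambda>k. real (free_count (window_set s R) (win_start R (Suc k))) \<le> \<gamma> * real (win_start R (Suc k))) sequentially"
      using gap[OF \<gamma>]
    proof eventually_elim
      case (elim k)
      have "real (free_count (window_set s R) (win_start R (Suc k))) \<le> s * real (win_end R k)"
        by (rule free_count_window_set_gap[OF R s])
      also have "\<dots> \<le> (\<gamma> * real (R k)) * real (win_end R k)" using elim by (rule mult_right_mono) simp
      also have "\<dots> = \<gamma> * real (win_start R (Suc k))" by (simp only: win_start_Suc of_nat_mult mult.assoc)
      finally show ?case .
    qed
  qed
  show "packing_dim D = ereal s"
  proof (rule antisym)
    show "packing_dim D \<le> ereal s"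
      unfolding D_def using s
      by (intro packing_dim_le_if_null packing_measure_direction_set_null[where s = s] free_count_window_set_le[OF R]
          countable_direction_set_finite) auto
    show "ereal s \<le> packing_dim D"
      unfolding packing_dim_def
    proof (rule INF_greatest)
      fix u assume "u \<in> {u. 0 \<le> u \<and> packing_measure u D = 0}"
      then have u: "0 \<le> u" "packing_measure u D = 0" by auto
      show "ereal s \<le> ereal u"
      proof (rule ccontr)
        assume "\<not> ereal s \<le> ereal u"
        then have "packing_measure u D \<noteq> 0"
          using u(1) s by (intro packing_measure_window_nonzero[OF R s(2)]) (auto simp: D_def)
        then show False using u(2) by simp
      qed
    qed
  qed
qed

section \<open>Universality\<close>

text \<open>The premise \<open>ext\<close> gives \<open>M\<close> before \<open>\<eta>\<close>:
  \<open>M\<close> depends on \<open>\<theta>\<close> alone and bounds the number of blocks, and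
  only then must the regularity error be small enough for all of them.\<close>

lemma exists_window_direction:
  fixes E :: "(real^2) set"
  assumes R: "\<And>k. 1 \<le> R k" and R0: "\<And>k. R k \<le> R0 * Suc k" and s: "0 \<le> s" "s \<le> 1" and ts: "t \<le> s"
    and ext: "\<And>\<theta> M. 0 < \<theta> \<Longrightarrow> 1 \<le> M \<Longrightarrow> \<exists>E0 \<eta> c \<tau>. E0 \<subseteq> E \<and> regular_counts E0 t \<eta> c \<and> 0 \<le> \<eta> \<and> \<eta> \<le> \<theta> \<and>
       0 < \<tau> \<and> \<tau> \<le> 1 \<and> t - \<eta> \<le> \<tau> \<and> hausdorff_content \<tau> E0 \<noteq> 0 \<and> (\<forall>k. 12 * \<eta> * real (M * R k) \<le> \<theta>)"
  shows "\<exists>e\<in>direction_set (window_set s R) UNIV. ereal t \<le> hausdorff_dim (proj e ` E)"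
proof -
  let ?X = "slope (window_set s R)"
  have "\<exists>\<omega>\<in>space coins. ereal t \<le> hausdorff_dim (proj (direction (?X \<omega>)) ` E)"
  proof (rule exists_direction_dim_ge[OF prob_space_coins slope_measurable _ s ts])
    show "0 \<le> ?X \<omega> \<and> ?X \<omega> \<le> 1" for \<omega> using slope_nonneg slope_le_1 by blast
    fix \<theta> :: real assume \<theta>: "0 < \<theta>"
    obtain M where M: "4 / \<theta> < real M" using reals_Archimedean2 by blast
    then have "0 < real M" using \<theta> by (meson divide_pos_pos order.strict_trans zero_less_numeral)
    then have M1: "1 \<le> M" by simp
    obtain E0 \<eta> c \<tau> where E0: "E0 \<subseteq> E" "regular_counts E0 t \<eta> c" "0 \<le> \<eta>" "\<eta> \<le> \<theta>" "0 < \<tau>" "\<tau> \<le> 1" "t - \<eta> \<le> \<tau>"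
      "hausdorff_content \<tau> E0 \<noteq> 0" and \<eta>: "\<And>k. 12 * \<eta> * real (M * R k) \<le> \<theta>"
      using ext[OF \<theta> M1] by blast
    obtain N0 where N0: "\<And>N. N0 \<le> N \<Longrightarrow> \<exists>i k. 1 \<le> i \<and> i * i \<le> N \<and> i \<le> M * R k \<and>
       M * win_start R k \<le> N div i \<and> N div i \<le> win_end R k"
      using exists_window_block[OF R M1 R0] by blast
    have "\<forall>N. \<exists>i. N0 \<le> N \<longrightarrow> 1 \<le> i \<and> i * i \<le> N \<and> 12 * \<eta> * real i \<le> \<theta> \<and> spread_at coins ?X s (N div i) (\<theta> * real (N div i) / 4)"
    proof
      fix N
      show "\<exists>i. N0 \<le> N \<longrightarrow> 1 \<le> i \<and> i * i \<le> N \<and> 12 * \<eta> * real i \<le> \<theta> \<and> spread_at coins ?X s (N div i) (\<theta> * real (N div i) / 4)"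
      proof (cases "N0 \<le> N")
        case True
        then obtain i k where i: "1 \<le> i" "i * i \<le> N" "i \<le> M * R k" "M * win_start R k \<le> N div i" "N div i \<le> win_end R k"
          using N0 by blast
        have "12 * \<eta> * real i \<le> 12 * \<eta> * real (M * R k)" using i(3) E0(3) by (intro mult_left_mono) (simp_all only: of_nat_le_iff mult_nonneg_nonneg zero_le_numeral)
        then have "12 * \<eta> * real i \<le> \<theta>" using \<eta>[of k] by linarith
        moreover have "spread_at coins ?X s (N div i) (\<theta> * real (N div i) / 4)"
          using M by (intro spread_at_window[OF R s i(4,5) _ \<theta>]) simp
        ultimately show ?thesis using i(1,2) by blast
      qed simp
    qed
    then obtain i where "\<forall>N. N0 \<le> N \<longrightarrow> 1 \<le> i N \<and> i N * i N \<le> N \<and> 12 * \<eta> * real (i N) \<le> \<theta> \<and>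
       spread_at coins ?X s (N div i N) (\<theta> * real (N div i N) / 4)" by (rule choice[THEN exE])
    then show "\<exists>E0 \<eta> c \<tau> i N1. E0 \<subseteq> E \<and> regular_counts E0 t \<eta> c \<and> 0 \<le> \<eta> \<and> \<eta> \<le> \<theta> \<and>
       0 < \<tau> \<and> \<tau> \<le> 1 \<and> t - \<eta> \<le> \<tau> \<and> hausdorff_content \<tau> E0 \<noteq> 0 \<and>
       (\<forall>N\<ge>N1. 1 \<le> i N \<and> i N * i N \<le> N \<and> 12 * \<eta> * real (i N) \<le> \<theta> \<and>
              spread_at coins ?X s (N div i N) (\<theta> * real (N div i N) / 4))"
      using E0 by blast
  qed
  then show ?thesis by (auto simp: direction_set_def)
qed

lemma hausdorff_dim_proj_le:
  assumes "norm e = 1"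
  shows "hausdorff_dim (proj e ` E) \<le> hausdorff_dim E"
proof (rule hausdorff_dim_nonexpansive_image)
  fix x y :: "real^2"
  have "dist (proj e x) (proj e y) = \<bar>e \<bullet> (x - y)\<bar>" by (simp add: Defs.proj_def dist_real_def inner_diff_right)
  also have "\<dots> \<le> norm e * norm (x - y)" by (rule Cauchy_Schwarz_ineq2)
  finally show "dist (proj e x) (proj e y) \<le> dist x y" using assms by (simp add: dist_norm)
qed

text \<open>Projections never raise the dimension and \<open>s < 1\<close> makes the minimum equal
  to \<open>t\<close>, so only the lower bound is left. For \<open>t = 0\<close> any direction
  serves.\<close>

lemma universal_for_if_dim_ge:
  assumes D: "D \<subseteq> sphere 0 1" "direction_set S UNIV \<subseteq> D" and s: "s < 1"
    and ge: "\<And>E t. E \<in> \<C> \<Longrightarrow> hausdorff_dim E = ereal t \<Longrightarrow> 0 < t \<Longrightarrow> t \<le> s \<Longrightarrow>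
       \<exists>e\<in>direction_set S UNIV. ereal t \<le> hausdorff_dim (proj e ` E)"
  shows "universal_for D (\<C> \<inter> class_dim_le s)"
  unfolding universal_for_def
proof (intro conjI ballI D(1))
  fix E assume "E \<in> \<C> \<inter> class_dim_le s"
  then have E: "E \<in> \<C>" "hausdorff_dim E \<le> ereal s" by (auto simp: class_dim_le_def)
  then obtain t where t: "hausdorff_dim E = ereal t" "0 \<le> t" "t \<le> s"
    using hausdorff_dim_nonneg[of E] by (cases "hausdorff_dim E") auto
  have "\<exists>e\<in>direction_set S UNIV. ereal t \<le> hausdorff_dim (proj e ` E)"
  proof (cases "t = 0")
    case True
    then show ?thesis using hausdorff_dim_nonneg by (auto simp: direction_set_def zero_ereal_def[symmetric])
  next
    case False
    then show ?thesis using ge[OF E(1) t(1) _ t(3)] t(2) by simp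
  qed
  then obtain e where e: "e \<in> direction_set S UNIV" "ereal t \<le> hausdorff_dim (proj e ` E)" by blast
  have "e \<in> D" using e(1) D(2) by blast
  moreover have "norm e = 1" using calculation D(1) by auto
  then have "hausdorff_dim (proj e ` E) \<le> ereal t" using hausdorff_dim_proj_le[of e E] t(1) by simp
  then have "hausdorff_dim (proj e ` E) = ereal t" using e(2) by (rule antisym)
  moreover have "min (ereal t) 1 = ereal t" using t(3) s by (simp add: min_def one_ereal_def)
  ultimately show "\<exists>e\<in>D. hausdorff_dim (proj e ` E) = min (hausdorff_dim E) 1" using t(1) by auto
qed

theorem proposition4:
  fixes s :: real
  assumes "0 < s" and "s < 1"
  shows "(\<exists>D \<subseteq> sphere (0 :: real^2) 1.
            lower_box_dim D = 0 \<and> packing_dim D = ereal s \<and>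
            universal_for D (class_AD \<inter> class_dim_le s)) \<and>
         (\<forall>\<epsilon>. 0 < \<epsilon> \<and> \<epsilon> < 1 \<longrightarrow>
            (\<exists>D \<subseteq> sphere (0 :: real^2) 1.
               lower_box_dim D = ereal \<epsilon> \<and> packing_dim D = ereal s \<and>
               universal_for D (class_WR \<inter> class_dim_le s)))"
proof (intro conjI allI impI)
  have s: "0 \<le> s" "s \<le> 1" using assms by auto
    \<comment> \<open>\<open>R = Suc\<close> makes the relative gap lengths tend to infinity, as
      lower box dimension 0 demands; the resulting unbounded number of blocks is affordable because
      AD-regular pieces have \<open>\<eta> = 0\<close>. With density 0 the second part adds no free
      digits.\<close>
    define D where "D = direction_set (window_set s Suc) UNIV \<union> direction_set (density_set 0) {\<omega>. finite {i. \<omega> i}}"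
    have dims: "D \<subseteq> sphere 0 1" "lower_box_dim D = ereal 0" "packing_dim D = ereal s"
    proof -
      have gap: "eventually (\<lambda>k. s \<le> \<gamma> * real (Suc k)) sequentially" if "0 < \<gamma>" for \<gamma>
        using that by real_asymp
      show "D \<subseteq> sphere 0 1" "lower_box_dim D = ereal 0" "packing_dim D = ereal s"
        unfolding D_def using window_direction_set_dims[of Suc s 0, OF _ s _ _ gap] by auto
    qed
    moreover have "universal_for D (class_AD \<inter> class_dim_le s)"
    proof (rule universal_for_if_dim_ge[OF dims(1) _ assms(2)])
      show "direction_set (window_set s Suc) UNIV \<subseteq> D" by (simp add: D_def)
      fix E t assume E: "E \<in> class_AD" "hausdorff_dim E = ereal t" and t: "0 < t" "t \<le> s"
      have "AD_regular E" using E(1) by (simp add: class_AD_def)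
      then obtain E0 c where E0: "E0 \<subseteq> E" "regular_counts E0 t 0 c" "hausdorff_content t E0 \<noteq> 0"
        using AD_regular_extraction[OF _ E(2) t(1)] by blast
      show "\<exists>e\<in>direction_set (window_set s Suc) UNIV. ereal t \<le> hausdorff_dim (proj e ` E)"
      proof (rule exists_window_direction[OF _ _ s t(2), where ?R0.0 = 1])
        fix \<theta> :: real and M :: nat assume "0 < \<theta>"
        then show "\<exists>E0 \<eta> c \<tau>. E0 \<subseteq> E \<and> regular_counts E0 t \<eta> c \<and> 0 \<le> \<eta> \<and> \<eta> \<le> \<theta> \<and>
          0 < \<tau> \<and> \<tau> \<le> 1 \<and> t - \<eta> \<le> \<tau> \<and> hausdorff_content \<tau> E0 \<noteq> 0 \<and> (\<forall>k. 12 * \<eta> * real (M * Suc k) \<le> \<theta>)"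
          using E0 t s by (intro exI[of _ E0] exI[of _ "0::real"] exI[of _ c] exI[of _ t]) auto
      qed auto
    qed
    ultimately show "\<exists>D \<subseteq> sphere (0 :: real^2) 1. lower_box_dim D = 0 \<and> packing_dim D = ereal s \<and>
            universal_for D (class_AD \<inter> class_dim_le s)"
      by (auto simp: zero_ereal_def)
  next
    fix \<epsilon> :: real assume \<epsilon>: "0 < \<epsilon> \<and> \<epsilon> < 1"
    have s: "0 \<le> s" "s \<le> 1" using assms by auto
    \<comment> \<open>A constant ratio above \<open>s / \<epsilon>\<close> already brings the
      proportion of free digits after a gap below \<open>\<epsilon>\<close>.\<close>
    obtain R0 where R0: "s / \<epsilon> < real R0" using reals_Archimedean2 by blast
    have R0pos: "1 \<le> R0"
    proof -
      have "0 < s / \<epsilon>" using assms(1) \<epsilon> by simp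
      then have "0 < real R0" using R0 by linarith
      then show ?thesis by simp
    qed
    have sR: "s \<le> \<epsilon> * real R0" using R0 \<epsilon> by (simp add: pos_divide_less_eq mult.commute less_imp_le)
    define D where "D = direction_set (window_set s (\<lambda>_. R0)) UNIV \<union> direction_set (density_set \<epsilon>) {\<omega>. finite {i. \<omega> i}}"
    have dims: "D \<subseteq> sphere 0 1" "lower_box_dim D = ereal \<epsilon>" "packing_dim D = ereal s"
    proof -
      have gap: "eventually (\<lambda>k::nat. s \<le> \<gamma> * real R0) sequentially" if "\<epsilon> < \<gamma>" for \<gamma>
      proof -
        have "\<epsilon> * real R0 \<le> \<gamma> * real R0" using that by (intro mult_right_mono) auto
        then show ?thesis using sR by simp
      qed
      show "D \<subseteq> sphere 0 1" "lower_box_dim D = ereal \<epsilon>" "packing_dim D = ereal s"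
        unfolding D_def using window_direction_set_dims[of "\<lambda>_. R0" s \<epsilon>, OF R0pos s _ _ gap] \<epsilon> by auto
    qed
    moreover have "universal_for D (class_WR \<inter> class_dim_le s)"
    proof (rule universal_for_if_dim_ge[OF dims(1) _ assms(2)])
      show "direction_set (window_set s (\<lambda>_. R0)) UNIV \<subseteq> D" by (simp add: D_def)
      fix E t assume E: "E \<in> class_WR" "hausdorff_dim E = ereal t" and t: "0 < t" "t \<le> s"
      have pd: "packing_dim E = ereal t" using E by (simp add: class_WR_def weakly_regular_def)
      show "\<exists>e\<in>direction_set (window_set s (\<lambda>_. R0)) UNIV. ereal t \<le> hausdorff_dim (proj e ` E)"
      proof (rule exists_window_direction[OF R0pos _ s t(2), where ?R0.0 = R0])
        fix \<theta> :: real and M :: nat assume \<theta>: "0 < \<theta>" and M: "1 \<le> M"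
        \<comment> \<open>The second term serves all \<open>M * R0\<close> blocks;
          \<open>t / 2\<close> keeps \<open>\<eta> < t\<close>, so that the content exponent of the
          extracted piece is positive.\<close>
        define \<eta> where "\<eta> = min (min \<theta> (\<theta> / (12 * real (M * R0)))) (t / 2)"
        have MR: "0 < 12 * real (M * R0)" using M R0pos by simp
        have \<eta>: "0 < \<eta>" "\<eta> < t" "\<eta> \<le> \<theta>" "\<eta> \<le> \<theta> / (12 * real (M * R0))" using \<theta> t(1) MR by (auto simp: \<eta>_def)
        have "\<eta> * (12 * real (M * R0)) \<le> \<theta>" using \<eta>(4) MR by (simp only: pos_le_divide_eq)
        then have \<eta>M: "12 * \<eta> * real (M * R0) \<le> \<theta>" by (simp only: mult_ac)
        have t1: "t \<le> 1" using t(2) s(2) by simp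
        obtain E0 c \<tau> where "E0 \<subseteq> E" "regular_counts E0 t \<eta> c" "0 < \<tau>" "\<tau> \<le> 1" "t - \<eta> \<le> \<tau>" "hausdorff_content \<tau> E0 \<noteq> 0"
          using weakly_regular_extraction[OF E(2) pd t1 \<eta>(1,2)] by blast
        then show "\<exists>E0 \<eta> c \<tau>. E0 \<subseteq> E \<and> regular_counts E0 t \<eta> c \<and> 0 \<le> \<eta> \<and> \<eta> \<le> \<theta> \<and>
          0 < \<tau> \<and> \<tau> \<le> 1 \<and> t - \<eta> \<le> \<tau> \<and> hausdorff_content \<tau> E0 \<noteq> 0 \<and> (\<forall>k::nat. 12 * \<eta> * real (M * R0) \<le> \<theta>)"
          using \<eta>(1,3) \<eta>M by (intro exI[of _ E0] exI[of _ \<eta>] exI[of _ c] exI[of _ \<tau>]) auto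
      qed auto
    qed
    ultimately show "\<exists>D \<subseteq> sphere (0 :: real^2) 1. lower_box_dim D = ereal \<epsilon> \<and> packing_dim D = ereal s \<and>
               universal_for D (class_WR \<inter> class_dim_le s)"
      by blast
qed

end
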